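(* The operators $\{T(a,b,r):-1<r<1\}$ on $C[-1,1]$ defined in the context have the following properties. (a) They form a multiplicative semigroup, that is, $T(a,b,r)\,T(a,b,s)=T(a,b,rs)$. (b) $T(a,b,r)$ tends to the identity operator $I$ as $r\to1^-$. (c) The eigenfunctions of $T(a,b,r)$ are $h(\cos\theta;a,b)H_n(x|q)$, $x=\cos\theta$, with eigenvalues $\lambda_n=r^n$. (d) There are operators $\mathcal{B}_q(a,b)$ such that $$\mathcal{B}_q(a,b)\,T(a,b,r)=T(a,b,rq^{-1/2}),$$ where, with $\breve f(z)=f(\cos\theta)$ and $z=e^{i\theta}$, $$\mathcal{B}_q(a,b)f=\frac{h(\cos\theta;a,b)\big[(1-q^{-1/2}az)(1-q^{-1/2}bz)\breve f(q^{1/2}z)-z^2(1-q^{-1/2}a/z)(1-q^{-1/2}b/z)\breve f(q^{-1/2}z)\big]}{h(\cos\theta;q^{-1/2}a,q^{-1/2}b)\,(q^{3/4}-q^{-1/4})(z^2-1)/2}.$$ In fact, $\mathcal{B}_q(a,b)$ also has the representation $$\mathcal{B}_q(a,b)f=\frac1{g(x;a,b)}\,\mathcal{D}_q\big(g(\cdot;a,b)f\big),\qquad g(\cos\theta;a,b)=\frac{(-q^{1/4}e^{i\theta},-q^{1/4}e^{-i\theta};q^{1/2})_\infty}{h(\cos\theta;a,b)},$$ where $\mathcal{D}_q$ is the Askey--Wilson operator.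
   Context: Throughout $0<q<1$, $(A;p)_\infty=\prod_{k\ge0}(1-Ap^k)$, $(A_1,\dots,A_m;p)_\infty=\prod_j(A_j;p)_\infty$, and $h(\cos\theta;a_1,\dots,a_n)=\prod_{j=1}^n(a_je^{i\theta},a_je^{-i\theta};q)_\infty$. The continuous $q$-Hermite polynomials $H_n(x|q)$, $n=0,1,2,\dots$, are given by $H_0=1$, $H_1(x|q)=2x$, $2xH_n(x|q)=H_{n+1}(x|q)+(1-q^n)H_{n-1}(x|q)$. Their normalized weight is $w_H(x|q)=\frac{(q,e^{2i\theta},e^{-2i\theta};q)_\infty}{2\pi\sqrt{1-x^2}}$, $x=\cos\theta$. For $f\in C[-1,1]$, $$(T(a,b,r)f)(\cos\theta)=h(\cos\theta;a,b)\,(r^2;q)_\infty\int_0^\pi\frac{w_H(\cos\phi|q)f(\cos\phi)\sin\phi\,d\phi}{h(\cos\phi;re^{i\theta},re^{-i\theta})\,h(\cos\phi;a,b)}.$$ The Askey--Wilson operator is defined, with $x=(z+1/z)/2$ and $\breve f(z)=f(x)$, by $$(\mathcal{D}_qf)(x)=\frac{\breve f(q^{1/2}z)-\breve f(q^{-1/2}z)}{(q^{1/2}-q^{-1/2})(z-1/z)/2}.$$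
   Formalization: In (d) the relation is corrected to ((1-q)/(2q^{1/4})) B_q T(a,b,r) = T(a,b,rq^{-1/2}), for |r|<q^{1/2}, off zeros of the denominator or as a limit; h(x;a,b)≠0 on [-1,1] is assumed; (b) is strong convergence; in (c), that there are no other eigenfunctions is for r≠0. *)

theory Defs
  imports "HOL-Analysis.Analysis"
begin

definition qpoch :: "complex \<Rightarrow> real \<Rightarrow> complex" where
  "qpoch A p = (\<Prod>k. 1 - A * of_real p ^ k)"

text \<open>
  Functions of \<open>x\<close> that are written in terms of \<open>z\<close>, where \<open>x = (z + 1/z)/2\<close>, are evaluated at
  \<open>z = zpt x\<close>.  All of them are invariant under the exchange of \<open>z\<close> and \<open>1/z\<close>, so the branch does
  not matter; see \<open>zpt_cases\<close>, \<open>hfun_cos\<close>, \<open>AW_joukowski\<close> and \<open>Bq_joukowski\<close> below.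
  For real \<open>x \<in> [-1,1]\<close> one has \<open>zpt x = exp (i arccos x)\<close>.
\<close>

definition zpt :: "complex \<Rightarrow> complex" where
  "zpt x = exp (\<i> * Arccos x)"

definition joukowski :: "complex \<Rightarrow> complex" where
  "joukowski z = (z + 1 / z) / 2"

text \<open>\<open>hfun q [a\<^sub>1, \<dots>, a\<^sub>n] x\<close> is \<open>h(x; a\<^sub>1, \<dots>, a\<^sub>n)\<close>, for complex \<open>x\<close>.\<close>

definition hfun :: "real \<Rightarrow> complex list \<Rightarrow> complex \<Rightarrow> complex" where
  "hfun q as x = (\<Prod>a\<leftarrow>as. qpoch (a * zpt x) q * qpoch (a / zpt x) q)"

fun qHermite :: "real \<Rightarrow> nat \<Rightarrow> real \<Rightarrow> real" where
  "qHermite q 0 x = 1"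
| "qHermite q (Suc 0) x = 2 * x"
| "qHermite q (Suc (Suc n)) x =
     2 * x * qHermite q (Suc n) x - (1 - q ^ Suc n) * qHermite q n x"

definition wH :: "real \<Rightarrow> real \<Rightarrow> complex" where
  "wH q x = qpoch (of_real q) q * qpoch (zpt (of_real x) ^ 2) q * qpoch (1 / zpt (of_real x) ^ 2) q
            / of_real (2 * pi * sqrt (1 - x\<^sup>2))"

text \<open>An element of \<open>C[-1,1]\<close> is a function \<open>real \<Rightarrow> complex\<close> that is continuous on \<open>{-1..1}\<close>; its
  values elsewhere are irrelevant.\<close>

definition Tq :: "real \<Rightarrow> complex \<Rightarrow> complex \<Rightarrow> real \<Rightarrow> (real \<Rightarrow> complex) \<Rightarrow> real \<Rightarrow> complex" where
  "Tq q a b r f x =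
     hfun q [a, b] (of_real x) * qpoch (of_real (r\<^sup>2)) q *
     integral {0..pi} (\<lambda>\<phi>.
       wH q (cos \<phi>) * f (cos \<phi>) * of_real (sin \<phi>) /
       (hfun q [of_real r * zpt (of_real x), of_real r / zpt (of_real x)] (of_real (cos \<phi>))
        * hfun q [a, b] (of_real (cos \<phi>))))"

definition eigenfunction ::
  "((real \<Rightarrow> complex) \<Rightarrow> real \<Rightarrow> complex) \<Rightarrow> complex \<Rightarrow> (real \<Rightarrow> complex) \<Rightarrow> bool" where
  "eigenfunction T \<mu> f \<longleftrightarrow>
     continuous_on {-1..1} f \<and> (\<exists>x\<in>{-1..1}. f x \<noteq> 0) \<and> (\<forall>x\<in>{-1..1}. T f x = \<mu> * f x)"

text \<open>
  For \<open>x \<in> [-1,1]\<close> the operators below evaluate their argument at \<open>joukowski (q\<^sup>\<plusminus>\<^sup>1\<^sup>/\<^sup>2 z)\<close> with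
  \<open>\<bar>z\<bar> = 1\<close>, that is, on the boundary of the following ellipse with foci \<open>\<plusminus>1\<close>.  They therefore act
  on the analytic continuation \<open>F\<close> of \<open>f\<close>, which is unique on the ellipse if it exists.
\<close>

definition qellipse :: "real \<Rightarrow> complex set" where
  "qellipse q = joukowski ` {z. q powr (1/2) \<le> norm z \<and> norm z \<le> q powr (-1/2)}"

definition analytic_ext :: "real \<Rightarrow> (real \<Rightarrow> complex) \<Rightarrow> (complex \<Rightarrow> complex) \<Rightarrow> bool" where
  "analytic_ext q f F \<longleftrightarrow> F analytic_on qellipse q \<and> (\<forall>x\<in>{-1..1}. F (of_real x) = f x)"

definition AW :: "real \<Rightarrow> (complex \<Rightarrow> complex) \<Rightarrow> complex \<Rightarrow> complex" where
  "AW q F x = (let z = zpt x in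
     (F (joukowski (of_real (q powr (1/2)) * z)) - F (joukowski (of_real (q powr (-1/2)) * z))) /
     (of_real (q powr (1/2) - q powr (-1/2)) * (z - 1 / z) / 2))"

definition Bq :: "real \<Rightarrow> complex \<Rightarrow> complex \<Rightarrow> (complex \<Rightarrow> complex) \<Rightarrow> complex \<Rightarrow> complex" where
  "Bq q a b F x = (let z = zpt x; s = of_real (q powr (-1/2)) in
     hfun q [a, b] x *
     ((1 - s * a * z) * (1 - s * b * z) * F (joukowski (of_real (q powr (1/2)) * z))
      - z\<^sup>2 * (1 - s * a / z) * (1 - s * b / z) * F (joukowski (of_real (q powr (-1/2)) * z))) /
     (hfun q [s * a, s * b] x * of_real (q powr (3/4) - q powr (-1/4)) * (z\<^sup>2 - 1) / 2))"

definition gfun :: "real \<Rightarrow> complex \<Rightarrow> complex \<Rightarrow> complex \<Rightarrow> complex" where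
  "gfun q a b x =
     qpoch (- of_real (q powr (1/4)) * zpt x) (q powr (1/2)) *
     qpoch (- of_real (q powr (1/4)) / zpt x) (q powr (1/2)) / hfun q [a, b] x"

lemma zpt_nonzero [simp]: "zpt x \<noteq> 0"
  by (simp add: zpt_def)

lemma joukowski_zpt [simp]: "joukowski (zpt x) = x"
proof -
  have "joukowski (zpt x) = cos (Arccos x)"
    by (simp add: joukowski_def zpt_def cos_exp_eq exp_minus inverse_eq_divide)
  then show ?thesis by simp
qed

lemma joukowski_inverse: "joukowski (1 / z) = joukowski z"
  by (simp add: joukowski_def add.commute)

lemma zpt_cases:
  assumes "z \<noteq> 0"
  shows "zpt (joukowski z) = z \<or> zpt (joukowski z) = 1 / z"
proof -
  define w where "w = zpt (joukowski z)"
  have w0: "w \<noteq> 0" by (simp add: w_def)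
  have "joukowski w = joukowski z" by (simp add: w_def)
  then have "w + 1 / w = z + 1 / z" unfolding joukowski_def by (metis divide_cancel_right zero_neq_numeral)
  then have "(w - z) * (w * z - 1) = 0"
    using assms w0 by (simp add: field_simps)
  then have "w = z \<or> w * z = 1" by simp
  then show ?thesis using assms unfolding w_def[symmetric] by (auto simp: field_simps)
qed

lemma zpt_of_real:
  assumes "x \<in> {-1..1}"
  shows "zpt (of_real x) = exp (\<i> * of_real (arccos x))"
  using assms by (simp add: zpt_def of_real_arccos abs_le_iff)

lemma hfun_joukowski:
  assumes "z \<noteq> 0"
  shows "hfun q as (joukowski z) = (\<Prod>a\<leftarrow>as. qpoch (a * z) q * qpoch (a / z) q)"
  using zpt_cases[OF assms] by (auto simp: hfun_def mult.commute)

lemma hfun_cos: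
  "hfun q as (cos \<theta>) =
     (\<Prod>a\<leftarrow>as. qpoch (a * exp (\<i> * \<theta>)) q * qpoch (a * exp (- (\<i> * \<theta>))) q)"
proof -
  have "cos \<theta> = joukowski (exp (\<i> * \<theta>))"
    by (simp add: joukowski_def cos_exp_eq exp_minus inverse_eq_divide)
  then show ?thesis
    by (simp add: hfun_joukowski exp_minus divide_inverse)
qed

lemma joukowski_powr_swap:
  assumes "q > 0"
  shows "joukowski (of_real (q powr (1/2)) * (1 / z)) = joukowski (of_real (q powr (-1/2)) * z)"
    and "joukowski (of_real (q powr (-1/2)) * (1 / z)) = joukowski (of_real (q powr (1/2)) * z)"
proof -
  have "q powr (-1/2) = 1 / q powr (1/2)"
    by (simp add: powr_minus_divide)
  then show "joukowski (of_real (q powr (1/2)) * (1 / z)) = joukowski (of_real (q powr (-1/2)) * z)"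
    and "joukowski (of_real (q powr (-1/2)) * (1 / z)) = joukowski (of_real (q powr (1/2)) * z)"
    using joukowski_inverse[of "of_real (q powr (1/2)) / z"]
      joukowski_inverse[of "of_real (q powr (1/2)) * z"]
    by auto
qed

lemma AW_joukowski:
  assumes "q > 0" "z \<noteq> 0"
  shows "AW q F (joukowski z) =
    (F (joukowski (of_real (q powr (1/2)) * z)) - F (joukowski (of_real (q powr (-1/2)) * z))) /
    (of_real (q powr (1/2) - q powr (-1/2)) * (z - 1 / z) / 2)"
  using zpt_cases[OF assms(2)]
proof
  assume "zpt (joukowski z) = z"
  then show ?thesis by (simp add: AW_def)
next
  assume w: "zpt (joukowski z) = 1 / z"
  have "(A - B) / (c * (1 / z - 1 / (1 / z)) / 2) = (B - A) / (c * (z - 1 / z) / 2)" for A B c :: complex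
  proof -
    have "c * (1 / z - 1 / (1 / z)) / 2 = - (c * (z - 1 / z) / 2)"
      by (simp add: algebra_simps diff_divide_distrib)
    then show ?thesis by (metis minus_diff_eq minus_divide_divide)
  qed
  then show ?thesis
    unfolding AW_def Let_def w joukowski_powr_swap[OF assms(1)] by blast
qed

lemma Bq_joukowski:
  fixes s :: complex
  assumes "q > 0" "z \<noteq> 0"
  defines "s \<equiv> of_real (q powr (-1/2))"
  shows "Bq q a b F (joukowski z) =
    hfun q [a, b] (joukowski z) *
    ((1 - s * a * z) * (1 - s * b * z) * F (joukowski (of_real (q powr (1/2)) * z))
     - z\<^sup>2 * (1 - s * a / z) * (1 - s * b / z) * F (joukowski (of_real (q powr (-1/2)) * z))) /
    (hfun q [s * a, s * b] (joukowski z) * of_real (q powr (3/4) - q powr (-1/4)) * (z\<^sup>2 - 1) / 2)"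
  using zpt_cases[OF assms(2)]
proof
  assume "zpt (joukowski z) = z"
  then show ?thesis unfolding Bq_def Let_def s_def by (simp only:)
next
  assume w: "zpt (joukowski z) = 1 / z"
  have *: "H * ((1 - s * a * (1 / z)) * (1 - s * b * (1 / z)) * B
          - (1 / z)\<^sup>2 * (1 - s * a / (1 / z)) * (1 - s * b / (1 / z)) * A) /
        (K * c * ((1 / z)\<^sup>2 - 1) / 2) =
      H * ((1 - s * a * z) * (1 - s * b * z) * A
          - z\<^sup>2 * (1 - s * a / z) * (1 - s * b / z) * B) / (K * c * (z\<^sup>2 - 1) / 2)"
    for A B H K c :: complex
  proof -
    define N where "N = H * ((1 - s * a * z) * (1 - s * b * z) * A
          - z\<^sup>2 * (1 - s * a / z) * (1 - s * b / z) * B)"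
    define D where "D = K * c * (z\<^sup>2 - 1) / 2"
    have "H * ((1 - s * a * (1 / z)) * (1 - s * b * (1 / z)) * B
          - (1 / z)\<^sup>2 * (1 - s * a / (1 / z)) * (1 - s * b / (1 / z)) * A) = (- 1 / z\<^sup>2) * N"
      using assms(2) by (simp add: N_def field_simps power2_eq_square)
    moreover have "K * c * ((1 / z)\<^sup>2 - 1) / 2 = (- 1 / z\<^sup>2) * D"
      using assms(2) by (simp add: D_def field_simps power2_eq_square)
    moreover have "(- 1 / z\<^sup>2) * N / ((- 1 / z\<^sup>2) * D) = N / D"
      using assms(2) by (intro mult_divide_mult_cancel_left) simp
    ultimately show ?thesis unfolding N_def D_def by simp
  qed
  show ?thesis
    unfolding Bq_def Let_def w joukowski_powr_swap[OF assms(1)] unfolding s_def[symmetric] by (rule *)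
qed

end

theory Submission
  imports Defs "HOL-Complex_Analysis.Complex_Analysis"
begin

text \<open>
  Dividing by \<open>h(x; a, b)\<close> turns \<open>T(a, b, r)\<close> into the operator with the \<open>q\<close>-Mehler kernel
  \<open>K\<^sub>r(x, y) = (r\<^sup>2; q)\<^sub>\<infinity> / (r e\<^sup>\<plusminus>\<^sup>i\<^sup>\<theta>\<^sup>\<plusminus>\<^sup>i\<^sup>\<phi>; q)\<^sub>\<infinity>\<close>, so everything follows once this operator multiplies \<open>H\<^sub>n\<close>
  by \<open>r\<^sup>n\<close>.  No product or series identity (Jacobi triple product, Mehler formula) is needed for that.
  Put \<open>p = q\<^sup>1\<^sup>/\<^sup>2\<close> and \<open>(D G)(z) = (G(p z) - z\<^sup>2 G(z / p)) / (1 - z\<^sup>2)\<close>.  Then \<open>D K\<^sub>p\<^sub>r = K\<^sub>r\<close> is an elementary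
  identity, which also yields the intertwining relation (d); \<open>D H\<^sub>n = p\<^sup>-\<^sup>n H\<^sub>n\<close>; and \<open>D\<close> is symmetric
  for the weight, by a shift of the contour.  Hence \<open>u(r) = (T\<^sub>r H\<^sub>n)(x)\<close> satisfies \<open>u(p r) = p\<^sup>n u(r)\<close>, and as it is
  holomorphic in \<open>\<bar>r\<bar> < 1\<close>, it equals \<open>c r\<^sup>n\<close>.  The constant is found by letting \<open>r \<rightarrow> 1\<close>: for \<open>0 < \<theta> < \<pi>\<close>,
  \<open>K\<^sub>r\<close> times the weight is the Poisson kernel times a function that is continuous up to \<open>r = 1\<close>.

  Since the kernel is positive and preserves \<open>H\<^sub>0 = 1\<close>, the operators are contractions, and (a) and (b) follow
  from the density of the span of the \<open>H\<^sub>n\<close>; the symmetry of the kernel and completeness give (c).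
\<close>

section \<open>Integrals depending on a parameter and over circles\<close>

text \<open>The operator \<open>D\<close> is \<open>Bq\<close> seen through division by
  \<open>h\<close>: the factors \<open>1 - q^(-1/2) a z\<close> and their companions turn
  \<open>h\<close> at either shifted point into the common value
  \<open>h(x; q^(-1/2) a, q^(-1/2) b)\<close>, which the denominator cancels. The constant
  \<open>2 q^(1/4) / (1 - q)\<close> that remains stems from
  \<open>q^(3/4) - q^(-1/4) = -(1 - q) / q^(1/4)\<close>. The contour shift needs room: both
  functions must be holomorphic on an annulus reaching beyond the radii \<open>p\<close> and
  \<open>1 / p\<close>. In \<open>z\<close> the kernel is singular from modulus \<open>|r|\<close>
  inwards and from \<open>1 / |r|\<close> outwards, so \<open>D\<close> is applied to the kernel
  with parameter \<open>p r\<close>, \<open>|r| < 1\<close>, and the scaling relation leads from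
  \<open>p r\<close> to \<open>r\<close>. It determines the dependence on \<open>r\<close> only
  because \<open>r\<close> is complex and Taylor coefficients at 0 can be compared. At
  \<open>\<theta> = 0\<close> or \<open>pi\<close> the singularities at
  \<open>\<phi> = \<theta>\<close> and \<open>\<phi> = -\<theta>\<close> merge and the Poisson
  argument breaks down; these endpoints are reached by continuity. Since \<open>D\<close> evaluates
  functions off \<open>[-1, 1]\<close>, all dependence on \<open>x\<close> is written through entire
  functions of \<open>x\<close>.\<close>

text \<open>By Morera it suffices that triangle integrals vanish. Joint continuity allows the order
  of integration to be exchanged, and Cauchy's theorem applies for each fixed \<open>t\<close>. The
  lemma serves both the parameter \<open>r\<close> and the variable \<open>x\<close> of the
  kernel.\<close>

lemma analytic_on_parameter_integral:
  fixes F :: "complex \<Rightarrow> real \<Rightarrow> complex"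
  assumes U: "open U"
    and cont: "continuous_on (U \<times> {\<alpha>..\<beta>}) (\<lambda>(s, t). F s t)"
    and hol: "\<And>t. t \<in> {\<alpha>..\<beta>} \<Longrightarrow> (\<lambda>s. F s t) holomorphic_on U"
  shows "(\<lambda>s. integral {\<alpha>..\<beta>} (F s)) analytic_on U"
proof (rule Morera_local_triangle_ball)
  fix z assume "z \<in> U"
  then obtain e where e: "e > 0" "ball z e \<subseteq> U" using U openE by blast
  have contI: "continuous_on U (\<lambda>s. integral {\<alpha>..\<beta>} (F s))"
    using integral_continuous_on_param[of U \<alpha> \<beta> F] cont by simp
  have seg: "contour_integral (linepath b c) (\<lambda>s. integral {\<alpha>..\<beta>} (F s)) =
      integral {\<alpha>..\<beta>} (\<lambda>t. contour_integral (linepath b c) (\<lambda>s. F s t))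
      \<and> (\<lambda>t. contour_integral (linepath b c) (\<lambda>s. F s t)) integrable_on {\<alpha>..\<beta>}"
    if bc: "closed_segment b c \<subseteq> ball z e" for b c
  proof -
    define G where "G = (\<lambda>(x::real) (t::real). F (linepath b c x) t * (c - b))"
    have lp: "linepath b c x \<in> U" if "x \<in> {0..1}" for x
      using that bc e(2) by (metis linepath_in_path subset_iff)
    have cG: "continuous_on ({0..1} \<times> {\<alpha>..\<beta>}) (\<lambda>(x, t). G x t)"
    proof -
      have "continuous_on ({0..1} \<times> {\<alpha>..\<beta>}) ((\<lambda>(s, t). F s t) \<circ> (\<lambda>(x, t). (linepath b c x, t)))"
      proof (rule continuous_on_compose)
        show "continuous_on ({0..1} \<times> {\<alpha>..\<beta>}) (\<lambda>(x, t). (linepath b c x, t))"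
          unfolding case_prod_unfold linepath_def by (intro continuous_intros)
        show "continuous_on ((\<lambda>(x, t). (linepath b c x, t)) ` ({0..1} \<times> {\<alpha>..\<beta>})) (\<lambda>(s, t). F s t)"
          by (rule continuous_on_subset[OF cont]) (use lp in auto)
      qed
      then show ?thesis unfolding G_def case_prod_unfold o_def by (intro continuous_intros) auto
    qed
    have "contour_integral (linepath b c) (\<lambda>s. integral {\<alpha>..\<beta>} (F s))
        = integral {0..1} (\<lambda>x. integral {\<alpha>..\<beta>} (G x))"
      unfolding contour_integral_integral vector_derivative_linepath_at G_def
      by (intro integral_cong) simp
    also have "\<dots> = integral {\<alpha>..\<beta>} (\<lambda>t. integral {0..1} (\<lambda>x. G x t))"
      using integral_swap_continuous[of 0 \<alpha> 1 \<beta> G] cG by (simp add: cbox_Pair_eq)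
    also have "(\<lambda>t. integral {0..1} (\<lambda>x. G x t)) = (\<lambda>t. contour_integral (linepath b c) (\<lambda>s. F s t))"
      unfolding contour_integral_integral vector_derivative_linepath_at G_def by simp
    finally have eq: "contour_integral (linepath b c) (\<lambda>s. integral {\<alpha>..\<beta>} (F s)) =
      integral {\<alpha>..\<beta>} (\<lambda>t. contour_integral (linepath b c) (\<lambda>s. F s t))" .
    have "continuous_on {\<alpha>..\<beta>} (\<lambda>t. integral {0..1} (\<lambda>x. G x t))"
    proof -
      have "continuous_on ({\<alpha>..\<beta>} \<times> {0..1}) ((\<lambda>(x, t). G x t) \<circ> (\<lambda>(t, x). (x, t)))"
        by (rule continuous_on_compose)
           (auto simp: case_prod_unfold
              intro!: continuous_intros continuous_on_subset[OF cG[unfolded case_prod_unfold]])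
      then have "continuous_on ({\<alpha>..\<beta>} \<times> cbox 0 1) (\<lambda>(t, x). G x t)"
        by (simp add: o_def case_prod_unfold)
      then show ?thesis using integral_continuous_on_param[of "{\<alpha>..\<beta>}" 0 1 "\<lambda>t x. G x t"] by simp
    qed
    then have "(\<lambda>t. integral {0..1} (\<lambda>x. G x t)) integrable_on {\<alpha>..\<beta>}"
      by (rule integrable_continuous_real)
    with eq show ?thesis
      unfolding contour_integral_integral vector_derivative_linepath_at G_def by simp
  qed
  show "\<exists>e a. 0 < e \<and> z \<in> ball a e \<and> continuous_on (ball a e) (\<lambda>s. integral {\<alpha>..\<beta>} (F s)) \<and>
      (\<forall>b c. closed_segment b c \<subseteq> ball a e \<longrightarrow>
        contour_integral (linepath a b) (\<lambda>s. integral {\<alpha>..\<beta>} (F s)) +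
        contour_integral (linepath b c) (\<lambda>s. integral {\<alpha>..\<beta>} (F s)) +
        contour_integral (linepath c a) (\<lambda>s. integral {\<alpha>..\<beta>} (F s)) = 0)"
  proof (intro exI conjI allI impI)
    fix b c assume bc: "closed_segment b c \<subseteq> ball z e"
    have zb: "closed_segment z b \<subseteq> ball z e" and cz: "closed_segment c z \<subseteq> ball z e"
      using subsetD[OF bc ends_in_segment(1)] subsetD[OF bc ends_in_segment(2)] e(1)
      by (intro closed_segment_subset; simp)+
    have tri: "contour_integral (linepath z b) (\<lambda>s. F s t) + contour_integral (linepath b c) (\<lambda>s. F s t)
       + contour_integral (linepath c z) (\<lambda>s. F s t) = 0" if "t \<in> {\<alpha>..\<beta>}" for t
    proof -
      have "convex hull {z, b, c} \<subseteq> ball z e"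
        using bc e(1) by (intro hull_minimal) (use subsetD[OF bc ends_in_segment(1)] subsetD[OF bc ends_in_segment(2)] in auto)
      then have "(\<lambda>s. F s t) holomorphic_on (convex hull {z, b, c})"
        using hol[OF that] e(2) by (meson holomorphic_on_subset order_trans)
      then have h: "((\<lambda>s. F s t) has_contour_integral 0) (linepath z b +++ linepath b c +++ linepath c z)"
        by (rule Cauchy_theorem_triangle)
      have ci: "(\<lambda>s. F s t) contour_integrable_on linepath u v" if "closed_segment u v \<subseteq> ball z e" for u v
        by (intro contour_integrable_continuous_linepath
              continuous_on_subset[OF holomorphic_on_imp_continuous_on[OF hol[OF \<open>t \<in> _\<close>]]])
           (use that e(2) in blast)
      show ?thesis
        using contour_integral_unique[OF h] ci[OF zb] ci[OF bc] ci[OF cz] by (simp add: add.assoc)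
    qed
    show "contour_integral (linepath z b) (\<lambda>s. integral {\<alpha>..\<beta>} (F s)) +
        contour_integral (linepath b c) (\<lambda>s. integral {\<alpha>..\<beta>} (F s)) +
        contour_integral (linepath c z) (\<lambda>s. integral {\<alpha>..\<beta>} (F s)) = 0" (is "?l = 0")
    proof -
      have "?l = integral {\<alpha>..\<beta>} (\<lambda>t. contour_integral (linepath z b) (\<lambda>s. F s t) +
          contour_integral (linepath b c) (\<lambda>s. F s t) + contour_integral (linepath c z) (\<lambda>s. F s t))"
        using seg[OF zb] seg[OF bc] seg[OF cz] by (simp add: integral_add integrable_add)
      also have "\<dots> = integral {\<alpha>..\<beta>} (\<lambda>t. 0)" by (intro integral_cong tri)
      finally show ?thesis by simp
    qed
  qed (use e contI in \<open>auto intro: continuous_on_subset\<close>)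
qed

text \<open>Up to \<open>2 pi i\<close> the mean over a circle is the contour integral of
  \<open>\<Phi> z / z\<close>, and concentric circles in the annulus are homotopic along radial
  segments.\<close>

lemma circle_integral_annulus:
  fixes \<Phi> :: "complex \<Rightarrow> complex"
  assumes hol: "\<Phi> holomorphic_on {z. \<rho>1 < norm z \<and> norm z < \<rho>2}"
    and \<rho>: "0 < \<rho>1" "\<rho>1 < R" "R < \<rho>2" "\<rho>1 < R'" "R' < \<rho>2"
  shows "integral {0..1} (\<lambda>t. \<Phi> (of_real R * exp (2 * of_real pi * \<i> * of_real t))) =
         integral {0..1} (\<lambda>t. \<Phi> (of_real R' * exp (2 * of_real pi * \<i> * of_real t)))"
proof -
  define S where "S = {z::complex. \<rho>1 < norm z \<and> norm z < \<rho>2}"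
  have "open S" unfolding S_def by (intro open_Collect_conj open_Collect_less continuous_intros)
  have hol': "(\<lambda>z. \<Phi> z / z) holomorphic_on S"
    using hol \<rho> unfolding S_def[symmetric] by (intro holomorphic_intros) (auto simp: S_def)
  have "homotopic_loops S (circlepath 0 R) (circlepath 0 R')"
  proof (rule homotopic_loops_linear)
    fix t :: real and x :: complex
    show "closed_segment (circlepath 0 R t) (circlepath 0 R' t) \<subseteq> S"
    proof
      fix w assume "w \<in> closed_segment (circlepath 0 R t) (circlepath 0 R' t)"
      then obtain u where u: "0 \<le> u" "u \<le> 1"
        and w: "w = (1 - u) *\<^sub>R circlepath 0 R t + u *\<^sub>R circlepath 0 R' t"
        by (auto simp: in_segment)
      have "w = of_real ((1 - u) * R + u * R') * exp (2 * of_real pi * \<i> * of_real t)"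
        unfolding w circlepath by (simp add: algebra_simps scaleR_conv_of_real)
      then have "norm w = \<bar>(1 - u) * R + u * R'\<bar>"
        using norm_mult[of "of_real ((1 - u) * R + u * R')" "exp (2 * of_real pi * \<i> * of_real t)"]
        by (simp only: norm_of_real norm_exp_eq_Re) simp
      moreover have "(1 - u) * R + u * R' \<in> {\<rho>1<..<\<rho>2}"
        using convexD_alt[of "{\<rho>1<..<\<rho>2}" R R' u] u \<rho> by simp
      ultimately show "w \<in> S" using \<rho> by (simp add: S_def)
    qed
  qed auto
  then have "contour_integral (circlepath 0 R) (\<lambda>z. \<Phi> z / z) = contour_integral (circlepath 0 R') (\<lambda>z. \<Phi> z / z)"
    by (rule Cauchy_theorem_homotopic_loops[OF _ \<open>open S\<close> hol']) auto
  moreover have "contour_integral (circlepath 0 R) (\<lambda>z. \<Phi> z / z) =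
      2 * of_real pi * \<i> * integral {0..1} (\<lambda>t. \<Phi> (of_real R * exp (2 * of_real pi * \<i> * of_real t)))"
    if "R > 0" for R
  proof -
    have "contour_integral (circlepath 0 R) (\<lambda>z. \<Phi> z / z) =
      integral {0..1} (\<lambda>t. (2 * of_real pi * \<i>) * \<Phi> (of_real R * exp (2 * of_real pi * \<i> * of_real t)))"
      unfolding contour_integral_integral
      using that by (intro integral_cong) (simp only: vector_derivative_circlepath, simp add: circlepath)
    then show ?thesis by simp
  qed
  ultimately show ?thesis using \<rho> by simp
qed

text \<open>By periodicity, inversion of the unit circle is the reflection
  \<open>t \<mapsto> 1 - t\<close>.\<close>

lemma circle_integral_inverse:
  fixes \<Phi> :: "complex \<Rightarrow> complex"
  shows "integral {0..1} (\<lambda>t. \<Phi> (1 / exp (2 * of_real pi * \<i> * of_real t))) =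
         integral {0..1} (\<lambda>t. \<Phi> (exp (2 * of_real pi * \<i> * of_real t)))"
proof -
  define f where "f = (\<lambda>t::real. \<Phi> (exp (2 * of_real pi * \<i> * of_real t)))"
  have per: "f (1 - t) = \<Phi> (1 / exp (2 * of_real pi * \<i> * of_real t))" for t
    unfolding f_def by (simp add: algebra_simps exp_diff)
  have "integral {0..1} (\<lambda>t. f (1 - t)) = integral {0..1} f"
  proof -
    have "integral {-1..0} (\<lambda>t. f (1 + t)) = integral {0..1} f"
      using integral_shift_Icc_real[of "-1" 0 f 1] by (simp add: o_def)
    moreover have "integral {-1..-0} (\<lambda>t. f (1 - (-t))) = integral {0..1} (\<lambda>t. f (1 - t))"
      using Henstock_Kurzweil_Integration.integral_reflect_real[of 1 0 "\<lambda>t. f (1 - t)"] by simp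
    ultimately show ?thesis by simp
  qed
  then show ?thesis unfolding per unfolding f_def .
qed

section \<open>Infinite products\<close>

text \<open>Contains both \<open>(A; q)\<^sub>\<infinity>\<close> and, as an entire function of \<open>x = (z + 1/z)/2\<close>, the product
  \<open>(a z, a/z; q)\<^sub>\<infinity>\<close>; in this form no branch of \<open>z\<close> occurs.\<close>

definition qprod2 :: "real \<Rightarrow> complex \<Rightarrow> complex \<Rightarrow> complex" where
  "qprod2 q u v = (\<Prod>k. 1 + u * of_real q ^ k + v * (of_real q ^ k)\<^sup>2)"

text \<open>The factors of index \<open>k\<close> in \<open>(a z; q)\<close> and
  \<open>(a / z; q)\<close> multiply to \<open>1 - 2 x a q^k + a^2 q^(2k)\<close>, which contains
  \<open>z\<close> only through \<open>x\<close>.\<close>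

definition hsym :: "real \<Rightarrow> complex \<Rightarrow> complex \<Rightarrow> complex" where
  "hsym q a x = qprod2 q (- 2 * x * a) (a\<^sup>2)"

lemma qpoch_conv_qprod2: "qpoch A q = qprod2 q (- A) 0"
  by (simp add: qpoch_def qprod2_def)

context
  fixes q :: real
  assumes q: "0 < q" "q < 1"
begin

lemma norm_qprod2_term:
  "norm (u * of_real q ^ k + v * (of_real q ^ k)\<^sup>2 :: complex) \<le> (norm u + norm v) * q ^ k"
proof -
  have "(q ^ k)\<^sup>2 \<le> q ^ k" using q by (simp add: power2_eq_square mult_left_le power_le_one)
  moreover have "norm (u * of_real q ^ k + v * (of_real q ^ k)\<^sup>2 :: complex)
      \<le> norm u * q ^ k + norm v * (q ^ k)\<^sup>2"
    by (rule norm_triangle_le) (use q in \<open>simp add: norm_mult norm_power\<close>)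
  ultimately have "norm (u * of_real q ^ k + v * (of_real q ^ k)\<^sup>2 :: complex)
      \<le> norm u * q ^ k + norm v * q ^ k"
    by (meson add_left_mono mult_left_mono norm_ge_zero order_trans)
  then show ?thesis by (simp add: algebra_simps)
qed

lemma summable_qprod2_bound: "summable (\<lambda>k. C * q ^ k)"
  using q by (intro summable_mult summable_geometric) auto

lemma convergent_prod_qprod2: "convergent_prod (\<lambda>k. 1 + u * of_real q ^ k + v * (of_real q ^ k)\<^sup>2 :: complex)"
proof -
  have "summable (\<lambda>k. norm (1 + u * of_real q ^ k + v * (of_real q ^ k)\<^sup>2 - 1 :: complex))"
    using norm_qprod2_term[of u _ v]
    by (intro summable_comparison_test'[OF summable_qprod2_bound]) (simp add: add.assoc)
  then show ?thesis
    by (intro abs_convergent_prod_imp_convergent_prod summable_imp_abs_convergent_prod)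
qed

lemma qprod2_LIMSEQ:
  "(\<lambda>n. \<Prod>k<n. 1 + u * of_real q ^ k + v * (of_real q ^ k)\<^sup>2) \<longlonglongrightarrow> qprod2 q u v"
  using convergent_prod_LIMSEQ[OF convergent_prod_qprod2, of u v]
  unfolding qprod2_def lessThan_Suc_atMost[symmetric]
  by (subst (asm) filterlim_sequentially_Suc)

text \<open>Uniformity in both coefficients jointly yields continuity in two variables and, after
  substitution of functions, holomorphy. The majorant of the M-test is
  \<open>2 R q^k\<close>.\<close>

lemma qprod2_uniform_limit:
  "uniform_limit (cball 0 R \<times> cball 0 R)
     (\<lambda>n (u, v). \<Prod>k<n. 1 + u * of_real q ^ k + v * (of_real q ^ k)\<^sup>2) (\<lambda>(u, v). qprod2 q u v) sequentially"
proof -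
  define f where "f = (\<lambda>k (p::complex \<times> complex). 1 + fst p * of_real q ^ k + snd p * (of_real q ^ k)\<^sup>2)"
  let ?A = "cball (0::complex) R \<times> cball (0::complex) R"
  have "uniformly_convergent_on ?A (\<lambda>N x. \<Prod>n<N. f n x)"
  proof (rule Infinite_Products.uniformly_convergent_on_prod')
    show "continuous_on ?A (f n)" for n unfolding f_def by (intro continuous_intros)
    show "compact ?A" by (intro compact_Times compact_cball)
    show "uniformly_convergent_on ?A (\<lambda>N x. \<Sum>n<N. norm (f n x - 1))"
    proof (rule Weierstrass_m_test'[OF _ summable_qprod2_bound[of "2 * R"]])
      fix k p assume "p \<in> ?A"
      then have "norm (fst p) + norm (snd p) \<le> 2 * R" by auto
      then have "(norm (fst p) + norm (snd p)) * q ^ k \<le> 2 * R * q ^ k"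
        using q by (intro mult_right_mono) auto
      then show "norm (norm (f k p - 1)) \<le> 2 * R * q ^ k"
        using norm_qprod2_term[of "fst p" k "snd p"] by (simp add: f_def add.assoc)
    qed
  qed
  then obtain l where l: "uniform_limit ?A (\<lambda>N x. \<Prod>n<N. f n x) l sequentially"
    by (auto simp: uniformly_convergent_on_def)
  have "l p = qprod2 q (fst p) (snd p)" if "p \<in> ?A" for p
    using LIMSEQ_unique[OF tendsto_uniform_limitI[OF l that]] qprod2_LIMSEQ[of "fst p" "snd p"]
    unfolding f_def by blast
  then have "uniform_limit ?A (\<lambda>N x. \<Prod>n<N. f n x) (\<lambda>p. qprod2 q (fst p) (snd p)) sequentially"
    by (intro iffD1[OF uniform_limit_cong' l]) simp_all
  then show ?thesis by (simp add: f_def case_prod_unfold)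
qed

lemma continuous_on_qprod2_UNIV: "continuous_on UNIV (\<lambda>(u, v). qprod2 q u v)"
proof -
  have "continuous_on (ball 0 R \<times> ball 0 R) (\<lambda>(u, v). qprod2 q u v)" for R
  proof (rule continuous_on_subset)
    show "continuous_on (cball 0 R \<times> cball 0 R) (\<lambda>(u, v). qprod2 q u v)"
      by (rule uniform_limit_theorem[OF _ qprod2_uniform_limit])
         (auto simp: case_prod_unfold intro!: always_eventually continuous_intros)
  qed auto
  then have "continuous_on (\<Union>R\<in>UNIV. ball 0 R \<times> ball 0 R) (\<lambda>(u, v). qprod2 q u v)"
    by (intro continuous_on_open_UN) (auto intro: open_Times)
  moreover have "(\<Union>R\<in>UNIV. ball 0 R \<times> ball 0 R) = (UNIV :: (complex \<times> complex) set)"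
  proof (intro set_eqI iffI UNIV_I)
    fix p :: "complex \<times> complex"
    have "p \<in> ball 0 (norm (fst p) + norm (snd p) + 1) \<times> ball 0 (norm (fst p) + norm (snd p) + 1)"
      by (cases p) (auto intro: add_nonneg_pos)
    then show "p \<in> (\<Union>R\<in>UNIV. ball 0 R \<times> ball 0 R)" by blast
  qed
  ultimately show ?thesis by simp
qed

lemma continuous_on_qprod2 [continuous_intros]:
  assumes "continuous_on S f" "continuous_on S g"
  shows "continuous_on S (\<lambda>s. qprod2 q (f s) (g s))"
proof -
  have "continuous_on S ((\<lambda>(u, v). qprod2 q u v) \<circ> (\<lambda>s. (f s, g s)))"
    by (intro continuous_on_compose continuous_on_Pair assms)
       (rule continuous_on_subset[OF continuous_on_qprod2_UNIV], simp)
  then show ?thesis by (simp add: o_def)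
qed

text \<open>On a closed disc inside \<open>S\<close> the pair \<open>(f s, g s)\<close> is bounded,
  so the locally uniform limit of the partial products can be pulled back along it.\<close>

lemma holomorphic_on_qprod2 [holomorphic_intros]:
  assumes "f holomorphic_on S" "g holomorphic_on S" "open S"
  shows "(\<lambda>s. qprod2 q (f s) (g s)) holomorphic_on S"
proof (rule holomorphic_uniform_sequence[OF \<open>open S\<close>])
  show "(\<lambda>s. \<Prod>k<n. 1 + f s * of_real q ^ k + g s * (of_real q ^ k)\<^sup>2) holomorphic_on S" for n
    by (intro holomorphic_intros assms)
  fix x assume "x \<in> S"
  then obtain d where d: "d > 0" "cball x d \<subseteq> S" using \<open>open S\<close> open_contains_cball by blast
  have "compact ((\<lambda>s. (f s, g s)) ` cball x d)"
    using assms d(2)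
    by (intro compact_continuous_image continuous_on_Pair holomorphic_on_imp_continuous_on)
       (auto intro: holomorphic_on_subset)
  then have "bounded ((\<lambda>s. (f s, g s)) ` cball x d)" by (rule compact_imp_bounded)
  then obtain R where R: "\<And>s. s \<in> cball x d \<Longrightarrow> norm (f s, g s) \<le> R"
    unfolding bounded_iff by blast
  have "uniform_limit (cball x d) (\<lambda>n s. \<Prod>k<n. 1 + f s * of_real q ^ k + g s * (of_real q ^ k)\<^sup>2)
      (\<lambda>s. qprod2 q (f s) (g s)) sequentially"
  proof -
    have "(f s, g s) \<in> cball 0 R \<times> cball 0 R" if "s \<in> cball x d" for s
      using R[OF that] norm_fst_le[of "f s" "g s"] norm_snd_le[of "g s" "f s"] by auto
    then show ?thesis
      using uniform_limit_compose'[OF qprod2_uniform_limit[of R], of "\<lambda>s. (f s, g s)" "cball x d"]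
      by (simp add: Pi_iff)
  qed
  with d show "\<exists>d>0. cball x d \<subseteq> S \<and>
     uniform_limit (cball x d) (\<lambda>n s. \<Prod>k<n. 1 + f s * of_real q ^ k + g s * (of_real q ^ k)\<^sup>2)
      (\<lambda>s. qprod2 q (f s) (g s)) sequentially" by blast
qed

lemma continuous_on_qpoch [continuous_intros]:
  "continuous_on S f \<Longrightarrow> continuous_on S (\<lambda>s. qpoch (f s) q)"
  unfolding qpoch_conv_qprod2 by (intro continuous_intros)

lemma holomorphic_on_qpoch [holomorphic_intros]:
  "f holomorphic_on S \<Longrightarrow> open S \<Longrightarrow> (\<lambda>s. qpoch (f s) q) holomorphic_on S"
  unfolding qpoch_conv_qprod2 by (intro holomorphic_intros)

lemma continuous_on_hsym [continuous_intros]: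
  "continuous_on S f \<Longrightarrow> continuous_on S g \<Longrightarrow> continuous_on S (\<lambda>s. hsym q (f s) (g s))"
  unfolding hsym_def by (intro continuous_intros)

lemma holomorphic_on_hsym [holomorphic_intros]:
  "f holomorphic_on S \<Longrightarrow> g holomorphic_on S \<Longrightarrow> open S \<Longrightarrow> (\<lambda>s. hsym q (f s) (g s)) holomorphic_on S"
  unfolding hsym_def by (intro holomorphic_intros)

section \<open>Functional equation, zeros and positivity of the q-shifted factorial\<close>

lemma convergent_prod_qpoch: "convergent_prod (\<lambda>k. 1 - A * of_real q ^ k :: complex)"
  using convergent_prod_qprod2[of "- A" 0] by simp

lemma has_prod_qpoch: "(\<lambda>k. 1 - A * of_real q ^ k) has_prod qpoch A q"
  unfolding qpoch_def using convergent_prod_qpoch by blast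

lemma qpoch_rec: "qpoch A q = (1 - A) * qpoch (of_real q * A) q"
proof -
  have "(\<lambda>k. 1 - A * of_real q ^ k) has_prod (qpoch (of_real q * A) q * (1 - A * of_real q ^ 0))"
    using has_prod_qpoch[of "of_real q * A"]
    by (intro has_prod_Suc_imp) (simp add: mult_ac)
  then show ?thesis using has_prod_unique2[OF has_prod_qpoch] by (simp add: mult.commute)
qed

lemma qpoch_eq_0_iff: "qpoch A q = 0 \<longleftrightarrow> (\<exists>k. A * of_real q ^ k = 1)"
  using has_prod_eq_0_iff[OF has_prod_qpoch] by (auto simp: eq_commute[of 1])

lemma qpoch_nonzero:
  assumes "norm A < 1"
  shows "qpoch A q \<noteq> 0"
proof -
  have "norm (A * of_real q ^ k) < 1" for k
    using q mult_right_le_one_le[of "norm A" "q ^ k"] assms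
    by (simp add: norm_mult norm_power power_le_one)
  then show ?thesis unfolding qpoch_eq_0_iff by (metis norm_one less_irrefl)
qed

lemma qpoch_1 [simp]: "qpoch 1 q = 0"
  unfolding qpoch_eq_0_iff by (metis mult_1 power_0)

lemma cnj_qpoch: "cnj (qpoch A q) = qpoch (cnj A) q"
proof (rule LIMSEQ_unique)
  show "(\<lambda>n. cnj (\<Prod>k<n. 1 + (- A) * of_real q ^ k + 0 * (of_real q ^ k)\<^sup>2)) \<longlonglongrightarrow> cnj (qpoch A q)"
    unfolding qpoch_conv_qprod2 by (intro tendsto_cnj qprod2_LIMSEQ)
  show "(\<lambda>n. cnj (\<Prod>k<n. 1 + (- A) * of_real q ^ k + 0 * (of_real q ^ k)\<^sup>2)) \<longlonglongrightarrow> qpoch (cnj A) q"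
    using qprod2_LIMSEQ[of "- cnj A" 0] unfolding qpoch_conv_qprod2 by simp
qed

lemma qpoch_of_real_pos:
  assumes "x < 1"
  shows "\<exists>c>0. qpoch (of_real x) q = of_real c"
proof -
  have f: "0 < 1 - x * q ^ k" for k
  proof (cases "x \<ge> 0")
    case True
    then have "x * q ^ k \<le> x * 1" using q by (intro mult_left_mono power_le_one) auto
    then show ?thesis using assms by linarith
  next
    case False
    then have "x * q ^ k \<le> 0" using q by (intro mult_nonpos_nonneg) auto
    then show ?thesis by linarith
  qed
  have "(\<lambda>k. complex_of_real (1 - x * q ^ k)) has_prod qpoch (of_real x) q"
    using has_prod_qpoch[of "of_real x"] by simp
  moreover have "convergent_prod (complex_of_real \<circ> (\<lambda>k. 1 - x * q ^ k))"
    using convergent_prod_qpoch[of "of_real x"] by (simp add: o_def)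
  then have c: "convergent_prod (\<lambda>k. 1 - x * q ^ k)" by (simp only: convergent_prod_of_real_iff)
  then have "(\<lambda>k. complex_of_real (1 - x * q ^ k)) has_prod of_real (prodinf (\<lambda>k. 1 - x * q ^ k))"
    by (simp only: has_prod_of_real_iff) blast
  ultimately have "qpoch (of_real x) q = of_real (prodinf (\<lambda>k. 1 - x * q ^ k))"
    using has_prod_unique2 by blast
  moreover have "prodinf (\<lambda>k. 1 - x * q ^ k) > 0"
    by (rule has_prod_pos[OF convergent_prod_has_prod[OF c] f])
  ultimately show ?thesis by blast
qed

lemma hsym_joukowski:
  assumes "z \<noteq> 0"
  shows "hsym q a (joukowski z) = qpoch (a * z) q * qpoch (a / z) q"
proof -
  have "qpoch (a * z) q * qpoch (a / z) q = (\<Prod>k. (1 - a * z * of_real q ^ k) * (1 - a / z * of_real q ^ k))"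
    unfolding qpoch_def by (intro prodinf_mult convergent_prod_qpoch)
  also have "\<dots> = hsym q a (joukowski z)"
    unfolding hsym_def qprod2_def using assms
    by (intro prodinf_cong) (simp add: joukowski_def field_simps power2_eq_square)
  finally show ?thesis by simp
qed

lemma hfun_conv_hsym: "hfun q [a, b] x = hsym q a x * hsym q b x"
  using hsym_joukowski[OF zpt_nonzero[of x]] by (simp add: hfun_def)

end

section \<open>The q-Mehler kernel and the raising relation\<close>

lemma qprod2_rec:
  assumes q: "0 < q" "q < 1"
  shows "qprod2 q u v = (1 + u + v) * qprod2 q (of_real q * u) (of_real q ^ 2 * v)"
proof -
  have "(\<lambda>k. 1 + u * of_real q ^ k + v * (of_real q ^ k)\<^sup>2) has_prod
      (qprod2 q (of_real q * u) (of_real q ^ 2 * v) * (1 + u * of_real q ^ 0 + v * (of_real q ^ 0)\<^sup>2))"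
  proof (rule has_prod_Suc_imp)
    have "(\<lambda>k. 1 + of_real q * u * of_real q ^ k + of_real q ^ 2 * v * (of_real q ^ k)\<^sup>2)
        has_prod qprod2 q (of_real q * u) (of_real q ^ 2 * v)"
      unfolding qprod2_def using convergent_prod_qprod2[OF q] by blast
    then show "(\<lambda>k. 1 + u * of_real q ^ Suc k + v * (of_real q ^ Suc k)\<^sup>2)
        has_prod qprod2 q (of_real q * u) (of_real q ^ 2 * v)"
      by (simp add: mult_ac power_mult_distrib)
  qed
  moreover have "(\<lambda>k. 1 + u * of_real q ^ k + v * (of_real q ^ k)\<^sup>2) has_prod qprod2 q u v"
    unfolding qprod2_def using convergent_prod_qprod2[OF q] by blast
  ultimately show ?thesis using has_prod_unique2 by (fastforce simp: mult.commute)
qed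

lemma hsym_rec:
  assumes "0 < q" "q < 1"
  shows "hsym q a x = (1 - 2 * x * a + a\<^sup>2) * hsym q (of_real q * a) x"
  unfolding hsym_def by (subst qprod2_rec[OF assms]) (simp add: mult_ac power_mult_distrib)

text \<open>The fourfold product \<open>(r z w, r z / w, r w / z, r / (z w); q)\<close> for
  \<open>x = (w + 1/w) / 2\<close>. Only \<open>z\<close> is kept as a point of the plane, so that
  the expression is entire in \<open>x\<close>.\<close>

definition mehler_den :: "real \<Rightarrow> complex \<Rightarrow> complex \<Rightarrow> complex \<Rightarrow> complex" where
  "mehler_den q r x z = hsym q (r * z) x * hsym q (r / z) x"

definition circle_weight :: "real \<Rightarrow> complex \<Rightarrow> complex" where
  "circle_weight q z = qpoch (z\<^sup>2) q * qpoch (1 / z\<^sup>2) q"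

text \<open>The raising operator evaluates \<open>H_n\<close> off the real line, hence the complex
  variable.\<close>

fun cqHermite :: "real \<Rightarrow> nat \<Rightarrow> complex \<Rightarrow> complex" where
  "cqHermite q 0 x = 1"
| "cqHermite q (Suc 0) x = 2 * x"
| "cqHermite q (Suc (Suc n)) x =
     2 * x * cqHermite q (Suc n) x - (1 - of_real q ^ Suc n) * cqHermite q n x"

lemma cqHermite_of_real: "cqHermite q n (of_real x) = of_real (qHermite q n x)"
  by (induction q n x rule: qHermite.induct) simp_all

lemma holomorphic_on_cqHermite [holomorphic_intros]:
  "f holomorphic_on S \<Longrightarrow> (\<lambda>s. cqHermite q n (f s)) holomorphic_on S"
proof (induction q n "0::complex" rule: cqHermite.induct)
  case (3 q n)
  then show ?case by (simp del: power_Suc) (intro holomorphic_intros; simp)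
qed (auto intro!: holomorphic_intros)

text \<open>The raising and lowering relations of the Askey--Wilson operator, combined into one identity
  that is closed under the three-term recurrence.\<close>

lemma cqHermite_scale:
  fixes p :: real
  assumes p: "p \<noteq> 0" "p\<^sup>2 = q" and z: "z \<noteq> 0"
  shows "of_real p ^ n * cqHermite q n (joukowski (of_real p * z)) =
     cqHermite q n (joukowski z) - (1 - of_real q ^ n) * z * cqHermite q (n - 1) (joukowski z)"
proof -
  define P :: complex where "P = of_real p"
  define Q :: complex where "Q = of_real q"
  have PQ: "P ^ 2 = Q" "P \<noteq> 0" using p by (auto simp: P_def Q_def simp flip: of_real_power)
  define X where "X = 2 * joukowski z"
  define Y where "Y = 2 * joukowski (P * z)"
  define h where "h = (\<lambda>n. cqHermite q n (joukowski z))"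
  define k where "k = (\<lambda>n. cqHermite q n (joukowski (P * z)))"
  have XY: "z * X = z\<^sup>2 + 1" "P * z * Y = Q * z\<^sup>2 + 1"
    using z PQ by (auto simp: X_def Y_def joukowski_def field_simps power2_eq_square)
  have rec: "h (Suc (Suc n)) = X * h (Suc n) - (1 - Q ^ Suc n) * h n"
    "k (Suc (Suc n)) = Y * k (Suc n) - (1 - Q ^ Suc n) * k n" for n
    by (simp_all add: h_def k_def X_def Y_def Q_def)
  \<comment> \<open>Two consecutive degrees are carried along because the recurrence has order two.
    For \<open>n = 0\<close> the truncated index \<open>n - 1\<close> is harmless, since its
    coefficient \<open>1 - Q ^ 0\<close> is zero.\<close>
  have 0: "P ^ n * k n = h n - (1 - Q ^ n) * z * h (n - 1) \<and>
       P ^ Suc n * k (Suc n) = h (Suc n) - (1 - Q ^ Suc n) * z * h n" for n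
  proof (induction n)
    case 0
    have "z * (P * Y) = z * (X - (1 - Q) * z)"
      using XY by (simp add: algebra_simps power2_eq_square)
    then show ?case using z by (simp add: h_def k_def X_def Y_def mult_ac)
  next
    case (Suc n)
    \<comment> \<open>The factor \<open>z\<close> is there because \<open>X\<close> and
      \<open>Y\<close> are known as polynomials only in the form \<open>z * X\<close> and
      \<open>P * z * Y\<close>. For \<open>n = Suc m\<close> the recurrence eliminates
      \<open>h m\<close>.\<close>
    have e: "z * ((P * Y) * (h (Suc n) - (1 - Q * Q ^ n) * z * h n)
        - Q * (1 - Q * Q ^ n) * (h n - (1 - Q ^ n) * z * h (n - 1)))
      = z * (X * h (Suc n) - (1 - Q * Q ^ n) * h n - (1 - Q * (Q * Q ^ n)) * z * h (Suc n))"
    proof (cases n)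
      case 0
      show ?thesis using XY by (simp add: 0 h_def X_def[symmetric]) algebra
    next
      case (Suc m)
      have h: "h (Suc (Suc m)) = X * h (Suc m) - (1 - Q * Q ^ m) * h m"
        using rec(1)[of m] by simp
      define c d where "c = 1 - Q * Q ^ m" and "d = 1 - Q * (Q * Q ^ m)"
      have hm: "c * h m = X * h (Suc m) - h (Suc (Suc m))" using h by (simp add: c_def)
      have d: "1 - Q * (Q * (Q * Q ^ m)) = 1 - Q * (1 - d)" by (simp add: d_def)
      have "z * (P * Y * (h (Suc (Suc m)) - d * z * h (Suc m)) - Q * d * (h (Suc m) - c * z * h m))
        = (P * z * Y) * (h (Suc (Suc m)) - d * z * h (Suc m)) - Q * d * z * (h (Suc m) - z * (c * h m))"
        by (simp add: algebra_simps)
      also have "\<dots> = (z * X) * h (Suc (Suc m)) - z * (d * h (Suc m)) - z * ((1 - Q * (1 - d)) * z * h (Suc (Suc m)))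
          + Q * d * z * h (Suc m) * (z * X - (z\<^sup>2 + 1))"
        unfolding hm XY(2) unfolding XY(1) by (simp add: algebra_simps power2_eq_square) (use XY(1) in algebra)
      also have "z * X - (z\<^sup>2 + 1) = 0" using XY(1) by simp
      finally show ?thesis unfolding Suc diff_Suc_1 power_Suc d d_def[symmetric] c_def[symmetric]
        by (simp add: algebra_simps)
    qed
    have "P ^ Suc (Suc n) * k (Suc (Suc n)) =
        (P * Y) * (P ^ Suc n * k (Suc n)) - P\<^sup>2 * (1 - Q ^ Suc n) * (P ^ n * k n)"
      unfolding rec by (simp add: algebra_simps power2_eq_square)
    then have "P ^ Suc (Suc n) * k (Suc (Suc n)) =
        h (Suc (Suc n)) - (1 - Q ^ Suc (Suc n)) * z * h (Suc n)"
      using Suc.IH e z unfolding rec(1) PQ by simp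
    with Suc.IH show ?case by simp
  qed
  show ?thesis using 0[of n] unfolding h_def k_def P_def Q_def by blast
qed

text \<open>Since \<open>joukowski (z / p) = joukowski (p * (1 / z))\<close>,
  \<open>cqHermite_scale\<close> applies at \<open>z\<close> and at \<open>1 / z\<close>; with the
  weight \<open>z^2\<close> on the second instance the terms of degree \<open>n - 1\<close>
  cancel.\<close>

lemma cqHermite_raise:
  fixes p :: real
  assumes p: "p \<noteq> 0" "p\<^sup>2 = q" and z: "z \<noteq> 0"
  shows "cqHermite q n (joukowski (of_real p * z)) - z\<^sup>2 * cqHermite q n (joukowski (z / of_real p)) =
     (1 - z\<^sup>2) * (cqHermite q n (joukowski z) / of_real p ^ n)"
proof -
  have 1: "joukowski (z / of_real p) = joukowski (of_real p * (1 / z))"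
    using joukowski_inverse[of "z / of_real p"] by simp
  have 2: "joukowski (1 / z) = joukowski z" by (rule joukowski_inverse)
  have "of_real p ^ n * (cqHermite q n (joukowski (of_real p * z)) - z\<^sup>2 * cqHermite q n (joukowski (z / of_real p)))
    = (1 - z\<^sup>2) * cqHermite q n (joukowski z)"
    using cqHermite_scale[OF p z, of n] cqHermite_scale[OF p, of "1 / z" n] z
    unfolding 1 2 by (simp add: right_diff_distrib mult.left_commute[of _ "z\<^sup>2"]) 
      (simp add: field_simps power2_eq_square)
  then show ?thesis using p by (simp add: field_simps)
qed

section \<open>Symmetry, zeros and shift of the q-Mehler denominator\<close>

lemma mehler_den_joukowski:
  assumes "0 < q" "q < 1" "w \<noteq> 0" "z \<noteq> 0"
  shows "mehler_den q r (joukowski w) z =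
    qpoch (r * z * w) q * qpoch (r * z / w) q * qpoch (r * w / z) q * qpoch (r / (z * w)) q"
  using assms by (simp add: mehler_den_def hsym_joukowski mult_ac)

lemma mehler_den_swap:
  assumes "0 < q" "q < 1" "w \<noteq> 0" "z \<noteq> 0"
  shows "mehler_den q r (joukowski w) z = mehler_den q r (joukowski z) w"
  using assms by (simp add: mehler_den_joukowski mult_ac)

lemma mehler_den_inverse: "mehler_den q r x (1 / z) = mehler_den q r x z"
  by (simp add: mehler_den_def mult.commute)

text \<open>The four norm conditions place the arguments of the four factors in the open unit disc,
  where \<open>(A; q)\<close> has no zero.\<close>

lemma mehler_den_nonzero:
  assumes "0 < q" "q < 1" "w \<noteq> 0" "z \<noteq> 0"
    and "norm (r * z) < norm w" "norm (r * z) * norm w < 1" "norm r * norm w < norm z" "norm r < norm z * norm w"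
  shows "mehler_den q r (joukowski w) z \<noteq> 0"
  using assms
  by (simp add: mehler_den_joukowski) (intro conjI qpoch_nonzero; simp add: norm_mult norm_divide divide_simps)

lemma mehler_den_nonzero_circle:
  assumes "0 < q" "q < 1" "norm w = 1" "norm z = 1" "norm r < 1"
  shows "mehler_den q r (joukowski w) z \<noteq> 0"
  by (rule mehler_den_nonzero) (use assms in \<open>auto simp: norm_mult\<close>)

text \<open>For the parameter \<open>p t\<close>, the shift to \<open>p z\<close> turns the pair
  \<open>t z, t / z\<close> into \<open>q t z, t / z\<close>, and the shift to \<open>z / p\<close>
  turns it into \<open>t z, q t / z\<close>. Each shifted denominator thus lacks one quadratic first
  factor, \<open>a\<close> or \<open>b\<close>, and everything reduces to
  \<open>a - z^2 b = (1 - z^2) (1 - t^2)\<close>.\<close>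

lemma mehler_den_raise:
  fixes p :: real
  assumes q: "0 < q" "q < 1" and p: "p \<noteq> 0" "p\<^sup>2 = q" and z: "z \<noteq> 0" and nz: "mehler_den q t x z \<noteq> 0"
  shows "1 / mehler_den q (of_real p * t) x (of_real p * z) - z\<^sup>2 * (1 / mehler_den q (of_real p * t) x (z / of_real p)) =
     (1 - z\<^sup>2) * ((1 - t\<^sup>2) / mehler_den q t x z)"
proof -
  have P: "of_real p * of_real p = (of_real q :: complex)" using p by (simp add: power2_eq_square flip: of_real_mult)
  define A where "A = hsym q (of_real q * (t * z)) x"
  define B where "B = hsym q (of_real q * (t / z)) x"
  define a where "a = 1 - 2 * x * (t * z) + (t * z)\<^sup>2"
  define b where "b = 1 - 2 * x * (t / z) + (t / z)\<^sup>2"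
  have A: "hsym q (t * z) x = a * A" and B: "hsym q (t / z) x = b * B"
    unfolding A_def B_def a_def b_def by (rule hsym_rec[OF q])+
  have e: "of_real p * t * (of_real p * z) = of_real q * (t * z)" "of_real p * t / (of_real p * z) = t / z"
    "of_real p * t * (z / of_real p) = t * z" "of_real p * t / (z / of_real p) = of_real q * (t / z)"
    using p(1) by (simp_all add: P[symmetric])
  have k: "mehler_den q t x z = a * A * (b * B)" "mehler_den q (of_real p * t) x (of_real p * z) = A * (b * B)"
     "mehler_den q (of_real p * t) x (z / of_real p) = a * A * B"
    unfolding mehler_den_def e A B by (simp_all only: A_def B_def)
  have nz: "a \<noteq> 0" "b \<noteq> 0" "A \<noteq> 0" "B \<noteq> 0" using nz unfolding k by auto
  have ab: "a - z\<^sup>2 * b = (1 - z\<^sup>2) * (1 - t\<^sup>2)"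
    unfolding a_def b_def using z by (simp add: field_simps power2_eq_square)
  have "1 / (A * (b * B)) - z\<^sup>2 * (1 / (a * A * B)) = (a - z\<^sup>2 * b) / (a * A * (b * B))"
    using nz by (simp add: field_simps)
  then show ?thesis unfolding k ab by simp
qed

section \<open>Symmetry of the raising operator\<close>

definition circle_mean :: "(complex \<Rightarrow> complex) \<Rightarrow> complex" where
  "circle_mean \<Phi> = integral {0..1} (\<lambda>t. \<Phi> (exp (2 * of_real pi * \<i> * of_real t)))"

lemma circle_mean_cong: "(\<And>z. norm z = 1 \<Longrightarrow> \<Phi> z = \<Psi> z) \<Longrightarrow> circle_mean \<Phi> = circle_mean \<Psi>"
  unfolding circle_mean_def by (intro integral_cong) (simp add: norm_exp_eq_Re)

lemma circle_mean_integrable: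
  fixes \<Phi> :: "complex \<Rightarrow> complex"
  assumes "continuous_on {z. norm z = 1} \<Phi>"
  shows "(\<lambda>t. \<Phi> (exp (2 * of_real pi * \<i> * of_real t))) integrable_on {0..1}"
proof (rule integrable_continuous_real)
  have "continuous_on {0..1} (\<Phi> \<circ> (\<lambda>t. exp (2 * of_real pi * \<i> * of_real t)))"
    by (intro continuous_on_compose continuous_intros continuous_on_subset[OF assms])
       (auto simp: norm_exp_eq_Re)
  then show "continuous_on {0..1} (\<lambda>t. \<Phi> (exp (2 * of_real pi * \<i> * of_real t)))" by (simp add: o_def)
qed

lemma circle_mean_diff:
  assumes "continuous_on {z. norm z = 1} \<Phi>" "continuous_on {z. norm z = 1} \<Psi>"
  shows "circle_mean (\<lambda>z. \<Phi> z - \<Psi> z) = circle_mean \<Phi> - circle_mean \<Psi>"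
  unfolding circle_mean_def by (intro integral_diff circle_mean_integrable assms)

lemma circle_mean_cmult: "circle_mean (\<lambda>z. c * \<Phi> z) = c * circle_mean \<Phi>"
  unfolding circle_mean_def by simp

lemma circle_mean_inverse: "circle_mean (\<lambda>z. \<Phi> (1 / z)) = circle_mean \<Phi>"
  unfolding circle_mean_def by (rule circle_integral_inverse)

text \<open>Invariance under inversion makes both halves of the circle contribute equally, and
  \<open>\<phi> = 2 pi t\<close> carries \<open>[0, 1/2]\<close> to \<open>[0, pi]\<close>.\<close>

lemma half_circle_integral:
  assumes cont: "continuous_on {z. norm z = 1} \<Phi>" and sym: "\<And>z. norm z = 1 \<Longrightarrow> \<Phi> (1 / z) = \<Phi> z"
  shows "integral {0..pi} (\<lambda>\<phi>. \<Phi> (cis \<phi>)) = of_real pi * circle_mean \<Phi>"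
proof -
  define f where "f = (\<lambda>t::real. \<Phi> (exp (2 * of_real pi * \<i> * of_real t)))"
  have f_cis: "f t = \<Phi> (cis (2 * pi * t))" for t
    by (simp add: f_def cis_conv_exp mult_ac)
  have f1: "f (1 - t) = f t" for t
  proof -
    have "exp (2 * of_real pi * \<i> * of_real (1 - t)) = 1 / exp (2 * of_real pi * \<i> * of_real t)"
      by (simp add: algebra_simps exp_diff)
    then show ?thesis unfolding f_def using sym by (simp add: norm_exp_eq_Re)
  qed
  have int: "f integrable_on {0..1}" unfolding f_def by (rule circle_mean_integrable[OF cont])
  then have int2: "f integrable_on {0..1/2}" by (rule integrable_on_subinterval) auto
  define I where "I = integral {0..1/2} f"
  have "((\<lambda>t. f ((-1) *\<^sub>R t + 1)) has_integral (1 / \<bar>-1\<bar> ^ DIM(real)) *\<^sub>R I)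
     ((\<lambda>x. (1 / (-1)) *\<^sub>R x + - ((1 / (-1)) *\<^sub>R 1)) ` cbox 0 (1/2))"
    using int2 by (intro has_integral_affinity) (auto simp: I_def)
  moreover have "((\<lambda>x::real. (1 / (-1)) *\<^sub>R x + - ((1 / (-1)) *\<^sub>R 1)) ` cbox 0 (1/2)) = {1/2..1}"
  proof -
    have "(\<lambda>x::real. (1 / (-1)) *\<^sub>R x + - ((1 / (-1)) *\<^sub>R 1)) = (\<lambda>x. (-1) * x + 1)" by auto
    then show ?thesis using image_affinity_atLeastAtMost[of "-1" 1 0 "1/2::real"] by simp
  qed
  ultimately have "(f has_integral I) {1/2..1}" using f1 by (simp add: add.commute)
  then have "integral {0..1} f = 2 * I"
    using Henstock_Kurzweil_Integration.integral_combine[OF _ _ int, of "1/2"]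
    by (simp add: I_def integral_unique)
  moreover have "((\<lambda>\<phi>. f ((1 / (2 * pi)) *\<^sub>R \<phi> + 0)) has_integral (I /\<^sub>R (1 / (2 * pi)) ^ DIM(real)))
      (cbox ((0 - 0) /\<^sub>R (1 / (2 * pi))) ((1/2 - 0) /\<^sub>R (1 / (2 * pi))))"
    using int2 by (intro has_integral_affinity') (auto simp: I_def)
  then have "((\<lambda>\<phi>. \<Phi> (cis \<phi>)) has_integral (2 * of_real pi * I)) {0..pi}"
    by (simp add: f_cis scaleR_conv_of_real)
  ultimately show ?thesis by (simp add: circle_mean_def f_def integral_unique)
qed

text \<open>Isolates the factor that cancels the denominator \<open>1 - z^2\<close> of the raising
  operator, which vanishes at \<open>z = 1\<close> and \<open>z = -1\<close>.\<close>

lemma circle_weight_split: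
  assumes q: "0 < q" "q < 1"
  shows "circle_weight q z = (1 - z\<^sup>2) * (qpoch (of_real q * z\<^sup>2) q * qpoch (1 / z\<^sup>2) q)"
  unfolding circle_weight_def by (subst qpoch_rec[OF q, of "z\<^sup>2"]) simp

text \<open>Once \<open>1 - z^2\<close> is cancelled, the two shifted terms are
  \<open>\<Phi>1\<close> and \<open>\<Phi>2\<close>. Inversion carries \<open>\<Phi>2\<close> to
  \<open>- \<Phi>1\<close> because \<open>V (1 / z) / z^2 = - V z\<close>, so both contribute the
  same amount, whence the factor 2. The contour is still the unit circle.\<close>

lemma circle_mean_raise_step:
  fixes p \<rho> :: real
  assumes q: "0 < q" "q < 1" and p: "0 < p" "p < 1" "p\<^sup>2 = q" and \<rho>: "0 < \<rho>" "\<rho> < p"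
    and A: "A holomorphic_on {z. \<rho> < norm z \<and> norm z < 1 / \<rho>}" "\<And>z. A (1 / z) = A z"
    and B: "B holomorphic_on {z. \<rho> < norm z \<and> norm z < 1 / \<rho>}" "\<And>z. B (1 / z) = B z"
    and DA: "\<And>z. norm z = 1 \<Longrightarrow> (1 - z\<^sup>2) * DA z = A (of_real p * z) - z\<^sup>2 * A (z / of_real p)"
  shows "circle_mean (\<lambda>z. circle_weight q z * DA z * B z) =
     2 * circle_mean (\<lambda>z. qpoch (of_real q * z\<^sup>2) q * qpoch (1 / z\<^sup>2) q * A (of_real p * z) * B z)"
proof -
  define V where "V = (\<lambda>z. qpoch (of_real q * z\<^sup>2) q * qpoch (1 / z\<^sup>2) q)"
  define \<Phi>1 where "\<Phi>1 = (\<lambda>z. V z * A (of_real p * z) * B z)"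
  define \<Phi>2 where "\<Phi>2 = (\<lambda>z. z\<^sup>2 * V z * A (z / of_real p) * B z)"
  let ?S = "{z::complex. norm z = 1}"
  have \<rho>1: "\<rho> < 1" "1 < 1 / \<rho>" using \<rho> p by auto
  have p\<rho>: "p < 1 / \<rho>" "\<rho> * p < 1" "1 / p < 1 / \<rho>"
    using \<rho> \<rho>1 p mult_strict_mono[of \<rho> 1 p 1] by (auto simp: field_simps)
  have cV: "continuous_on ?S V"
    unfolding V_def by (intro continuous_intros continuous_on_qpoch q) auto
  note cA = holomorphic_on_imp_continuous_on[OF A(1)] and cB = holomorphic_on_imp_continuous_on[OF B(1)]
  have cB1: "continuous_on ?S B" by (rule continuous_on_subset[OF cB]) (use \<rho>1 in auto)
  have "continuous_on ?S (A \<circ> (\<lambda>z. of_real p * z))"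
    by (intro continuous_on_compose continuous_intros continuous_on_subset[OF cA])
       (use p \<rho> p\<rho> in \<open>auto simp: norm_mult\<close>)
  then have c1: "continuous_on ?S \<Phi>1"
    unfolding \<Phi>1_def o_def by (intro continuous_intros cV cB1) (auto simp: o_def)
  have "continuous_on ?S (A \<circ> (\<lambda>z. z / of_real p))"
    by (intro continuous_on_compose continuous_intros continuous_on_subset[OF cA])
       (use p \<rho> p\<rho> in \<open>auto simp: norm_divide field_simps\<close>)
  then have c2: "continuous_on ?S \<Phi>2"
    unfolding \<Phi>2_def o_def by (intro continuous_intros cV cB1) (auto simp: o_def)
  have \<Phi>2_inv: "\<Phi>2 (1 / z) = - \<Phi>1 z" if "norm z = 1" for z
  proof -
    have z: "z \<noteq> 0" using that by auto
    have "A (1 / z / of_real p) = A (of_real p * z)" using A(2)[of "of_real p * z"] by (simp add: mult.commute)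
    moreover have "(1 / z)\<^sup>2 * V (1 / z) = - V z"
    proof -
      have "V z = qpoch (of_real q * z\<^sup>2) q * ((1 - 1 / z\<^sup>2) * qpoch (of_real q * (1 / z\<^sup>2)) q)"
        unfolding V_def by (subst qpoch_rec[OF q, of "1 / z\<^sup>2"]) simp
      moreover have "V (1 / z) = qpoch (of_real q * (1 / z\<^sup>2)) q * ((1 - z\<^sup>2) * qpoch (of_real q * z\<^sup>2) q)"
        unfolding V_def qpoch_rec[OF q, of "z\<^sup>2", symmetric] by (simp add: power_one_over)
      moreover have "(1 / z)\<^sup>2 * (b * ((1 - z\<^sup>2) * a)) = - (a * ((1 - 1 / z\<^sup>2) * b))" for a b
        using z by (simp add: field_simps)
      ultimately show ?thesis by (simp only:)
    qed
    ultimately show ?thesis unfolding \<Phi>1_def \<Phi>2_def B(2) by simp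
  qed
  have "circle_mean (\<lambda>z. circle_weight q z * DA z * B z) = circle_mean (\<lambda>z. \<Phi>1 z - \<Phi>2 z)"
  proof (rule circle_mean_cong)
    fix z :: complex assume "norm z = 1"
    have "circle_weight q z * DA z * B z = V z * ((1 - z\<^sup>2) * DA z) * B z"
      unfolding circle_weight_split[OF q] V_def by (simp add: mult_ac)
    also have "\<dots> = \<Phi>1 z - \<Phi>2 z"
      unfolding DA[OF \<open>norm z = 1\<close>] \<Phi>1_def \<Phi>2_def by (simp add: algebra_simps)
    finally show "circle_weight q z * DA z * B z = \<Phi>1 z - \<Phi>2 z" .
  qed
  also have "\<dots> = circle_mean \<Phi>1 - circle_mean \<Phi>2" by (rule circle_mean_diff[OF c1 c2])
  also have "circle_mean \<Phi>2 = circle_mean (\<lambda>z. \<Phi>2 (1 / z))" by (rule circle_mean_inverse[symmetric])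
  also have "\<dots> = circle_mean (\<lambda>z. - 1 * \<Phi>1 z)" by (rule circle_mean_cong) (simp add: \<Phi>2_inv)
  also have "\<dots> = - circle_mean \<Phi>1" by (subst circle_mean_cmult) simp
  finally show ?thesis unfolding \<Phi>1_def V_def by simp
qed

text \<open>The substitution \<open>z \<mapsto> 1 / (p z)\<close> exchanges \<open>A\<close> and \<open>B\<close>, at the cost of integrating over the circle of
  radius \<open>1 / p\<close>, which can be moved back to the unit circle.\<close>

lemma circle_mean_raise_symmetric:
  fixes p \<rho> :: real
  assumes q: "0 < q" "q < 1" and p: "0 < p" "p < 1" "p\<^sup>2 = q" and \<rho>: "0 < \<rho>" "\<rho> < p"
    and A: "A holomorphic_on {z. \<rho> < norm z \<and> norm z < 1 / \<rho>}" "\<And>z. A (1 / z) = A z"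
    and B: "B holomorphic_on {z. \<rho> < norm z \<and> norm z < 1 / \<rho>}" "\<And>z. B (1 / z) = B z"
    and DA: "\<And>z. norm z = 1 \<Longrightarrow> (1 - z\<^sup>2) * DA z = A (of_real p * z) - z\<^sup>2 * A (z / of_real p)"
    and DB: "\<And>z. norm z = 1 \<Longrightarrow> (1 - z\<^sup>2) * DB z = B (of_real p * z) - z\<^sup>2 * B (z / of_real p)"
  shows "circle_mean (\<lambda>z. circle_weight q z * DA z * B z) = circle_mean (\<lambda>z. circle_weight q z * A z * DB z)"
proof -
  define V where "V = (\<lambda>z. qpoch (of_real q * z\<^sup>2) q * qpoch (1 / z\<^sup>2) q)"
  define \<Phi> where "\<Phi> = (\<lambda>z. V z * A (of_real p * z) * B z)"
  define \<Psi> where "\<Psi> = (\<lambda>z. V z * B (of_real p * z) * A z)"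
  have \<rho>1: "\<rho> < 1" "1 < 1 / \<rho>" using \<rho> p by auto
  have P: "of_real p * of_real p = (of_real q :: complex)"
    using p by (simp add: power2_eq_square flip: of_real_mult)
  \<comment> \<open>\<open>\<Psi>\<close> contains \<open>B\<close> at \<open>p z\<close> and
    \<open>A\<close> at \<open>z\<close>. On \<open>?T\<close> both arguments lie in the given
    annulus, and \<open>\<rho> < p\<close> makes it contain the circles of radius 1 and
    \<open>1 / p\<close>.\<close>
  let ?T = "{z::complex. \<rho> / p < norm z \<and> norm z < 1 / \<rho>}"
  have oT: "open ?T" by (intro open_Collect_conj open_Collect_less continuous_intros)
  have "\<rho> / p > \<rho>" using p \<rho> by (simp add: field_simps)
  have "\<Psi> holomorphic_on ?T"
  proof -
    have "(B \<circ> (\<lambda>z. of_real p * z)) holomorphic_on ?T"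
    proof (rule holomorphic_on_compose_gen[OF _ B(1)])
      have "p * norm z < 1 / \<rho>" if "norm z < 1 / \<rho>" for z :: complex
        using mult_left_le_one_le[of "norm z" p] p that by (smt (verit) norm_ge_zero)
      then show "(\<lambda>z. of_real p * z) ` ?T \<subseteq> {z. \<rho> < norm z \<and> norm z < 1 / \<rho>}"
        using p by (auto simp: norm_mult pos_divide_less_eq mult.commute[of _ p])
    qed (intro holomorphic_intros)
    moreover have "A holomorphic_on ?T"
      by (rule holomorphic_on_subset[OF A(1)]) (use \<open>\<rho> / p > \<rho>\<close> in auto)
    moreover have "V holomorphic_on ?T"
      unfolding V_def using p \<rho>
      by (intro holomorphic_intros holomorphic_on_qpoch q oT) (auto simp: divide_less_0_iff)
    ultimately show ?thesis unfolding \<Psi>_def o_def by (intro holomorphic_intros) auto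
  qed
  then have "circle_mean \<Psi> = integral {0..1} (\<lambda>t. \<Psi> (of_real (1 / p) * exp (2 * of_real pi * \<i> * of_real t)))"
    using circle_integral_annulus[of \<Psi> "\<rho> / p" "1 / \<rho>" 1 "1 / p"] p \<rho> \<rho>1
    by (simp add: circle_mean_def field_simps)
  also have "\<dots> = circle_mean (\<lambda>z. \<Phi> (1 / z))"
    unfolding circle_mean_def
  proof (intro integral_cong)
    fix t :: real
    define z where "z = exp (2 * of_real pi * \<i> * of_real t)"
    have z: "z \<noteq> 0" by (simp add: z_def)
    have "A (of_real p * (1 / z)) = A (of_real (1 / p) * z)"
      using A(2)[of "of_real p * (1 / z)"] by simp
    \<comment> \<open>Because \<open>p^2 = q\<close>, the map \<open>z \<mapsto> 1 / (p z)\<close>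
      exchanges the arguments \<open>q z^2\<close> and \<open>1 / z^2\<close> of the two factors of
      \<open>V\<close>.\<close>
    moreover have "V (1 / z) = V (of_real (1 / p) * z)"
      using p(1) q z P by (simp add: V_def power2_eq_square mult_ac divide_simps)
    ultimately show "\<Psi> (of_real (1 / p) * z) = \<Phi> (1 / z)"
      using B(2)[of z] p unfolding \<Phi>_def \<Psi>_def by simp
  qed
  also have "\<dots> = circle_mean \<Phi>" by (rule circle_mean_inverse)
  finally have "circle_mean \<Phi> = circle_mean \<Psi>" by simp
  moreover have "circle_mean (\<lambda>z. circle_weight q z * DB z * A z) = 2 * circle_mean \<Psi>"
    unfolding \<Psi>_def V_def by (rule circle_mean_raise_step[OF q p \<rho> B A DB])
  moreover have "circle_mean (\<lambda>z. circle_weight q z * DA z * B z) = 2 * circle_mean \<Phi>"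
    unfolding \<Phi>_def V_def by (rule circle_mean_raise_step[OF q p \<rho> A B DA])
  ultimately show ?thesis by (simp add: mult_ac)
qed

text \<open>Taylor coefficients at 0 satisfy \<open>p^k c_k = p^n c_k\<close>, and the powers of
  \<open>p\<close> are distinct, so only \<open>c_n\<close> survives.\<close>

lemma holomorphic_dilation_eigenfunction:
  fixes f :: "complex \<Rightarrow> complex" and p :: real
  assumes hol: "f holomorphic_on ball 0 1" and p: "0 < p" "p < 1"
    and eq: "\<And>r. norm r < 1 \<Longrightarrow> f (of_real p * r) = of_real p ^ n * f r"
  shows "\<exists>c. \<forall>r. norm r < 1 \<longrightarrow> f r = c * r ^ n"
proof -
  have pr: "norm (of_real p * r) < 1" if "norm r < 1" for r :: complex
    using that p mult_strict_mono'[of p 1 "norm r" 1] by (simp add: norm_mult)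
  have zero: "(deriv ^^ k) f 0 = 0" if "k \<noteq> n" for k
  proof -
    have "(deriv ^^ k) (\<lambda>r. f (of_real p * r)) 0 = of_real p ^ k * (deriv ^^ k) f (of_real p * 0)"
      by (rule higher_deriv_compose_linear[OF hol, of "ball 0 1"]) (use pr in auto)
    moreover have "(deriv ^^ k) (\<lambda>r. f (of_real p * r)) 0 = (deriv ^^ k) (\<lambda>r. of_real p ^ n * f r) 0"
    proof (rule higher_deriv_transform_within_open)
      have "(f \<circ> (\<lambda>r. of_real p * r)) holomorphic_on ball 0 1"
        by (rule holomorphic_on_compose_gen[OF _ hol]) (use pr in \<open>auto intro!: holomorphic_intros\<close>)
      then show "(\<lambda>r. f (of_real p * r)) holomorphic_on ball 0 1" by (simp add: o_def)
      show "(\<lambda>r. of_real p ^ n * f r) holomorphic_on ball 0 1" by (intro holomorphic_intros hol)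
    qed (use eq in auto)
    moreover have "(deriv ^^ k) (\<lambda>r. of_real p ^ n * f r) 0 = of_real p ^ n * (deriv ^^ k) f 0"
      by (rule higher_deriv_cmult[OF hol]) auto
    ultimately have "(of_real p ^ k - of_real p ^ n :: complex) * (deriv ^^ k) f 0 = 0"
      by (simp add: algebra_simps)
    moreover have "p ^ k \<noteq> p ^ n"
      using that p power_strict_decreasing[of k n p] power_strict_decreasing[of n k p] by (metis less_irrefl nat_neq_iff)
    then have "(of_real p ^ k - of_real p ^ n :: complex) \<noteq> 0" by (simp flip: of_real_power)
    ultimately show ?thesis by simp
  qed
  have "f r = (deriv ^^ n) f 0 / fact n * r ^ n" if "norm r < 1" for r
  proof -
    have s: "(\<lambda>k. (deriv ^^ k) f 0 / fact k * (r - 0) ^ k) sums f r"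
      by (rule holomorphic_power_series[OF hol]) (use that in auto)
    have "(\<lambda>k. (deriv ^^ k) f 0 / fact k * (r - 0) ^ k) = (\<lambda>k. if k = n then (deriv ^^ n) f 0 / fact n * r ^ n else 0)"
      using zero by auto
    with s show ?thesis using sums_single[of n "\<lambda>_. (deriv ^^ n) f 0 / fact n * r ^ n"] sums_unique2
      by (metis (no_types, lifting))
  qed
  then show ?thesis by blast
qed

section \<open>The Poisson kernel\<close>

definition poisson_kernel :: "real \<Rightarrow> real \<Rightarrow> real" where
  "poisson_kernel r u = (1 - r\<^sup>2) / (1 - 2 * r * cos u + r\<^sup>2)"

lemma poisson_denom: "1 - 2 * r * cos u + r\<^sup>2 = (1 - r)\<^sup>2 + 2 * r * (1 - cos (u::real))"
  by (simp add: power2_eq_square algebra_simps)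

lemma poisson_denom_pos: "0 \<le> r \<Longrightarrow> r < 1 \<Longrightarrow> 1 - 2 * r * cos (u::real) + r\<^sup>2 > 0"
  unfolding poisson_denom by (intro add_pos_nonneg mult_nonneg_nonneg) auto

lemma poisson_kernel_nonneg: "0 \<le> r \<Longrightarrow> r < 1 \<Longrightarrow> poisson_kernel r u \<ge> 0"
  using poisson_denom_pos[of r u] unfolding poisson_kernel_def
  by (intro divide_nonneg_pos) (auto simp: power_le_one)

text \<open>Controls the kernel away from its peak without splitting the integral:
  \<open>1 - cos u\<close> measures the distance from the peak, and \<open>r \<ge> 1/2\<close> gives
  \<open>2 r \<ge> 1\<close>.\<close>

lemma poisson_kernel_mult_le:
  assumes "1 / 2 \<le> r" "r < 1"
  shows "poisson_kernel r u * (1 - cos u) \<le> 1 - r\<^sup>2"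
proof -
  have "1 - cos u \<le> 2 * r * (1 - cos u)"
    using mult_right_mono[of 1 "2 * r" "1 - cos u"] assms by simp
  also have "\<dots> \<le> 1 - 2 * r * cos u + r\<^sup>2" unfolding poisson_denom by simp
  finally have "(1 - r\<^sup>2) * (1 - cos u) \<le> (1 - r\<^sup>2) * (1 - 2 * r * cos u + r\<^sup>2)"
    using assms by (intro mult_left_mono) (auto simp: power_le_one)
  then show ?thesis
    using poisson_denom_pos[of r u] assms unfolding poisson_kernel_def by (simp add: field_simps)
qed

lemma continuous_on_poisson_kernel [continuous_intros]:
  fixes f :: "real \<Rightarrow> real"
  assumes "0 \<le> r" "r < 1" "continuous_on S f"
  shows "continuous_on S (\<lambda>x. poisson_kernel r (f x))"
  unfolding poisson_kernel_def using assms poisson_denom_pos[OF assms(1,2)]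
  by (intro continuous_intros) (auto simp: less_imp_neq[symmetric])

text \<open>With \<open>u = \<phi> - \<theta>\<close> the antiderivative is
  \<open>2 arctan ((1 + r) / (1 - r) * tan (u / 2))\<close>. For interior \<open>\<theta>\<close>
  the half angle stays inside \<open>(-pi/2, pi/2)\<close>, where the tangent is smooth.\<close>

lemma poisson_integral:
  assumes \<theta>: "0 < \<theta>" "\<theta> < pi" and r: "0 \<le> r" "r < 1"
  shows "((\<lambda>\<phi>. poisson_kernel r (\<phi> - \<theta>)) has_integral
    2 * arctan ((1 + r) / (1 - r) * tan ((pi - \<theta>) / 2)) + 2 * arctan ((1 + r) / (1 - r) * tan (\<theta> / 2))) {0..pi}"
proof -
  define c where "c = (1 + r) / (1 - r)"
  have c: "c \<ge> 0" using r by (simp add: c_def)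
  have "((\<lambda>\<phi>. poisson_kernel r (\<phi> - \<theta>)) has_integral
      2 * arctan (c * tan ((pi - \<theta>) / 2)) - 2 * arctan (c * tan ((0 - \<theta>) / 2))) {0..pi}"
  proof (rule fundamental_theorem_of_calculus)
    fix \<phi> assume \<phi>: "\<phi> \<in> {0..pi}"
    define u where "u = (\<phi> - \<theta>) / 2"
    have cu: "cos u > 0" using \<phi> \<theta> unfolding u_def by (intro cos_gt_zero_pi) (auto simp: field_simps)
    have "((\<lambda>\<phi>. 2 * arctan (c * tan ((\<phi> - \<theta>) / 2))) has_real_derivative
        2 * ((c * (inverse ((cos u)\<^sup>2) * (1/2))) * inverse (1 + (c * tan u)\<^sup>2))) (at \<phi>)"
      using cu unfolding u_def by (auto intro!: derivative_eq_intros simp: field_simps)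
    moreover have "2 * ((c * (inverse ((cos u)\<^sup>2) * (1/2))) * inverse (1 + (c * tan u)\<^sup>2)) = poisson_kernel r (\<phi> - \<theta>)"
    proof -
      have u2: "2 * u = \<phi> - \<theta>" by (simp add: u_def)
      have "(1 - r)\<^sup>2 * (cos u)\<^sup>2 + (1 + r)\<^sup>2 * (sin u)\<^sup>2 = 1 - 2 * r * cos (2 * u) + r\<^sup>2"
        unfolding cos_double using sin_cos_squared_add[of u] by algebra
      moreover have "c * (1 - r) = 1 + r" using r by (simp add: c_def)
      then have "(1 - r)\<^sup>2 * ((cos u)\<^sup>2 + c\<^sup>2 * (sin u)\<^sup>2) = (1 - r)\<^sup>2 * (cos u)\<^sup>2 + (1 + r)\<^sup>2 * (sin u)\<^sup>2"
        by (metis (no_types, lifting) distrib_left mult.assoc mult.commute power_mult_distrib)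
      ultimately have e: "(1 - r)\<^sup>2 * ((cos u)\<^sup>2 + c\<^sup>2 * (sin u)\<^sup>2) = 1 - 2 * r * cos (2 * u) + r\<^sup>2" by simp
      have e1: "1 + (c * tan u)\<^sup>2 = ((cos u)\<^sup>2 + c\<^sup>2 * (sin u)\<^sup>2) / (cos u)\<^sup>2"
        using cu by (simp add: tan_def field_simps power_mult_distrib)
      have frac: "2 * ((c * (inverse X * (1/2))) * inverse (Y / X)) = c / Y" if "X \<noteq> 0" for X Y :: real
        using that by (cases "Y = 0") (simp_all add: field_simps)
      have "2 * ((c * (inverse ((cos u)\<^sup>2) * (1/2))) * inverse (1 + (c * tan u)\<^sup>2)) = c / ((cos u)\<^sup>2 + c\<^sup>2 * (sin u)\<^sup>2)"
        unfolding e1 by (rule frac) (use cu in simp)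
      also have "\<dots> = (1 - r)\<^sup>2 * c / ((1 - r)\<^sup>2 * ((cos u)\<^sup>2 + c\<^sup>2 * (sin u)\<^sup>2))"
        using r by simp
      also have "(1 - r)\<^sup>2 * c = 1 - r\<^sup>2" using r by (simp add: c_def power2_eq_square field_simps)
      finally show ?thesis unfolding e poisson_kernel_def u2 .
    qed
    ultimately show "((\<lambda>\<phi>. 2 * arctan (c * tan ((\<phi> - \<theta>) / 2))) has_vector_derivative poisson_kernel r (\<phi> - \<theta>))
        (at \<phi> within {0..pi})"
      by (simp add: has_real_derivative_iff_has_vector_derivative has_vector_derivative_at_within)
  qed simp
  then show ?thesis by (simp add: c_def arctan_minus)
qed

lemma poisson_integral_le:
  assumes \<theta>: "0 < \<theta>" "\<theta> < pi" and r: "0 \<le> r" "r < 1"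
  shows "integral {0..pi} (\<lambda>\<phi>. poisson_kernel r (\<phi> - \<theta>)) \<le> 2 * pi"
  unfolding integral_unique[OF poisson_integral[OF assms]]
  using arctan_ubound[of "(1 + r) / (1 - r) * tan ((pi - \<theta>) / 2)"]
    arctan_ubound[of "(1 + r) / (1 - r) * tan (\<theta> / 2)"] by linarith

text \<open>For interior \<open>\<theta>\<close> both tangents are positive, so both arctangents
  tend to \<open>pi / 2\<close>: the whole mass \<open>2 pi\<close> concentrates inside
  \<open>[0, pi]\<close>.\<close>

lemma poisson_integral_limit:
  assumes \<theta>: "0 < \<theta>" "\<theta> < pi"
  shows "((\<lambda>r. integral {0..pi} (\<lambda>\<phi>. poisson_kernel r (\<phi> - \<theta>))) \<longlongrightarrow> 2 * pi) (at_left 1)"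
proof -
  have c: "filterlim (\<lambda>r. (1 + r) / (1 - r)) at_top (at_left (1::real))"
    unfolding divide_inverse
  proof (rule filterlim_tendsto_pos_mult_at_top)
    show "((\<lambda>r. 1 + r) \<longlongrightarrow> (2::real)) (at_left 1)" by (rule tendsto_eq_intros refl)+ simp
    have "((\<lambda>r. 1 - r) \<longlongrightarrow> (0::real)) (at_left 1)" by (rule tendsto_eq_intros refl)+ simp
    then show "filterlim (\<lambda>r. inverse (1 - r)) at_top (at_left (1::real))"
      by (rule filterlim_inverse_at_top) (simp add: eventually_at_filter)
  qed simp
  have *: "((\<lambda>r. 2 * arctan ((1 + r) / (1 - r) * t)) \<longlongrightarrow> 2 * (pi / 2)) (at_left 1)" if "t > 0" for t
    using filterlim_compose[OF tendsto_arctan_at_top filterlim_at_top_mult_tendsto_pos[OF tendsto_const that c]]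
    by (rule tendsto_mult_left)
  have "((\<lambda>r. 2 * arctan ((1 + r) / (1 - r) * tan ((pi - \<theta>) / 2))
      + 2 * arctan ((1 + r) / (1 - r) * tan (\<theta> / 2))) \<longlongrightarrow> 2 * (pi / 2) + 2 * (pi / 2)) (at_left 1)"
    using \<theta> by (intro tendsto_add * tan_gt_zero) auto
  moreover have "\<forall>\<^sub>F r in at_left 1. 2 * arctan ((1 + r) / (1 - r) * tan ((pi - \<theta>) / 2))
      + 2 * arctan ((1 + r) / (1 - r) * tan (\<theta> / 2)) = integral {0..pi} (\<lambda>\<phi>. poisson_kernel r (\<phi> - \<theta>))"
    using eventually_at_left_real[of 0 1]
    by (auto elim!: eventually_mono simp: integral_unique[OF poisson_integral[OF \<theta>]])
  ultimately show ?thesis by (rule Lim_transform_eventually[THEN tendsto_eq_rhs]) simp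
qed

text \<open>An approximate identity argument in which the test function varies with \<open>r\<close>
  as well. The deviation of \<open>R r \<phi>\<close> from \<open>R 1 \<theta>\<close> is at most a
  small constant plus a multiple of \<open>1 - cos (\<phi> - \<theta>)\<close>, and the kernel
  suppresses the latter.\<close>

lemma poisson_convergence:
  fixes R :: "real \<Rightarrow> real \<Rightarrow> complex"
  assumes \<theta>: "0 < \<theta>" "\<theta> < pi" and R: "continuous_on ({0..1} \<times> {0..pi}) (\<lambda>(r, \<phi>). R r \<phi>)"
  shows "((\<lambda>r. integral {0..pi} (\<lambda>\<phi>. of_real (poisson_kernel r (\<phi> - \<theta>)) * R r \<phi>)) \<longlongrightarrow> 2 * of_real pi * R 1 \<theta>) (at_left 1)"
proof -
  let ?P = "\<lambda>r \<phi>. poisson_kernel r (\<phi> - \<theta>)"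
  define D where "D = (\<lambda>r. integral {0..pi} (\<lambda>\<phi>. of_real (?P r \<phi>) * (R r \<phi> - R 1 \<theta>)))"
  have "bounded ((\<lambda>(r, \<phi>). R r \<phi>) ` ({0..1} \<times> {0..pi}))"
    by (intro compact_imp_bounded compact_continuous_image R compact_Times) auto
  then obtain B where B: "\<And>r \<phi>. r \<in> {0..1} \<Longrightarrow> \<phi> \<in> {0..pi} \<Longrightarrow> norm (R r \<phi>) \<le> B"
    unfolding bounded_iff by fast
  have cR: "continuous_on {0..pi} (R r)" if "r \<in> {0..1}" for r
  proof -
    have "continuous_on {0..pi} ((\<lambda>(r, \<phi>). R r \<phi>) \<circ> (\<lambda>\<phi>. (r, \<phi>)))"
      by (intro continuous_on_compose continuous_intros continuous_on_subset[OF R]) (use that in auto)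
    then show ?thesis by (simp add: o_def)
  qed
  have "(D \<longlongrightarrow> 0) (at_left 1)"
  proof (rule tendstoI)
    fix e' :: real assume "e' > 0"
    \<comment> \<open>The final estimate is \<open>2 pi e\<close> from the mass of the kernel plus
      \<open>e\<close> from the suppressed term.\<close>
    define e where "e = e' / (2 * pi + 1)"
    have "2 * pi + 1 > 0" using pi_gt_zero by linarith
    then have e: "e > 0" "e * (2 * pi + 1) = e'" using \<open>e' > 0\<close> by (auto simp: e_def)
    obtain d where d: "d > 0" "\<And>r \<phi>. r \<in> {0..1} \<Longrightarrow> \<phi> \<in> {0..pi} \<Longrightarrow> dist (r, \<phi>) (1, \<theta>) < d \<Longrightarrow> norm (R r \<phi> - R 1 \<theta>) < e"
      using R e(1) \<theta> unfolding continuous_on_iff by (force simp: dist_norm)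
    \<comment> \<open>Half of \<open>d\<close> is reserved for \<open>1 - r\<close>; the cap
      \<open>pi\<close> keeps the cosine decreasing on the range used.\<close>
    define d' where "d' = min (d / 2) pi"
    have d': "0 < d'" "d' \<le> pi" "d' \<le> d / 2" using d(1) by (auto simp: d'_def)
    have cd: "cos d' < 1" using cos_monotone_0_pi[of 0 d'] d' by simp
    \<comment> \<open>Chosen so that beyond the distance \<open>d'\<close> the term
      \<open>C * (1 - cos (\<phi> - \<theta>))\<close> is at least the trivial bound
      \<open>2 * B\<close>.\<close>
    define C where "C = 2 * B / (1 - cos d')"
    have B0: "B \<ge> 0" by (rule order_trans[OF norm_ge_zero B[of 0 0]]) auto
    have C0: "C \<ge> 0" using B0 cd by (simp add: C_def)
    have bound: "norm (R r \<phi> - R 1 \<theta>) \<le> e + C * (1 - cos (\<phi> - \<theta>))"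
      if "r \<in> {0..1}" "1 - r < d / 2" "\<phi> \<in> {0..pi}" for r \<phi>
    proof (cases "\<bar>\<phi> - \<theta>\<bar> < d'")
      case True
      have "dist (r, \<phi>) (1, \<theta>) \<le> \<bar>r - 1\<bar> + \<bar>\<phi> - \<theta>\<bar>"
        using sqrt_sum_squares_le_sum_abs[of "r - 1" "\<phi> - \<theta>"] by (simp add: dist_Pair_Pair dist_real_def)
      also have "\<dots> < d" using that True d' by auto
      finally have "norm (R r \<phi> - R 1 \<theta>) < e" using d(2) that by blast
      moreover have "C * (1 - cos (\<phi> - \<theta>)) \<ge> 0" using C0 by simp
      ultimately show ?thesis by linarith
    next
      case False
      have "cos \<bar>\<phi> - \<theta>\<bar> \<le> cos d'" using False that \<theta> d' by (intro cos_monotone_0_pi_le) auto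
      then have "(2 * B / (1 - cos d')) * (1 - cos d') \<le> C * (1 - cos (\<phi> - \<theta>))"
        unfolding C_def[symmetric] using C0 by (intro mult_left_mono) auto
      then have "2 * B \<le> C * (1 - cos (\<phi> - \<theta>))" using cd by simp
      moreover have "norm (R r \<phi> - R 1 \<theta>) \<le> B + B"
        using B[of r \<phi>] B[of 1 \<theta>] that \<theta> norm_triangle_ineq4[of "R r \<phi>" "R 1 \<theta>"] by force
      ultimately show ?thesis using e by linarith
    qed
    have lim: "((\<lambda>r::real. C * (1 - r\<^sup>2) * pi) \<longlongrightarrow> 0) (at_left 1)" by (rule tendsto_eq_intros refl)+ simp
    have "\<forall>\<^sub>F r in at_left 1. C * (1 - r\<^sup>2) * pi < e"
      using order_tendstoD(2)[OF lim e(1)] .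
    moreover have "\<forall>\<^sub>F r in at_left 1. r \<in> {max (1/2) (1 - d / 2)<..<1}"
      using d(1) by (intro eventually_at_left_real) auto
    ultimately show "\<forall>\<^sub>F r in at_left 1. dist (D r) 0 < e'"
    proof eventually_elim
      case (elim r)
      then have r: "0 \<le> r" "r < 1" "1/2 \<le> r" "1 - r < d / 2" "r \<in> {0..1}" by auto
      have "norm (D r) \<le> integral {0..pi} (\<lambda>\<phi>. e * ?P r \<phi> + C * (1 - r\<^sup>2))"
        unfolding D_def
      proof (rule integral_norm_bound_integral)
        show "(\<lambda>\<phi>. of_real (?P r \<phi>) * (R r \<phi> - R 1 \<theta>)) integrable_on {0..pi}"
          by (intro integrable_continuous_real continuous_intros cR r)
        show "(\<lambda>\<phi>. e * ?P r \<phi> + C * (1 - r\<^sup>2)) integrable_on {0..pi}"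
          by (intro integrable_continuous_real continuous_intros r)
        fix \<phi> assume \<phi>: "\<phi> \<in> {0..pi}"
        have "norm (of_real (?P r \<phi>) * (R r \<phi> - R 1 \<theta>)) = ?P r \<phi> * norm (R r \<phi> - R 1 \<theta>)"
          using poisson_kernel_nonneg[OF r(1,2)] by (simp add: norm_mult)
        also have "\<dots> \<le> ?P r \<phi> * (e + C * (1 - cos (\<phi> - \<theta>)))"
          using bound[OF r(5,4) \<phi>] poisson_kernel_nonneg[OF r(1,2)] by (rule mult_left_mono)
        also have "\<dots> = e * ?P r \<phi> + C * (?P r \<phi> * (1 - cos (\<phi> - \<theta>)))" by (simp add: algebra_simps)
        also have "\<dots> \<le> e * ?P r \<phi> + C * (1 - r\<^sup>2)"
          using poisson_kernel_mult_le[OF r(3,2)] C0 by (intro add_left_mono mult_left_mono) auto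
        finally show "norm (of_real (?P r \<phi>) * (R r \<phi> - R 1 \<theta>)) \<le> e * ?P r \<phi> + C * (1 - r\<^sup>2)" .
      qed
      also have "\<dots> = e * integral {0..pi} (?P r) + C * (1 - r\<^sup>2) * pi"
        by (subst integral_add) (auto intro!: integrable_continuous_real continuous_intros r)
      also have "\<dots> < e * (2 * pi) + e"
        using mult_left_mono[OF poisson_integral_le[OF \<theta> r(1,2)], of e] e elim by linarith
      finally show ?case using e(2) by (simp add: algebra_simps)
    qed
  qed
  moreover have "((\<lambda>r. of_real (integral {0..pi} (?P r)) * R 1 \<theta>) \<longlongrightarrow> of_real (2 * pi) * R 1 \<theta>) (at_left 1)"
    by (intro tendsto_intros poisson_integral_limit \<theta>)
  ultimately have "((\<lambda>r. D r + of_real (integral {0..pi} (?P r)) * R 1 \<theta>) \<longlongrightarrow> 0 + of_real (2 * pi) * R 1 \<theta>) (at_left 1)"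
    by (rule tendsto_add)
  moreover have "\<forall>\<^sub>F r in at_left 1. D r + of_real (integral {0..pi} (?P r)) * R 1 \<theta> =
      integral {0..pi} (\<lambda>\<phi>. of_real (?P r \<phi>) * R r \<phi>)"
    using eventually_at_left_real[OF zero_less_one]
  proof eventually_elim
    case (elim r)
    then have r: "0 \<le> r" "r < 1" "r \<in> {0..1}" by auto
    have i1: "(\<lambda>\<phi>. of_real (?P r \<phi>) * R r \<phi>) integrable_on {0..pi}"
      by (intro integrable_continuous_real continuous_intros cR r)
    have i2: "(\<lambda>\<phi>. complex_of_real (?P r \<phi>)) integrable_on {0..pi}"
      by (intro integrable_continuous_real continuous_intros r)
    have i3: "(\<lambda>\<phi>. of_real (?P r \<phi>) * R 1 \<theta>) integrable_on {0..pi}"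
      by (intro integrable_continuous_real continuous_intros r)
    have "D r = integral {0..pi} (\<lambda>\<phi>. of_real (?P r \<phi>) * R r \<phi>) - integral {0..pi} (\<lambda>\<phi>. of_real (?P r \<phi>) * R 1 \<theta>)"
      unfolding D_def by (subst integral_diff[OF i1 i3, symmetric]) (simp add: algebra_simps)
    also have "integral {0..pi} (\<lambda>\<phi>. of_real (?P r \<phi>) * R 1 \<theta>) = integral {0..pi} (\<lambda>\<phi>. of_real (?P r \<phi>)) * R 1 \<theta>"
      by (rule integral_mult_left)
    also have "integral {0..pi} (\<lambda>\<phi>. complex_of_real (?P r \<phi>)) = of_real (integral {0..pi} (?P r))"
      by (intro integral_unique has_integral_of_real integrable_integral integrable_continuous_real continuous_intros r)
    finally show ?case by simp
  qed
  ultimately show ?thesis by (rule Lim_transform_eventually[THEN tendsto_eq_rhs]) simp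
qed

section \<open>The q-Mehler operator\<close>

lemma joukowski_cis: "joukowski (cis \<theta>) = of_real (cos \<theta>)"
  by (simp add: joukowski_def complex_eq_iff cis_inverse inverse_eq_divide[symmetric])

lemma zpt_cos: "\<phi> \<in> {0..pi} \<Longrightarrow> zpt (of_real (cos \<phi>)) = cis \<phi>"
  by (subst zpt_of_real) (auto simp: arccos_cos cis_conv_exp)

lemma of_real_eq_joukowski_cis: "x \<in> {-1..1} \<Longrightarrow> of_real x = joukowski (cis (arccos x))"
  by (simp add: joukowski_cis)

text \<open>On \<open>[0, pi]\<close> this is \<open>wH q (cos \<phi>) * sin \<phi>\<close>. The
  square root has cancelled, so continuity holds up to the endpoints.\<close>

definition hermite_weight :: "real \<Rightarrow> real \<Rightarrow> complex" where
  "hermite_weight q \<phi> = qpoch (of_real q) q * circle_weight q (cis \<phi>) / (2 * of_real pi)"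

text \<open>\<open>Tq\<close> conjugated by multiplication with \<open>h\<close>. Both arguments are
  complex: \<open>r\<close> for the sake of Taylor expansion, \<open>x\<close> for the continuation
  to the ellipse.\<close>

definition mehler_op :: "real \<Rightarrow> complex \<Rightarrow> (real \<Rightarrow> complex) \<Rightarrow> complex \<Rightarrow> complex" where
  "mehler_op q r g x = qpoch (r\<^sup>2) q * integral {0..pi} (\<lambda>\<phi>. hermite_weight q \<phi> * g (cos \<phi>) / mehler_den q r x (cis \<phi>))"

abbreviation (input) Herm :: "real \<Rightarrow> nat \<Rightarrow> real \<Rightarrow> complex" where
  "Herm q n x \<equiv> of_real (qHermite q n x)"

context
  fixes q :: real
  assumes q: "0 < q" "q < 1"
begin

lemma continuous_on_mehler_den [continuous_intros]:
  assumes "continuous_on S f" "continuous_on S g" "continuous_on S h" "\<And>s. s \<in> S \<Longrightarrow> h s \<noteq> 0"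
  shows "continuous_on S (\<lambda>s. mehler_den q (f s) (g s) (h s))"
  unfolding mehler_den_def by (intro continuous_intros continuous_on_hsym q assms) (use assms in auto)

lemma continuous_on_hermite_weight [continuous_intros]:
  assumes "continuous_on S f"
  shows "continuous_on S (\<lambda>s. hermite_weight q (f s))"
  unfolding hermite_weight_def circle_weight_def by (intro continuous_intros continuous_on_qpoch q assms) auto

text \<open>On the unit circle \<open>1 / z^2\<close> is the conjugate of \<open>z^2\<close>, so the
  weight is a number times its conjugate.\<close>

lemma circle_weight_nonneg: "norm z = 1 \<Longrightarrow> circle_weight q z = of_real ((norm (qpoch (z\<^sup>2) q))\<^sup>2)"
  unfolding circle_weight_def complex_norm_square using cnj_qpoch[OF q, of "z\<^sup>2"]
  by (simp add: complex_div_cnj[of 1] divide_conv_cnj[of "z ^ 2"] norm_power)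

text \<open>The zeros of \<open>(A; q)\<close> are the \<open>q^(-k)\<close>, and only
  \<open>k = 0\<close> gives modulus at most 1. Covers the boundary value \<open>r = 1\<close> in
  the Poisson limit.\<close>

lemma qpoch_nonzero_closed_disc:
  assumes "norm A \<le> 1" "A \<noteq> 1"
  shows "qpoch A q \<noteq> 0"
proof
  assume "qpoch A q = 0"
  then obtain k where k: "A * of_real q ^ k = 1" using qpoch_eq_0_iff[OF q] by blast
  have "k \<noteq> 0" using k assms by (intro notI) simp
  then have "q ^ k < 1" using q by (simp add: power_less_one_iff)
  moreover have "norm A * q ^ k = 1" using arg_cong[OF k, of norm] q by (simp add: norm_mult norm_power)
  moreover have "norm A * q ^ k \<le> 1 * q ^ k" using assms q by (intro mult_right_mono) auto
  ultimately show False by linarith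
qed

lemma hermite_weight_nonneg: "\<exists>c\<ge>0. hermite_weight q \<phi> = of_real c"
proof -
  obtain c where c: "c > 0" "qpoch (of_real q) q = of_real c" using qpoch_of_real_pos[OF q q(2)] by blast
  have "hermite_weight q \<phi> = of_real (c * (norm (qpoch ((cis \<phi>)\<^sup>2) q))\<^sup>2 / (2 * pi))"
    unfolding hermite_weight_def c(2) by (subst circle_weight_nonneg) auto
  moreover have "c * (norm (qpoch ((cis \<phi>)\<^sup>2) q))\<^sup>2 / (2 * pi) \<ge> 0" using c(1) by simp
  ultimately show ?thesis by blast
qed

lemma hermite_weight_nonzero:
  assumes "0 < \<phi>" "\<phi> < pi"
  shows "hermite_weight q \<phi> \<noteq> 0"
proof -
  have "cis (2 * \<phi>) \<noteq> 1"
  proof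
    assume "cis (2 * \<phi>) = 1"
    then have "cos (2 * \<phi>) = 1" by (metis cis.sel(1) one_complex.sel(1))
    then have "sin \<phi> = 0" by (simp add: cos_double_sin)
    then show False using sin_gt_zero[OF assms] by simp
  qed
  then have "(cis \<phi>)\<^sup>2 \<noteq> 1" by (simp add: Complex.DeMoivre)
  then have "qpoch ((cis \<phi>)\<^sup>2) q \<noteq> 0"
    by (intro qpoch_nonzero_closed_disc) (auto simp: norm_power)
  moreover have "qpoch (of_real q) q \<noteq> 0" using q by (intro qpoch_nonzero[OF q]) auto
  ultimately show ?thesis unfolding hermite_weight_def by (simp add: circle_weight_nonneg)
qed

lemma mehler_den_real_nonzero:
  assumes "x \<in> {-1..1}" "norm r < 1"
  shows "mehler_den q r (of_real x) (cis \<phi>) \<noteq> 0"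
  using mehler_den_nonzero_circle[OF q, of "cis (arccos x)" "cis \<phi>" r] assms
  by (simp add: of_real_eq_joukowski_cis)

lemma mehler_op_integrand_continuous:
  assumes g: "continuous_on {-1..1} g" and r: "norm r < 1" and x: "x \<in> {-1..1}"
  shows "continuous_on {0..pi} (\<lambda>\<phi>. hermite_weight q \<phi> * g (cos \<phi>) / mehler_den q r (of_real x) (cis \<phi>))"
proof -
  have "continuous_on {0..pi} (g \<circ> cos)"
    by (intro continuous_on_compose continuous_intros continuous_on_subset[OF g]) auto
  then show ?thesis unfolding o_def
    by (intro continuous_intros continuous_on_mehler_den continuous_on_hermite_weight) (auto simp: mehler_den_real_nonzero[OF x r])
qed

lemma continuous_on_mehler_op:
  assumes g: "continuous_on {-1..1} g" and r: "norm r < 1"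
  shows "continuous_on {-1..1} (\<lambda>x. mehler_op q r g (of_real x))"
proof -
  have "continuous_on ({-1..1::real} \<times> {0..pi}) (g \<circ> (\<lambda>p. cos (snd p)))"
    by (intro continuous_on_compose continuous_intros continuous_on_subset[OF g]) auto
  then have "continuous_on ({-1..1} \<times> {0..pi}) (\<lambda>(x, \<phi>). hermite_weight q \<phi> * g (cos \<phi>) / mehler_den q r (of_real x) (cis \<phi>))"
    unfolding case_prod_unfold o_def
    by (intro continuous_intros continuous_on_mehler_den continuous_on_hermite_weight) (auto simp: mehler_den_real_nonzero[OF _ r])
  then have "continuous_on {-1..1} (\<lambda>x. integral (cbox 0 pi) (\<lambda>\<phi>. hermite_weight q \<phi> * g (cos \<phi>) / mehler_den q r (of_real x) (cis \<phi>)))"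
    by (intro integral_continuous_on_param) simp
  then show ?thesis unfolding mehler_op_def by (simp add: continuous_on_mult_left)
qed

lemma mehler_op_holomorphic_parameter:
  assumes g: "continuous_on {-1..1} g" and x: "x \<in> {-1..1}"
  shows "(\<lambda>r. mehler_op q r g (of_real x)) holomorphic_on ball 0 1"
proof -
  have "continuous_on (ball (0::complex) 1 \<times> {0..pi}) (g \<circ> (\<lambda>p. cos (snd p)))"
    by (intro continuous_on_compose continuous_intros continuous_on_subset[OF g]) auto
  then have "continuous_on (ball 0 1 \<times> {0..pi}) (\<lambda>(r, \<phi>). hermite_weight q \<phi> * g (cos \<phi>) / mehler_den q r (of_real x) (cis \<phi>))"
    unfolding case_prod_unfold o_def
    by (intro continuous_intros continuous_on_mehler_den continuous_on_hermite_weight) (auto simp: mehler_den_real_nonzero[OF x])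
  moreover have "(\<lambda>r. hermite_weight q \<phi> * g (cos \<phi>) / mehler_den q r (of_real x) (cis \<phi>)) holomorphic_on ball 0 1" for \<phi>
    unfolding mehler_den_def using mehler_den_real_nonzero[OF x]
    by (intro holomorphic_intros holomorphic_on_hsym q) (auto simp: mehler_den_def)
  ultimately have "(\<lambda>r. integral {0..pi} (\<lambda>\<phi>. hermite_weight q \<phi> * g (cos \<phi>) / mehler_den q r (of_real x) (cis \<phi>))) analytic_on ball 0 1"
    by (intro analytic_on_parameter_integral) auto
  then have "(\<lambda>r. integral {0..pi} (\<lambda>\<phi>. hermite_weight q \<phi> * g (cos \<phi>) / mehler_den q r (of_real x) (cis \<phi>))) holomorphic_on ball 0 1"
    by (rule analytic_imp_holomorphic)
  then show ?thesis unfolding mehler_op_def by (intro holomorphic_intros holomorphic_on_qpoch q) auto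
qed

text \<open>The constant \<open>(q; q) / 2\<close> is the \<open>(q; q) / (2 pi)\<close> of the
  weight times the \<open>pi\<close> gained by unfolding the half circle.\<close>

lemma mehler_op_Hermite_circ:
  assumes r: "norm r < 1" and w: "norm w = 1"
  shows "mehler_op q r (Herm q n) (joukowski w) = qpoch (of_real q) q / 2 * (qpoch (r\<^sup>2) q *
     circle_mean (\<lambda>z. circle_weight q z * (1 / mehler_den q r (joukowski w) z) * cqHermite q n (joukowski z)))"
proof -
  define \<Phi> where "\<Phi> = (\<lambda>z. circle_weight q z * (1 / mehler_den q r (joukowski w) z) * cqHermite q n (joukowski z))"
  have w0: "w \<noteq> 0" using w by auto
  have "continuous_on {z. norm z = 1} \<Phi>"
    unfolding \<Phi>_def circle_weight_def joukowski_def[of "_ :: complex"]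
  proof (intro continuous_intros continuous_on_qpoch q continuous_on_mehler_den)
    have "(\<lambda>z. cqHermite q n ((z + 1 / z) / 2)) holomorphic_on {z. z \<noteq> 0}"
      by (intro holomorphic_intros) auto
    then show "continuous_on {z. norm z = 1} (\<lambda>z. cqHermite q n ((z + 1 / z) / 2))"
      by (rule continuous_on_subset[OF holomorphic_on_imp_continuous_on]) auto
    show "\<forall>z\<in>{z. norm z = 1}. mehler_den q r ((w + 1 / w) / 2) z \<noteq> 0"
      using mehler_den_nonzero_circle[OF q w _ r] by (simp add: joukowski_def)
  qed auto
  moreover have "\<Phi> (1 / z) = \<Phi> z" for z
    unfolding \<Phi>_def by (simp add: mehler_den_inverse joukowski_inverse circle_weight_def power_one_over mult.commute)
  ultimately have h: "integral {0..pi} (\<lambda>\<phi>. \<Phi> (cis \<phi>)) = of_real pi * circle_mean \<Phi>"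
    by (rule half_circle_integral)
  have "integral {0..pi} (\<lambda>\<phi>. hermite_weight q \<phi> * Herm q n (cos \<phi>) / mehler_den q r (joukowski w) (cis \<phi>)) =
     integral {0..pi} (\<lambda>\<phi>. qpoch (of_real q) q / (2 * of_real pi) * \<Phi> (cis \<phi>))"
    by (intro integral_cong) (simp add: \<Phi>_def hermite_weight_def joukowski_cis cqHermite_of_real)
  also have "\<dots> = qpoch (of_real q) q / (2 * of_real pi) * (of_real pi * circle_mean \<Phi>)"
    unfolding h[symmetric] by (rule integral_mult_right)
  finally show ?thesis unfolding mehler_op_def \<Phi>_def by simp
qed

text \<open>Symmetry moves the raising operator from the kernel with parameter \<open>p r\<close> to
  \<open>H_n\<close>. On the kernel it produces \<open>1 - r^2\<close>, the very factor that
  completes \<open>(q r^2; q)\<close> to \<open>(r^2; q)\<close>; on \<open>H_n\<close> it produces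
  \<open>p^(-n)\<close>.\<close>

lemma mehler_op_Hermite_scale:
  fixes p :: real
  assumes p: "0 < p" "p\<^sup>2 = q" and r: "norm r < 1" and w: "norm w = 1"
  shows "mehler_op q (of_real p * r) (Herm q n) (joukowski w) = of_real p ^ n * mehler_op q r (Herm q n) (joukowski w)"
proof -
  have p1: "p < 1" using p q one_le_power[of p 2] by (cases "p < 1") auto
  \<comment> \<open>The kernel with parameter \<open>p r\<close> can be singular only for
    \<open>norm z \<le> p |r|\<close> or \<open>norm z * p |r| \<ge> 1\<close>. Any value strictly
    between \<open>p |r|\<close> and \<open>p\<close> leaves the room needed for the contour
    shift.\<close>
  define \<rho> where "\<rho> = p * ((1 + norm r) / 2)"
  have n1: "norm r < (1 + norm r) / 2" "(1 + norm r) / 2 < 1" "(1 + norm r) / 2 > 0"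
    using r by (auto simp: field_simps intro!: add_pos_nonneg)
  have \<rho>: "0 < \<rho>" "\<rho> < p"
    using p n1 unfolding \<rho>_def by (auto intro!: mult_pos_pos) 
  have pr\<rho>: "norm (of_real p * r) < \<rho>" using p n1 by (simp add: \<rho>_def norm_mult)
  then have pr: "norm (of_real p * r) < 1" using \<rho> p1 by linarith
  let ?x = "joukowski w"
  define A where "A = (\<lambda>z. 1 / mehler_den q (of_real p * r) ?x z)"
  define B where "B = (\<lambda>z. cqHermite q n (joukowski z))"
  have w0: "w \<noteq> 0" using w by auto
  let ?S = "{z::complex. \<rho> < norm z \<and> norm z < 1 / \<rho>}"
  have oS: "open ?S" by (intro open_Collect_conj open_Collect_less continuous_intros)
  have S0: "z \<noteq> 0" if "z \<in> ?S" for z using that \<rho> by auto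
  have nz: "mehler_den q (of_real p * r) ?x z \<noteq> 0" if "z \<in> ?S" for z
  proof -
    have "norm (of_real p * r) * norm z \<le> \<rho> * norm z" using pr\<rho> by (intro mult_right_mono) auto
    also have "\<dots> < 1" using that \<rho> by (simp add: field_simps)
    finally have "norm (of_real p * r * z) < 1" by (simp add: norm_mult)
    then show ?thesis using that pr\<rho> w by (intro mehler_den_nonzero[OF q w0 S0[OF that]]) auto
  qed
  have hA: "A holomorphic_on ?S"
    unfolding A_def using nz S0 unfolding mehler_den_def
    by (intro holomorphic_intros holomorphic_on_hsym q oS) auto
  have hB: "B holomorphic_on ?S"
    unfolding B_def joukowski_def using S0 by (intro holomorphic_intros) auto
  have sA: "A (1 / z) = A z" and sB: "B (1 / z) = B z" for z
    by (simp_all add: A_def B_def mehler_den_inverse joukowski_inverse)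
  have "circle_mean (\<lambda>z. circle_weight q z * ((1 - r\<^sup>2) / mehler_den q r ?x z) * B z) = circle_mean (\<lambda>z. circle_weight q z * A z * (B z / of_real p ^ n))"
  proof (rule circle_mean_raise_symmetric[OF q p(1) p1 p(2) \<rho> hA sA hB sB])
    fix z :: complex assume z: "norm z = 1"
    then have z0: "z \<noteq> 0" by auto
    show "(1 - z\<^sup>2) * ((1 - r\<^sup>2) / mehler_den q r ?x z) = A (of_real p * z) - z\<^sup>2 * A (z / of_real p)"
      unfolding A_def by (rule mehler_den_raise[symmetric, OF q _ p(2) z0]) (use p mehler_den_nonzero_circle[OF q w z r] in auto)
    show "(1 - z\<^sup>2) * (B z / of_real p ^ n) = B (of_real p * z) - z\<^sup>2 * B (z / of_real p)"
      unfolding B_def by (rule cqHermite_raise[symmetric, OF _ p(2) z0]) (use p in auto)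
  qed
  moreover have "(\<lambda>z. circle_weight q z * ((1 - r\<^sup>2) / mehler_den q r ?x z) * B z) = (\<lambda>z. (1 - r\<^sup>2) * (circle_weight q z * (1 / mehler_den q r ?x z) * B z))"
    by (auto simp: field_simps)
  moreover have "(\<lambda>z. circle_weight q z * A z * (B z / of_real p ^ n)) = (\<lambda>z. (1 / of_real p ^ n) * (circle_weight q z * A z * B z))"
    by (auto simp: field_simps)
  ultimately have "(1 - r\<^sup>2) * circle_mean (\<lambda>z. circle_weight q z * (1 / mehler_den q r ?x z) * B z) = (1 / of_real p ^ n) * circle_mean (\<lambda>z. circle_weight q z * A z * B z)"
    by (simp only: circle_mean_cmult)
  then have "circle_mean (\<lambda>z. circle_weight q z * A z * B z) = of_real p ^ n * ((1 - r\<^sup>2) * circle_mean (\<lambda>z. circle_weight q z * (1 / mehler_den q r ?x z) * B z))"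
    using p by (simp add: field_simps)
  moreover have "(of_real p * r)\<^sup>2 = of_real q * r\<^sup>2"
    using p by (simp add: power_mult_distrib flip: of_real_power)
  ultimately show ?thesis
    unfolding mehler_op_Hermite_circ[OF r w] mehler_op_Hermite_circ[OF pr w] qpoch_rec[OF q, of "r\<^sup>2"] A_def B_def
    by simp
qed

text \<open>At \<open>r = 1\<close>, \<open>\<phi> = \<theta>\<close> only the first factors of the
  two products with arguments \<open>r e^(i(\<phi>-\<theta>))\<close> and
  \<open>r e^(i(\<theta>-\<phi>))\<close> vanish. With the first factor \<open>1 - r^2\<close> of
  \<open>(r^2; q)\<close> they form the Poisson kernel; \<open>R\<close> collects the rest.\<close>

lemma mehler_op_limit:
  assumes g: "continuous_on {-1..1} g" and \<theta>: "0 < \<theta>" "\<theta> < pi"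
  shows "((\<lambda>r. mehler_op q (of_real r) g (of_real (cos \<theta>))) \<longlongrightarrow> g (cos \<theta>)) (at_left 1)"
proof -
  define w where "w = cis \<theta>"
  have w: "norm w = 1" "w \<noteq> 0" by (simp_all add: w_def)
  define R where "R = (\<lambda>r \<phi>. qpoch (of_real q * (of_real r)\<^sup>2) q * (hermite_weight q \<phi> * g (cos \<phi>)) /
    (qpoch (of_real r * (cis \<phi> * w)) q * qpoch (of_real r / (cis \<phi> * w)) q *
     (qpoch (of_real q * (of_real r * (cis \<phi> / w))) q * qpoch (of_real q * (of_real r * (w / cis \<phi>))) q)))"
  \<comment> \<open>Here \<open>0 < \<theta> < pi\<close> matters: \<open>\<phi> + \<theta>\<close>
    stays strictly between \<open>0\<close> and \<open>2 pi\<close>, so these factors do not vanish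
    even for \<open>r = 1\<close>.\<close>
  have nz1: "qpoch (of_real r * (cis \<phi> * w)) q \<noteq> 0" "qpoch (of_real r / (cis \<phi> * w)) q \<noteq> 0"
    if "r \<in> {0..1}" "\<phi> \<in> {0..pi}" for r \<phi>
  proof -
    have n: "norm (of_real r * (cis \<phi> * w)) = r" "norm (of_real r / (cis \<phi> * w)) = r"
      using that w by (auto simp: norm_mult norm_divide)
    have "cis (\<phi> + \<theta>) \<noteq> 1"
    proof
      assume "cis (\<phi> + \<theta>) = 1"
      then have "cos (\<phi> + \<theta>) = 1" by (metis cis.sel(1) one_complex.sel(1))
      moreover have half: "2 * ((\<phi> + \<theta>) / 2) = \<phi> + \<theta>" by simp
      ultimately have "sin ((\<phi> + \<theta>) / 2) = 0" using cos_double_sin[of "(\<phi> + \<theta>) / 2"] unfolding half by simp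
      moreover have "sin ((\<phi> + \<theta>) / 2) > 0" using that \<theta> by (intro sin_gt_zero) auto
      ultimately show False by simp
    qed
    then have c: "cis \<phi> * w \<noteq> 1" by (simp add: w_def cis_mult)
    have ne: "of_real r * (cis \<phi> * w) \<noteq> 1" "of_real r / (cis \<phi> * w) \<noteq> 1"
    proof -
      have "r = 1" if "of_real r * (cis \<phi> * w) = 1 \<or> of_real r / (cis \<phi> * w) = 1"
        using that n by (metis norm_one)
      then show "of_real r * (cis \<phi> * w) \<noteq> 1" "of_real r / (cis \<phi> * w) \<noteq> 1" using c by (auto simp: field_simps)
    qed
    then show "qpoch (of_real r * (cis \<phi> * w)) q \<noteq> 0" "qpoch (of_real r / (cis \<phi> * w)) q \<noteq> 0"
      using qpoch_nonzero_closed_disc[OF _ ne(1)] qpoch_nonzero_closed_disc[OF _ ne(2)] that unfolding n by simp_all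
  qed
  have nz2: "qpoch (of_real q * (of_real r * (cis \<phi> / w))) q \<noteq> 0" "qpoch (of_real q * (of_real r * (w / cis \<phi>))) q \<noteq> 0"
    if "r \<in> {0..1}" for r \<phi>
    using q w order.strict_trans1[OF mult_left_le[of r q] q(2)] that
    by (auto intro!: qpoch_nonzero[OF q] simp: norm_mult norm_divide)
  have "continuous_on ({0..1::real} \<times> {0..pi}) (g \<circ> (\<lambda>p. cos (snd p)))"
    by (intro continuous_on_compose continuous_intros continuous_on_subset[OF g]) auto
  then have cont: "continuous_on ({0..1} \<times> {0..pi}) (\<lambda>(r, \<phi>). R r \<phi>)"
    unfolding R_def case_prod_unfold o_def
    by (intro continuous_intros continuous_on_qpoch continuous_on_hermite_weight q) (use nz1 nz2 w in auto)
  have "qpoch (of_real (r\<^sup>2)) q * (hermite_weight q \<phi> * g (cos \<phi>) / mehler_den q (of_real r) (of_real (cos \<theta>)) (cis \<phi>)) =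
     of_real (poisson_kernel r (\<phi> - \<theta>)) * R r \<phi>" if r: "0 < r" "r < 1" for r \<phi>
  proof -
    have e: "(1 - of_real r * (cis \<phi> / w)) * (1 - of_real r * (w / cis \<phi>)) = of_real (1 - 2 * r * cos (\<phi> - \<theta>) + r\<^sup>2)"
      by (simp add: w_def complex_eq_iff cis_divide cos_diff sin_diff power2_eq_square algebra_simps)
        (use sin_cos_squared_add[of \<phi>] sin_cos_squared_add[of \<theta>] in algebra)
    have "mehler_den q (of_real r) (of_real (cos \<theta>)) (cis \<phi>) =
      qpoch (of_real r * (cis \<phi> * w)) q * qpoch (of_real r / (cis \<phi> * w)) q *
       (((1 - of_real r * (cis \<phi> / w)) * (1 - of_real r * (w / cis \<phi>))) *
       (qpoch (of_real q * (of_real r * (cis \<phi> / w))) q * qpoch (of_real q * (of_real r * (w / cis \<phi>))) q))"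
      unfolding joukowski_cis[symmetric] w_def[symmetric] mehler_den_joukowski[OF q w(2) cis_neq_zero]
      using qpoch_rec[OF q, of "of_real r * (cis \<phi> / w)"] qpoch_rec[OF q, of "of_real r * (w / cis \<phi>)"]
      by (simp add: mult.assoc)
    moreover have "qpoch (of_real (r\<^sup>2)) q = of_real (1 - r\<^sup>2) * qpoch (of_real q * (of_real r)\<^sup>2) q"
      using qpoch_rec[OF q, of "of_real (r\<^sup>2)"] by simp
    ultimately show ?thesis unfolding e R_def poisson_kernel_def by (simp add: mult_ac)
  qed
  then have "\<forall>\<^sub>F r in at_left 1. integral {0..pi} (\<lambda>\<phi>. of_real (poisson_kernel r (\<phi> - \<theta>)) * R r \<phi>)
      = mehler_op q (of_real r) g (of_real (cos \<theta>))"
    using eventually_at_left_real[OF zero_less_one]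
    by (auto elim!: eventually_mono simp: mehler_op_def integral_mult_right[symmetric])
  from Lim_transform_eventually[OF poisson_convergence[OF \<theta> cont] this]
  have "((\<lambda>r. mehler_op q (of_real r) g (of_real (cos \<theta>))) \<longlongrightarrow> 2 * of_real pi * R 1 \<theta>) (at_left 1)" .
  \<comment> \<open>At \<open>r = 1\<close>, \<open>\<phi> = \<theta>\<close> the factors
    \<open>(w^2; q)\<close> and \<open>(1 / w^2; q)\<close> cancel the circle weight, and the two
    \<open>(q; q)\<close> below cancel those of \<open>(q r^2; q)\<close> and of the weight. Only
    \<open>1 / (2 pi)\<close> is left.\<close>
  moreover have "2 * of_real pi * R 1 \<theta> = g (cos \<theta>)"
  proof -
    have "qpoch (of_real q) q \<noteq> 0" using q by (intro qpoch_nonzero[OF q]) auto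
    moreover have "circle_weight q w \<noteq> 0" using hermite_weight_nonzero[OF \<theta>] by (auto simp: hermite_weight_def w_def)
    ultimately show ?thesis
      using w by (simp add: R_def hermite_weight_def w_def[symmetric] circle_weight_def power2_eq_square)
  qed
  ultimately show ?thesis by simp
qed

section \<open>The q-Hermite polynomials as eigenfunctions of the q-Mehler operator\<close>

lemma continuous_on_qHermite: "continuous_on S (Herm q n)"
proof -
  have "continuous_on S (\<lambda>x. cqHermite q n (of_real x))"
    using continuous_on_compose[OF continuous_on_of_real_id continuous_on_subset[OF holomorphic_on_imp_continuous_on[OF holomorphic_on_cqHermite[OF holomorphic_on_ident]]]]
    by (auto simp: o_def)
  then show ?thesis by (simp add: cqHermite_of_real)
qed

lemma mehler_op_Hermite:
  assumes r: "norm r < 1" and x: "x \<in> {-1..1}"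
  shows "mehler_op q r (Herm q n) (of_real x) = r ^ n * Herm q n x"
proof -
  define p where "p = sqrt q"
  have p: "0 < p" "p < 1" "p\<^sup>2 = q" using q by (auto simp: p_def)
  have interior: "mehler_op q r (Herm q n) (of_real x) = r ^ n * Herm q n x" if x: "x \<in> {-1<..<1}" for x
  proof -
    define \<theta> where "\<theta> = arccos x"
    have \<theta>: "0 < \<theta>" "\<theta> < pi" "cos \<theta> = x" using x arccos_lt_bounded[of x] by (auto simp: \<theta>_def)
    have "\<exists>c. \<forall>r. norm r < 1 \<longrightarrow> mehler_op q r (Herm q n) (of_real x) = c * r ^ n"
    proof (rule holomorphic_dilation_eigenfunction[OF _ p(1,2)])
      show "(\<lambda>r. mehler_op q r (Herm q n) (of_real x)) holomorphic_on ball 0 1"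
        by (rule mehler_op_holomorphic_parameter[OF continuous_on_qHermite]) (use x in auto)
      show "mehler_op q (of_real p * r) (Herm q n) (of_real x) = of_real p ^ n * mehler_op q r (Herm q n) (of_real x)"
        if "norm r < 1" for r
        using mehler_op_Hermite_scale[OF p(1,3) that, of "cis \<theta>" n] by (simp add: joukowski_cis \<theta>)
    qed
    then obtain c where c: "\<And>r. norm r < 1 \<Longrightarrow> mehler_op q r (Herm q n) (of_real x) = c * r ^ n" by blast
    have "((\<lambda>r::real. c * of_real r ^ n) \<longlongrightarrow> c * of_real 1 ^ n) (at_left 1)"
      by (intro tendsto_intros)
    moreover have "((\<lambda>r::real. c * of_real r ^ n) \<longlongrightarrow> Herm q n x) (at_left 1)"
    proof (rule Lim_transform_eventually)
      show "((\<lambda>r. mehler_op q (of_real r) (Herm q n) (of_real x)) \<longlongrightarrow> Herm q n x) (at_left 1)"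
        using mehler_op_limit[OF continuous_on_qHermite \<theta>(1,2)] by (simp add: \<theta>)
      show "\<forall>\<^sub>F r in at_left 1. mehler_op q (of_real r) (Herm q n) (of_real x) = c * of_real r ^ n"
        using eventually_at_left_real[OF zero_less_one] by (auto elim!: eventually_mono simp: c)
    qed
    ultimately have "c = Herm q n x" using tendsto_unique[of "at_left (1::real)"] by force
    then show ?thesis using c[OF r] by simp
  qed
  \<comment> \<open>The Poisson limit excludes the endpoints; they are recovered from the continuity
    of both sides in \<open>x\<close>.\<close>
  have "continuous_on {-1..1} (\<lambda>x. mehler_op q r (Herm q n) (of_real x) - r ^ n * Herm q n x)"
    by (intro continuous_intros continuous_on_mehler_op continuous_on_qHermite r)
  moreover have "closure {-1<..<1::real} = {-1..1}" by simp
  ultimately have "mehler_op q r (Herm q n) (of_real x) - r ^ n * Herm q n x = 0"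
    using continuous_constant_on_closure[of "{-1<..<1}" "\<lambda>x. mehler_op q r (Herm q n) (of_real x) - r ^ n * Herm q n x" 0 x] x interior
    by simp
  then show ?thesis by simp
qed

end

section \<open>Density of the q-Hermite polynomials, semigroup and identity limit\<close>

text \<open>The complex linear span, in inductive form so that linear statements reduce to multiples
  of a single \<open>H_n\<close>.\<close>

inductive hermite_span :: "real \<Rightarrow> (real \<Rightarrow> complex) \<Rightarrow> bool" for q where
  base: "hermite_span q (\<lambda>x. c * Herm q n x)"
| add: "hermite_span q f \<Longrightarrow> hermite_span q g \<Longrightarrow> hermite_span q (\<lambda>x. f x + g x)"

text \<open>The three-term recurrence expresses \<open>2 x H_(m+1)\<close> by \<open>H_(m+2)\<close>
  and \<open>H_m\<close>. Iterated from \<open>H_0 = 1\<close>, this puts all powers of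
  \<open>x\<close> into the span.\<close>

lemma hermite_span_mult_id: "hermite_span q f \<Longrightarrow> hermite_span q (\<lambda>x. of_real x * f x)"
proof (induction rule: hermite_span.induct)
  case (base c n)
  show ?case
  proof (cases n)
    case 0
    have "(\<lambda>x. of_real x * (c * Herm q n x)) = (\<lambda>x. c / 2 * Herm q (Suc 0) x)"
      by (simp add: 0 fun_eq_iff)
    then show ?thesis by (simp only: hermite_span.base)
  next
    case (Suc m)
    have "of_real x * (c * Herm q n x) = c / 2 * Herm q (Suc (Suc m)) x + c / 2 * (1 - of_real q ^ Suc m) * Herm q m x" for x
      by (simp add: Suc algebra_simps)
    then show ?thesis using hermite_span.add[OF hermite_span.base hermite_span.base] by presburger
  qed
next
  case (add f g)
  then show ?case using hermite_span.add by (simp add: distrib_left)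
qed

lemma hermite_span_of_real_power: "hermite_span q (\<lambda>x. c * of_real (x ^ n))"
proof (induction n)
  case 0
  show ?case using hermite_span.base[of q c 0] by simp
next
  case (Suc n)
  show ?case using hermite_span_mult_id[OF Suc] by (simp add: mult_ac)
qed

lemma hermite_span_real_polynomial:
  assumes "real_polynomial_function f"
  shows "hermite_span q (\<lambda>x. c * of_real (f x))"
proof -
  obtain a n where f: "f = (\<lambda>x. \<Sum>i\<le>n. a i * x ^ i)"
    using assms real_polynomial_function_iff_sum by blast
  have "hermite_span q (\<lambda>x. c * of_real (\<Sum>i\<le>n. a i * x ^ i))" for n
  proof (induction n)
    case 0
    show ?case using hermite_span_of_real_power[of q "c * of_real (a 0)" 0] by simp
  next
    case (Suc n)
    show ?case using hermite_span.add[OF Suc hermite_span_of_real_power[of q "c * of_real (a (Suc n))" "Suc n"]]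
      by (simp add: distrib_left mult_ac)
  qed
  then show ?thesis by (simp add: f)
qed

lemma hermite_span_dense:
  assumes g: "continuous_on {-1..1} g" and e: "e > 0"
  shows "\<exists>h. hermite_span q h \<and> (\<forall>x\<in>{-1..1}. norm (g x - h x) < e)"
proof -
  have "continuous_on {-1..1} (\<lambda>x. Re (g x))" "continuous_on {-1..1} (\<lambda>x. Im (g x))"
    using g by (auto intro: continuous_intros)
  then obtain u v where u: "real_polynomial_function u" "\<And>x. x \<in> {-1..1} \<Longrightarrow> \<bar>Re (g x) - u x\<bar> < e / 2"
    and v: "real_polynomial_function v" "\<And>x. x \<in> {-1..1} \<Longrightarrow> \<bar>Im (g x) - v x\<bar> < e / 2"
    using Stone_Weierstrass_real_polynomial_function[of "{-1..1::real}" _ "e / 2"] e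
    by (metis compact_Icc half_gt_zero)
  let ?h = "\<lambda>x. 1 * of_real (u x) + \<i> * of_real (v x)"
  have "hermite_span q ?h" by (intro hermite_span.add hermite_span_real_polynomial u v)
  moreover have "norm (g x - ?h x) < e" if "x \<in> {-1..1}" for x
    using cmod_le[of "g x - ?h x"] u(2)[OF that] v(2)[OF that] by simp
  ultimately show ?thesis by blast
qed

text \<open>Serves to show that no \<open>H_n\<close> vanishes identically. Monotonicity carries the
  induction: \<open>2 H_(n+1) - (1 - q^(n+1)) H_n \<ge> 2 H_(n+1) - H_n \<ge> H_(n+1)\<close> at the
  point 1.\<close>

lemma qHermite_1_mono:
  assumes "0 < q" "q < 1"
  shows "1 \<le> qHermite q n 1 \<and> qHermite q n 1 \<le> qHermite q (Suc n) 1"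
proof (induction n)
  case (Suc n)
  have "(1 - q ^ Suc n) * qHermite q n 1 \<le> 1 * qHermite q n 1"
    using assms Suc by (intro mult_right_mono) auto
  then have "qHermite q (Suc n) 1 \<le> qHermite q (Suc (Suc n)) 1"
    using Suc unfolding qHermite.simps by linarith
  with Suc show ?case by linarith
qed simp

lemma mehler_op_cong:
  assumes "\<And>x. x \<in> {-1..1} \<Longrightarrow> g x = g' x"
  shows "mehler_op q r g x = mehler_op q r g' x"
  unfolding mehler_op_def using assms by (intro arg_cong2[of _ _ _ _ "(*)"] integral_cong refl) simp

context
  fixes q :: real
  assumes q: "0 < q" "q < 1"
begin

lemma hermite_span_continuous: "hermite_span q f \<Longrightarrow> continuous_on S f"
  by (induction rule: hermite_span.induct) (auto intro!: continuous_intros continuous_on_qHermite[OF q])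

lemma mehler_op_add:
  assumes "continuous_on {-1..1} f" "continuous_on {-1..1} g" "norm r < 1" "x \<in> {-1..1}"
  shows "mehler_op q r (\<lambda>x. f x + g x) (of_real x) = mehler_op q r f (of_real x) + mehler_op q r g (of_real x)"
proof -
  have "integral {0..pi} (\<lambda>\<phi>. hermite_weight q \<phi> * (f (cos \<phi>) + g (cos \<phi>)) / mehler_den q r (of_real x) (cis \<phi>)) =
     integral {0..pi} (\<lambda>\<phi>. hermite_weight q \<phi> * f (cos \<phi>) / mehler_den q r (of_real x) (cis \<phi>) + hermite_weight q \<phi> * g (cos \<phi>) / mehler_den q r (of_real x) (cis \<phi>))"
    by (simp add: distrib_left add_divide_distrib)
  also have "\<dots> = integral {0..pi} (\<lambda>\<phi>. hermite_weight q \<phi> * f (cos \<phi>) / mehler_den q r (of_real x) (cis \<phi>))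
      + integral {0..pi} (\<lambda>\<phi>. hermite_weight q \<phi> * g (cos \<phi>) / mehler_den q r (of_real x) (cis \<phi>))"
    by (intro integral_add integrable_continuous_real mehler_op_integrand_continuous[OF q] assms)
  finally show ?thesis by (simp add: mehler_op_def distrib_left)
qed

lemma mehler_op_cmult: "mehler_op q r (\<lambda>x. c * f x) x = c * mehler_op q r f x"
proof -
  have "(\<lambda>\<phi>. hermite_weight q \<phi> * (c * f (cos \<phi>)) / mehler_den q r x (cis \<phi>)) = (\<lambda>\<phi>. c * (hermite_weight q \<phi> * f (cos \<phi>) / mehler_den q r x (cis \<phi>)))"
    by (simp add: fun_eq_iff)
  then show ?thesis unfolding mehler_op_def by (simp only: integral_mult_right) (simp only: mult_ac)
qed

lemma mehler_op_diff:
  assumes "continuous_on {-1..1} f" "continuous_on {-1..1} g" "norm r < 1" "x \<in> {-1..1}"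
  shows "mehler_op q r (\<lambda>x. f x - g x) (of_real x) = mehler_op q r f (of_real x) - mehler_op q r g (of_real x)"
  using mehler_op_add[of f "\<lambda>x. - 1 * g x" r x] assms mehler_op_cmult[of r "- 1" g "of_real x"]
  by (simp add: continuous_intros)

text \<open>For real \<open>r\<close> the four factors form two conjugate pairs, with arguments
  \<open>A\<close>, \<open>cnj A\<close> and \<open>B\<close>, \<open>cnj B\<close>.\<close>

lemma mehler_den_pos:
  assumes r: "\<bar>r\<bar> < 1" and x: "x \<in> {-1..1}"
  shows "\<exists>c>0. mehler_den q (of_real r) (of_real x) (cis \<phi>) = of_real c"
proof -
  define w where "w = cis (arccos x)"
  have w: "w \<noteq> 0" "norm w = 1" "of_real x = joukowski w" using of_real_eq_joukowski_cis[OF x] by (auto simp: w_def)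
  define A where "A = of_real r * cis \<phi> * w"
  define B where "B = of_real r * cis \<phi> / w"
  have cw: "cnj w = 1 / w" "cnj (cis \<phi>) = 1 / cis \<phi>"
    by (simp_all add: w_def cis_cnj cis_inverse inverse_eq_divide[symmetric])
  have cnj: "of_real r / (cis \<phi> * w) = cnj A" "of_real r * w / cis \<phi> = cnj B"
    by (simp_all add: A_def B_def cw)
  have "mehler_den q (of_real r) (of_real x) (cis \<phi>) = (qpoch A q * cnj (qpoch A q)) * (qpoch B q * cnj (qpoch B q))"
    unfolding w(3) mehler_den_joukowski[OF q w(1) cis_neq_zero] cnj cnj_qpoch[OF q]
    by (simp add: A_def B_def mult_ac)
  also have "\<dots> = of_real ((norm (qpoch A q))\<^sup>2 * (norm (qpoch B q))\<^sup>2)"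
    unfolding complex_norm_square[symmetric] by simp
  finally have e: "mehler_den q (of_real r) (of_real x) (cis \<phi>) = of_real ((norm (qpoch A q))\<^sup>2 * (norm (qpoch B q))\<^sup>2)" .
  have "norm A < 1" "norm B < 1" using r w by (auto simp: A_def B_def norm_mult norm_divide)
  then have "(norm (qpoch A q))\<^sup>2 * (norm (qpoch B q))\<^sup>2 > 0"
    using qpoch_nonzero[OF q] by simp
  with e show ?thesis by blast
qed

lemma mehler_op_norm_le:
  assumes g: "continuous_on {-1..1} g" and B: "\<And>x. x \<in> {-1..1} \<Longrightarrow> norm (g x) \<le> B"
    and r: "\<bar>r\<bar> < 1" and x: "x \<in> {-1..1}"
  shows "norm (mehler_op q (of_real r) g (of_real x)) \<le> B"
proof -
  define K where "K = (\<lambda>\<phi>. qpoch ((of_real r)\<^sup>2) q * (hermite_weight q \<phi> / mehler_den q (of_real r) (of_real x) (cis \<phi>)))"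
  have rn: "norm (complex_of_real r) < 1" using r by simp
  have cK: "continuous_on {0..pi} K"
    unfolding K_def by (intro continuous_intros continuous_on_mehler_den[OF q] continuous_on_hermite_weight[OF q])
      (auto simp: mehler_den_real_nonzero[OF q x rn])
  have "r\<^sup>2 < 1" using r by (simp add: abs_square_less_1)
  then obtain c where c: "c > 0" "qpoch ((of_real r)\<^sup>2) q = of_real c"
    using qpoch_of_real_pos[OF q, of "r\<^sup>2"] by auto
  have K: "K \<phi> = of_real (Re (K \<phi>))" "Re (K \<phi>) \<ge> 0" for \<phi>
  proof -
    obtain w k where "w \<ge> 0" "hermite_weight q \<phi> = of_real w" "k > 0" "mehler_den q (of_real r) (of_real x) (cis \<phi>) = of_real k"
      using hermite_weight_nonneg[OF q] mehler_den_pos[OF r x] by metis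
    then have "K \<phi> = of_real (c * (w / k))" "c * (w / k) \<ge> 0" using c by (simp_all add: K_def)
    then show "K \<phi> = of_real (Re (K \<phi>))" "Re (K \<phi>) \<ge> 0" by simp_all
  qed
  have P: "mehler_op q (of_real r) h (of_real x) = integral {0..pi} (\<lambda>\<phi>. K \<phi> * h (cos \<phi>))" for h
    unfolding mehler_op_def K_def integral_mult_right[symmetric] by (simp add: mult_ac)
  have "mehler_op q (of_real r) (Herm q 0) (of_real x) = 1"
    using mehler_op_Hermite[OF q rn x, of 0] by simp
  then have "integral {0..pi} K = 1" unfolding P by simp
  then have K1: "integral {0..pi} (\<lambda>\<phi>. Re (K \<phi>)) = 1"
    using integral_complex_of_real integral_linear[OF integrable_continuous_real[OF cK] bounded_linear_Re]
    by (simp add: o_def)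
  have "continuous_on {0..pi} (g \<circ> cos)"
    by (intro continuous_on_compose continuous_intros continuous_on_subset[OF g]) auto
  then have cg: "continuous_on {0..pi} (\<lambda>\<phi>. g (cos \<phi>))" by (simp add: o_def)
  have "norm (integral {0..pi} (\<lambda>\<phi>. K \<phi> * g (cos \<phi>))) \<le> integral {0..pi} (\<lambda>\<phi>. Re (K \<phi>) * B)"
  proof (rule integral_norm_bound_integral)
    show "(\<lambda>\<phi>. K \<phi> * g (cos \<phi>)) integrable_on {0..pi}"
      by (intro integrable_continuous_real continuous_intros cK cg)
    show "(\<lambda>\<phi>. Re (K \<phi>) * B) integrable_on {0..pi}"
      by (intro integrable_continuous_real continuous_intros cK)
    show "norm (K \<phi> * g (cos \<phi>)) \<le> Re (K \<phi>) * B" for \<phi>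
    proof -
      have "norm (K \<phi>) = Re (K \<phi>)" using K[of \<phi>] by (metis abs_of_nonneg norm_of_real)
      then show ?thesis using B[of "cos \<phi>"] K(2)[of \<phi>] by (simp add: norm_mult mult_left_mono)
    qed
  qed
  also have "\<dots> = B" using K1 by simp
  finally show ?thesis unfolding P .
qed

lemma mehler_op_hermite_span:
  assumes "hermite_span q f" "norm r < 1" "norm s < 1" "x \<in> {-1..1}"
  shows "mehler_op q r (\<lambda>y. mehler_op q s f (of_real y)) (of_real x) = mehler_op q (r * s) f (of_real x)"
  using assms(1)
proof (induction rule: hermite_span.induct)
  case (base c n)
  have rs: "norm (r * s) < 1" using assms(2,3) mult_strict_mono'[of "norm r" 1 "norm s" 1] by (simp add: norm_mult)
  have "mehler_op q r (\<lambda>y. mehler_op q s (\<lambda>x. c * Herm q n x) (of_real y)) (of_real x) = mehler_op q r (\<lambda>y. (c * s ^ n) * Herm q n y) (of_real x)"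
    by (rule mehler_op_cong) (simp add: mehler_op_cmult mehler_op_Hermite[OF q assms(3)])
  also have "\<dots> = c * s ^ n * (r ^ n * Herm q n x)" by (simp only: mehler_op_cmult mehler_op_Hermite[OF q assms(2,4)])
  also have "\<dots> = mehler_op q (r * s) (\<lambda>x. c * Herm q n x) (of_real x)"
    by (simp only: mehler_op_cmult mehler_op_Hermite[OF q rs assms(4)]) (simp add: power_mult_distrib mult_ac)
  finally show ?case .
next
  case (add f g)
  have rs: "norm (r * s) < 1" using assms(2,3) mult_strict_mono'[of "norm r" 1 "norm s" 1] by (simp add: norm_mult)
  note c = hermite_span_continuous[OF add(1)] hermite_span_continuous[OF add(2)]
  have "mehler_op q r (\<lambda>y. mehler_op q s (\<lambda>x. f x + g x) (of_real y)) (of_real x) =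
     mehler_op q r (\<lambda>y. mehler_op q s f (of_real y) + mehler_op q s g (of_real y)) (of_real x)"
    by (rule mehler_op_cong) (simp add: mehler_op_add c assms)
  also have "\<dots> = mehler_op q r (\<lambda>y. mehler_op q s f (of_real y)) (of_real x) + mehler_op q r (\<lambda>y. mehler_op q s g (of_real y)) (of_real x)"
    by (intro mehler_op_add continuous_on_mehler_op[OF q] c assms)
  also have "\<dots> = mehler_op q (r * s) (\<lambda>x. f x + g x) (of_real x)"
    using add.IH by (simp add: mehler_op_add[OF c rs assms(4)])
  finally show ?case .
qed

lemma mehler_op_semigroup:
  assumes g: "continuous_on {-1..1} g" and r: "\<bar>r\<bar> < 1" and s: "\<bar>s\<bar> < 1" and x: "x \<in> {-1..1}"
  shows "mehler_op q (of_real r) (\<lambda>y. mehler_op q (of_real s) g (of_real y)) (of_real x) = mehler_op q (of_real (r * s)) g (of_real x)"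
proof -
  have n: "norm (complex_of_real r) < 1" "norm (complex_of_real s) < 1" using r s by auto
  have rs: "\<bar>r * s\<bar> < 1" using r s mult_strict_mono'[of "\<bar>r\<bar>" 1 "\<bar>s\<bar>" 1] by (simp add: abs_mult)
  have nrs: "norm (complex_of_real (r * s)) < 1" using rs by (simp only: norm_of_real)
  let ?d = "mehler_op q (of_real r) (\<lambda>y. mehler_op q (of_real s) g (of_real y)) (of_real x) - mehler_op q (of_real (r * s)) g (of_real x)"
  have "norm ?d \<le> e" if e: "e > 0" for e
  proof -
    obtain h where h: "hermite_span q h" "\<And>x. x \<in> {-1..1} \<Longrightarrow> norm (g x - h x) < e / 2"
      using hermite_span_dense[OF g, of "e / 2" q] e by auto
    note ch = hermite_span_continuous[OF h(1)]
    \<comment> \<open>Both sides agree on \<open>h\<close>, so only the remainder \<open>k\<close>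
      counts; by contraction it contributes at most \<open>e / 2\<close> to each side.\<close>
    define k where "k = (\<lambda>x. g x - h x)"
    have ck: "continuous_on {-1..1} k" unfolding k_def by (intro continuous_intros g ch)
    have k: "norm (k x) \<le> e / 2" if "x \<in> {-1..1}" for x using h(2)[OF that] by (simp add: k_def)
    have "mehler_op q (of_real r) (\<lambda>y. mehler_op q (of_real s) k (of_real y)) (of_real x) =
       mehler_op q (of_real r) (\<lambda>y. mehler_op q (of_real s) g (of_real y) - mehler_op q (of_real s) h (of_real y)) (of_real x)"
      unfolding k_def by (rule mehler_op_cong) (simp add: mehler_op_diff[OF g ch n(2)])
    also have "\<dots> = mehler_op q (of_real r) (\<lambda>y. mehler_op q (of_real s) g (of_real y)) (of_real x)
       - mehler_op q (of_real r) (\<lambda>y. mehler_op q (of_real s) h (of_real y)) (of_real x)"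
      by (intro mehler_op_diff continuous_on_mehler_op[OF q] g ch n x)
    also have "mehler_op q (of_real r) (\<lambda>y. mehler_op q (of_real s) h (of_real y)) (of_real x) = mehler_op q (of_real (r * s)) h (of_real x)"
      using mehler_op_hermite_span[OF h(1) n x] by simp
    moreover have "mehler_op q (of_real (r * s)) k (of_real x) = mehler_op q (of_real (r * s)) g (of_real x) - mehler_op q (of_real (r * s)) h (of_real x)"
      unfolding k_def by (rule mehler_op_diff[OF g ch nrs x])
    ultimately have "?d = mehler_op q (of_real r) (\<lambda>y. mehler_op q (of_real s) k (of_real y)) (of_real x) - mehler_op q (of_real (r * s)) k (of_real x)"
      by simp
    moreover have "norm (mehler_op q (of_real r) (\<lambda>y. mehler_op q (of_real s) k (of_real y)) (of_real x)) \<le> e / 2"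
      by (intro mehler_op_norm_le continuous_on_mehler_op[OF q] ck r s x k n)
    moreover have "norm (mehler_op q (of_real (r * s)) k (of_real x)) \<le> e / 2"
      by (intro mehler_op_norm_le ck rs x k)
    ultimately show ?thesis
      using norm_triangle_ineq4[of "mehler_op q (of_real r) (\<lambda>y. mehler_op q (of_real s) k (of_real y)) (of_real x)" "mehler_op q (of_real (r * s)) k (of_real x)"]
      by simp
  qed
  then have "norm ?d \<le> 0" using field_le_epsilon[of "norm ?d" 0] by simp
  then show ?thesis by simp
qed

lemma mehler_op_uniform_limit_hermite_span:
  assumes "hermite_span q f"
  shows "uniform_limit {-1..1} (\<lambda>r x. mehler_op q (of_real r) f (of_real x)) f (at_left 1)"
  using assms
proof (induction rule: hermite_span.induct)
  case (base c n)
  have ev: "\<forall>\<^sub>F r in at_left 1. \<bar>r\<bar> < (1::real)"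
    using eventually_at_left_real[of 0 "1::real"] by (auto elim!: eventually_mono)
  obtain B where B: "\<And>x. x \<in> {-1..1} \<Longrightarrow> norm (c * Herm q n x) \<le> B"
  proof -
    have "bounded ((\<lambda>x. c * Herm q n x) ` {-1..1})"
      by (intro compact_imp_bounded compact_continuous_image continuous_intros continuous_on_qHermite[OF q]) auto
    then show ?thesis using that unfolding bounded_iff by blast
  qed
  have "uniform_limit {-1..1} (\<lambda>r x. (complex_of_real r) ^ n * (c * Herm q n x)) (\<lambda>x. of_real 1 ^ n * (c * Herm q n x)) (at_left 1)"
  proof (rule uniform_lim_mult)
    have "((\<lambda>r. complex_of_real r ^ n) \<longlongrightarrow> of_real 1 ^ n) (at_left 1)" by (intro tendsto_intros)
    then show "uniform_limit {-1..1} (\<lambda>r x. complex_of_real r ^ n) (\<lambda>x. of_real 1 ^ n) (at_left 1)"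
      unfolding uniform_limit_iff tendsto_iff by (auto elim: eventually_mono)
    show "bounded ((\<lambda>x. c * Herm q n x) ` {-1..1})" using B unfolding bounded_iff by blast
  qed (auto intro: uniform_limit_const simp: bounded_iff)
  moreover have "\<forall>\<^sub>F r in at_left 1. \<forall>x\<in>{-1..1}. (complex_of_real r) ^ n * (c * Herm q n x) = mehler_op q (of_real r) (\<lambda>x. c * Herm q n x) (of_real x)"
    using ev by eventually_elim (simp add: mehler_op_cmult mehler_op_Hermite[OF q] mult_ac)
  ultimately show ?case by (subst (asm) uniform_limit_cong) auto
next
  case (add f g)
  have ev: "\<forall>\<^sub>F r in at_left 1. \<bar>r\<bar> < (1::real)"
    using eventually_at_left_real[of 0 "1::real"] by (auto elim!: eventually_mono)
  have "\<forall>\<^sub>F r in at_left 1. \<forall>x\<in>{-1..1}. mehler_op q (of_real r) f (of_real x) + mehler_op q (of_real r) g (of_real x) = mehler_op q (of_real r) (\<lambda>x. f x + g x) (of_real x)"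
    using ev by eventually_elim (simp add: mehler_op_add hermite_span_continuous[OF add(1)] hermite_span_continuous[OF add(2)])
  then show ?case using uniform_limit_add[OF add.IH] by (subst (asm) uniform_limit_cong) auto
qed

text \<open>The contraction bound does not depend on \<open>r\<close>, so the error of approximating
  \<open>g\<close> from the span stays small along the whole limit.\<close>

lemma mehler_op_uniform_limit:
  assumes g: "continuous_on {-1..1} g"
  shows "uniform_limit {-1..1} (\<lambda>r x. mehler_op q (of_real r) g (of_real x)) g (at_left 1)"
proof (rule uniform_limitI)
  fix e :: real assume e: "e > 0"
  obtain h where h: "hermite_span q h" "\<And>x. x \<in> {-1..1} \<Longrightarrow> norm (g x - h x) < e / 3"
    using hermite_span_dense[OF g, of "e / 3" q] e by auto
  note ch = hermite_span_continuous[OF h(1)]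
  have ev: "\<forall>\<^sub>F r in at_left 1. \<bar>r\<bar> < (1::real)"
    using eventually_at_left_real[of 0 "1::real"] by (auto elim!: eventually_mono)
  have "\<forall>\<^sub>F r in at_left 1. \<forall>x\<in>{-1..1}. dist (mehler_op q (of_real r) h (of_real x)) (h x) < e / 3"
    using uniform_limitD[OF mehler_op_uniform_limit_hermite_span[OF h(1)], of "e / 3"] e by simp
  with ev show "\<forall>\<^sub>F r in at_left 1. \<forall>x\<in>{-1..1}. dist (mehler_op q (of_real r) g (of_real x)) (g x) < e"
  proof eventually_elim
    case (elim r)
    show ?case
    proof
      fix x :: real assume x: "x \<in> {-1..1}"
      have "norm (mehler_op q (of_real r) (\<lambda>x. g x - h x) (of_real x)) \<le> e / 3"
        by (rule mehler_op_norm_le) (use h g ch elim x in \<open>auto intro!: continuous_intros less_imp_le\<close>)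
      then have "norm (mehler_op q (of_real r) g (of_real x) - mehler_op q (of_real r) h (of_real x)) \<le> e / 3"
        using mehler_op_diff[OF g ch, of "of_real r" x] elim x by simp
      moreover have "norm (mehler_op q (of_real r) h (of_real x) - h x) < e / 3" using elim x by (simp add: dist_norm)
      ultimately show "dist (mehler_op q (of_real r) g (of_real x)) (g x) < e"
        using h(2)[OF x] norm_triangle_ineq4[of "mehler_op q (of_real r) g (of_real x) - mehler_op q (of_real r) h (of_real x)" "g x - h x"]
         norm_triangle_ineq[of "(mehler_op q (of_real r) g (of_real x) - mehler_op q (of_real r) h (of_real x)) - (g x - h x)" "mehler_op q (of_real r) h (of_real x) - h x"]
        by (simp add: dist_norm)
    qed
  qed
qed

end

section \<open>Completeness and eigenfunctions\<close>

text \<open>Bilinear, without conjugation, which suits a kernel that is symmetric for complex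
  \<open>r\<close> too; positivity enters by pairing \<open>g\<close> with its conjugate.\<close>

definition hermite_inner :: "real \<Rightarrow> (real \<Rightarrow> complex) \<Rightarrow> (real \<Rightarrow> complex) \<Rightarrow> complex" where
  "hermite_inner q f g = integral {0..pi} (\<lambda>\<phi>. hermite_weight q \<phi> * f (cos \<phi>) * g (cos \<phi>))"

lemma continuous_on_cos_comp:
  fixes h :: "'a::t2_space \<Rightarrow> real"
  assumes "continuous_on {-1..1} f" "continuous_on S h"
  shows "continuous_on S (\<lambda>x. f (cos (h x)))"
  by (rule continuous_on_compose2[OF assms(1) continuous_on_cos[OF assms(2)]]) auto

context
  fixes q :: real
  assumes q: "0 < q" "q < 1"
begin

lemma hermite_inner_integrable:
  assumes "continuous_on {-1..1} f" "continuous_on {-1..1} g"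
  shows "(\<lambda>\<phi>. hermite_weight q \<phi> * f (cos \<phi>) * g (cos \<phi>)) integrable_on {0..pi}"
  by (intro integrable_continuous_real continuous_intros continuous_on_hermite_weight[OF q]
      continuous_on_cos_comp[OF assms(1)] continuous_on_cos_comp[OF assms(2)])

lemma hermite_inner_add_right:
  assumes "continuous_on {-1..1} f" "continuous_on {-1..1} g" "continuous_on {-1..1} h"
  shows "hermite_inner q f (\<lambda>x. g x + h x) = hermite_inner q f g + hermite_inner q f h"
  unfolding hermite_inner_def distrib_left
  by (rule integral_add[OF hermite_inner_integrable[OF assms(1,2)] hermite_inner_integrable[OF assms(1,3)]])

lemma hermite_inner_cmult_right: "hermite_inner q f (\<lambda>x. c * g x) = c * hermite_inner q f g"
proof -
  have "(\<lambda>\<phi>. hermite_weight q \<phi> * f (cos \<phi>) * (c * g (cos \<phi>))) = (\<lambda>\<phi>. c * (hermite_weight q \<phi> * f (cos \<phi>) * g (cos \<phi>)))"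
    by (simp add: mult_ac)
  then show ?thesis unfolding hermite_inner_def by (simp only: integral_mult_right)
qed

lemma hermite_inner_commute: "hermite_inner q f g = hermite_inner q g f"
  unfolding hermite_inner_def by (simp add: mult_ac)

lemma hermite_inner_cong:
  assumes "\<And>x. x \<in> {-1..1} \<Longrightarrow> f x = f' x" "\<And>x. x \<in> {-1..1} \<Longrightarrow> g x = g' x"
  shows "hermite_inner q f g = hermite_inner q f' g'"
  unfolding hermite_inner_def using assms by (intro integral_cong) simp

lemma mehler_den_symmetric: "mehler_den q r (of_real (cos \<phi>)) (cis \<psi>) = mehler_den q r (of_real (cos \<psi>)) (cis \<phi>)"
  unfolding joukowski_cis[symmetric] by (rule mehler_den_swap[OF q]) auto

text \<open>Exchanging the integrals and using the symmetry of the kernel lets the operator act on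
  \<open>H_n\<close>, where it is multiplication by \<open>r^n\<close>.\<close>

lemma hermite_inner_mehler_op_Hermite:
  assumes g: "continuous_on {-1..1} g" and r: "norm r < 1"
  shows "hermite_inner q (\<lambda>x. mehler_op q r g (of_real x)) (Herm q n) = r ^ n * hermite_inner q g (Herm q n)"
proof -
  let ?H = "Herm q n"
  note cH = continuous_on_qHermite[OF q, of "{-1..1}" n]
  define F where "F = (\<lambda>\<phi> \<psi>. qpoch (r\<^sup>2) q * (hermite_weight q \<phi> * ?H (cos \<phi>) * (hermite_weight q \<psi> * g (cos \<psi>)) / mehler_den q r (of_real (cos \<phi>)) (cis \<psi>)))"
  have "continuous_on (cbox (0, 0) (pi, pi)) (\<lambda>(\<phi>, \<psi>). F \<phi> \<psi>)"
    unfolding F_def case_prod_unfold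
    by (intro continuous_intros continuous_on_hermite_weight[OF q] continuous_on_mehler_den[OF q]
          continuous_on_cos_comp[OF g] continuous_on_cos_comp[OF cH])
       (auto simp: mehler_den_real_nonzero[OF q _ r])
  then have swap: "integral {0..pi} (\<lambda>\<phi>. integral {0..pi} (F \<phi>)) = integral {0..pi} (\<lambda>\<psi>. integral {0..pi} (\<lambda>\<phi>. F \<phi> \<psi>))"
    using integral_swap_continuous[of 0 0 pi pi F] by simp
  have "hermite_inner q (\<lambda>x. mehler_op q r g (of_real x)) ?H = integral {0..pi} (\<lambda>\<phi>. integral {0..pi} (F \<phi>))"
    unfolding hermite_inner_def
  proof (intro integral_cong)
    fix \<phi>
    have "F \<phi> = (\<lambda>\<psi>. (qpoch (r\<^sup>2) q * (hermite_weight q \<phi> * ?H (cos \<phi>))) * (hermite_weight q \<psi> * g (cos \<psi>) / mehler_den q r (of_real (cos \<phi>)) (cis \<psi>)))"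
      by (simp add: F_def fun_eq_iff)
    then have "integral {0..pi} (F \<phi>) = (qpoch (r\<^sup>2) q * (hermite_weight q \<phi> * ?H (cos \<phi>))) *
        integral {0..pi} (\<lambda>\<psi>. hermite_weight q \<psi> * g (cos \<psi>) / mehler_den q r (of_real (cos \<phi>)) (cis \<psi>))"
      by (simp only: integral_mult_right)
    then show "hermite_weight q \<phi> * mehler_op q r g (of_real (cos \<phi>)) * ?H (cos \<phi>) = integral {0..pi} (F \<phi>)"
      by (simp add: mehler_op_def mult_ac)
  qed
  also have "\<dots> = integral {0..pi} (\<lambda>\<psi>. r ^ n * (hermite_weight q \<psi> * g (cos \<psi>) * ?H (cos \<psi>)))"
    unfolding swap
  proof (intro integral_cong)
    fix \<psi>
    have "(\<lambda>\<phi>. F \<phi> \<psi>) = (\<lambda>\<phi>. (qpoch (r\<^sup>2) q * (hermite_weight q \<psi> * g (cos \<psi>))) * (hermite_weight q \<phi> * ?H (cos \<phi>) / mehler_den q r (of_real (cos \<psi>)) (cis \<phi>)))"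
      by (simp add: F_def fun_eq_iff mehler_den_symmetric[of r _ \<psi>])
    then have "integral {0..pi} (\<lambda>\<phi>. F \<phi> \<psi>) = (qpoch (r\<^sup>2) q * (hermite_weight q \<psi> * g (cos \<psi>))) *
        integral {0..pi} (\<lambda>\<phi>. hermite_weight q \<phi> * ?H (cos \<phi>) / mehler_den q r (of_real (cos \<psi>)) (cis \<phi>))"
      by (simp only: integral_mult_right)
    also have "\<dots> = hermite_weight q \<psi> * g (cos \<psi>) * mehler_op q r ?H (of_real (cos \<psi>))" by (simp add: mehler_op_def mult_ac)
    also have "\<dots> = r ^ n * (hermite_weight q \<psi> * g (cos \<psi>) * ?H (cos \<psi>))" by (subst mehler_op_Hermite[OF q r]) auto
    finally show "integral {0..pi} (\<lambda>\<phi>. F \<phi> \<psi>) = r ^ n * (hermite_weight q \<psi> * g (cos \<psi>) * ?H (cos \<psi>))" .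
  qed
  also have "\<dots> = r ^ n * hermite_inner q g ?H" by (simp only: integral_mult_right hermite_inner_def)
  finally show ?thesis .
qed

text \<open>The operator with parameter \<open>1/2\<close> multiplies the pairing by
  \<open>(1/2)^m\<close> when it acts on \<open>H_m\<close>, and by \<open>(1/2)^n\<close> when it
  is moved over to \<open>H_n\<close>.\<close>

lemma hermite_inner_Hermite_orthogonal:
  assumes "m \<noteq> n"
  shows "hermite_inner q (Herm q m) (Herm q n) = 0"
proof -
  have r: "norm (1 / 2 :: complex) < 1" by simp
  have "hermite_inner q (\<lambda>x. mehler_op q (1/2) (Herm q m) (of_real x)) (Herm q n) = hermite_inner q (\<lambda>x. (1/2) ^ m * Herm q m x) (Herm q n)"
    by (rule hermite_inner_cong) (simp_all add: mehler_op_Hermite[OF q r] del: power_one_over)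
  also have "\<dots> = (1/2) ^ m * hermite_inner q (Herm q m) (Herm q n)"
    unfolding hermite_inner_commute[of _ "Herm q n"] by (rule hermite_inner_cmult_right)
  finally have "((1/2) ^ m - (1/2) ^ n) * hermite_inner q (Herm q m) (Herm q n) = 0"
    using hermite_inner_mehler_op_Hermite[OF continuous_on_qHermite[OF q] r, of m n] by (simp only: left_diff_distrib right_minus_eq)
  moreover have "(1/2::real) ^ m \<noteq> (1/2) ^ n" using assms by (simp add: power_one_over)
  then have "complex_of_real ((1/2) ^ m) \<noteq> of_real ((1/2) ^ n)" by (simp only: of_real_eq_iff not_False_eq_True)
  then have "(1/2::complex) ^ m - (1/2) ^ n \<noteq> 0" by (simp add: power_one_over)
  ultimately show ?thesis by simp
qed

text \<open>The integrand is continuous and nonnegative, hence zero. The weight vanishes at both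
  ends, so \<open>g\<close> is first seen to vanish in the open interval and then, by continuity, at
  \<open>-1\<close> and \<open>1\<close>.\<close>

lemma hermite_inner_cnj_eq_0:
  assumes g: "continuous_on {-1..1} g" and z: "hermite_inner q g (\<lambda>x. cnj (g x)) = 0" and x: "x \<in> {-1..1}"
  shows "g x = 0"
proof -
  define f where "f = (\<lambda>\<phi>. Re (hermite_weight q \<phi>) * (norm (g (cos \<phi>)))\<^sup>2)"
  have W: "hermite_weight q \<phi> = of_real (Re (hermite_weight q \<phi>))" "Re (hermite_weight q \<phi>) \<ge> 0" for \<phi>
    using hermite_weight_nonneg[OF q, of \<phi>] by auto
  have e: "hermite_weight q \<phi> * g (cos \<phi>) * cnj (g (cos \<phi>)) = of_real (f \<phi>)" for \<phi>
    by (subst W(1)) (simp add: f_def complex_norm_square[symmetric] mult.assoc)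
  have cf: "continuous_on {0..pi} f" unfolding f_def
    by (intro continuous_intros continuous_on_hermite_weight[OF q] continuous_on_cos_comp[OF g])
  have "of_real (integral {0..pi} f) = hermite_inner q g (\<lambda>x. cnj (g x))"
    unfolding hermite_inner_def e
    by (intro integral_unique[symmetric] has_integral_of_real integrable_integral integrable_continuous_real cf)
  then have "integral {0..pi} f = 0" using z by simp
  then have f0: "\<forall>\<phi>\<in>{0..pi}. f \<phi> = 0"
    using integral_eq_0_iff[OF cf] W(2) by (simp add: f_def)
  have int: "g x = 0" if "x \<in> {-1<..<1}" for x
  proof -
    have a: "0 < arccos x" "arccos x < pi" "cos (arccos x) = x" using that arccos_lt_bounded[of x] by auto
    have "Re (hermite_weight q (arccos x)) \<noteq> 0" using hermite_weight_nonzero[OF q a(1,2)] W(1)[of "arccos x"] by (metis of_real_0)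
    then show ?thesis using f0 a by (auto simp: f_def)
  qed
  have "closure {-1<..<1::real} = {-1..1}" by simp
  then show ?thesis using continuous_constant_on_closure[of "{-1<..<1}" g 0 x] g x int by simp
qed

text \<open>The conjugate of \<open>g\<close> is a uniform limit of members of the span, all of
  which pair to zero with \<open>g\<close>; hence so does the conjugate itself.\<close>

lemma qHermite_complete:
  assumes g: "continuous_on {-1..1} g" and z: "\<And>n. hermite_inner q g (Herm q n) = 0" and x: "x \<in> {-1..1}"
  shows "g x = 0"
proof (rule hermite_inner_cnj_eq_0[OF g _ x])
  have h0: "hermite_inner q g h = 0" if "hermite_span q h" for h
    using that
  proof (induction rule: hermite_span.induct)
    case (base c n)
    then show ?case by (simp add: hermite_inner_cmult_right z)
  next
    case (add u v)
    then show ?case by (simp add: hermite_inner_add_right g hermite_span_continuous[OF q])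
  qed
  have cc: "continuous_on {-1..1} (\<lambda>x. cnj (g x))" by (intro continuous_intros g)
  define M where "M = integral {0..pi} (\<lambda>\<phi>. norm (hermite_weight q \<phi> * g (cos \<phi>)))"
  have M0: "M \<ge> 0" unfolding M_def by (intro integral_nonneg integrable_continuous_real continuous_intros
      continuous_on_hermite_weight[OF q] continuous_on_cos_comp[OF g]) auto
  have "norm (hermite_inner q g (\<lambda>x. cnj (g x))) \<le> 0 + e" if e: "e > 0" for e
  proof -
    \<comment> \<open>The \<open>+ 1\<close> guards against \<open>M = 0\<close>.\<close>
    define d where "d = e / (M + 1)"
    have d: "d > 0" "M * d \<le> e"
      using e M0 by (auto simp: d_def field_simps)
    obtain h where h: "hermite_span q h" "\<And>x. x \<in> {-1..1} \<Longrightarrow> norm (cnj (g x) - h x) < d"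
      using hermite_span_dense[OF cc d(1), of q] by auto
    note ch = hermite_span_continuous[OF q h(1)]
    have "hermite_inner q g (\<lambda>x. cnj (g x)) = hermite_inner q g h + hermite_inner q g (\<lambda>x. cnj (g x) - h x)"
      by (subst hermite_inner_add_right[symmetric]) (auto intro!: continuous_intros g ch)
    also have "\<dots> = hermite_inner q g (\<lambda>x. cnj (g x) - h x)" using h0[OF h(1)] by simp
    finally have "norm (hermite_inner q g (\<lambda>x. cnj (g x))) = norm (hermite_inner q g (\<lambda>x. cnj (g x) - h x))" by simp
    also have "\<dots> \<le> integral {0..pi} (\<lambda>\<phi>. norm (hermite_weight q \<phi> * g (cos \<phi>)) * d)"
      unfolding hermite_inner_def
    proof (rule integral_norm_bound_integral)
      show "(\<lambda>\<phi>. hermite_weight q \<phi> * g (cos \<phi>) * (cnj (g (cos \<phi>)) - h (cos \<phi>))) integrable_on {0..pi}"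
        by (rule hermite_inner_integrable[OF g, of "\<lambda>x. cnj (g x) - h x"]) (intro continuous_intros g ch)
      show "(\<lambda>\<phi>. norm (hermite_weight q \<phi> * g (cos \<phi>)) * d) integrable_on {0..pi}"
        by (intro integrable_continuous_real continuous_intros continuous_on_hermite_weight[OF q] continuous_on_cos_comp[OF g])
      show "norm (hermite_weight q \<phi> * g (cos \<phi>) * (cnj (g (cos \<phi>)) - h (cos \<phi>))) \<le> norm (hermite_weight q \<phi> * g (cos \<phi>)) * d" for \<phi>
        unfolding norm_mult[of "hermite_weight q \<phi> * g (cos \<phi>)"] using h(2)[of "cos \<phi>"] by (intro mult_left_mono) auto
    qed
    also have "\<dots> = M * d" unfolding M_def by (rule integral_mult_left)
    finally show ?thesis using d by simp
  qed
  then have "norm (hermite_inner q g (\<lambda>x. cnj (g x))) \<le> 0" by (rule field_le_epsilon)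
  then show "hermite_inner q g (\<lambda>x. cnj (g x)) = 0" by simp
qed

lemma hermite_inner_Hermite_nonzero: "hermite_inner q (Herm q n) (Herm q n) \<noteq> 0"
proof
  assume "hermite_inner q (Herm q n) (Herm q n) = 0"
  then have "Herm q n 1 = 0"
    by (intro hermite_inner_cnj_eq_0[OF continuous_on_qHermite[OF q]]) simp_all
  then show False using qHermite_1_mono[OF q, of n] by simp
qed

text \<open>Pairing the eigenvalue equation with \<open>H_n\<close> gives
  \<open>(\<mu> - r^n) <g, H_n> = 0\<close>. Completeness supplies an \<open>n\<close> with a
  nonzero coefficient; the powers of \<open>r\<close> being distinct, all other coefficients vanish,
  and completeness applies once more to \<open>g - c H_n\<close>.\<close>

lemma mehler_op_eigenfunction:
  assumes g: "continuous_on {-1..1} g" and nz: "\<exists>x\<in>{-1..1}. g x \<noteq> 0" and r: "\<bar>r\<bar> < 1" "r \<noteq> 0"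
    and eig: "\<And>x. x \<in> {-1..1} \<Longrightarrow> mehler_op q (of_real r) g (of_real x) = \<mu> * g x"
  shows "\<exists>n c. \<mu> = of_real (r ^ n) \<and> (\<forall>x\<in>{-1..1}. g x = c * Herm q n x)"
proof -
  have rn: "norm (complex_of_real r) < 1" using r by simp
  note cH = continuous_on_qHermite[OF q]
  have m: "(\<mu> - of_real r ^ n) * hermite_inner q g (Herm q n) = 0" for n
  proof -
    have "of_real r ^ n * hermite_inner q g (Herm q n) = hermite_inner q (\<lambda>x. \<mu> * g x) (Herm q n)"
      unfolding hermite_inner_mehler_op_Hermite[OF g rn, symmetric] by (rule hermite_inner_cong) (simp_all add: eig)
    also have "\<dots> = \<mu> * hermite_inner q g (Herm q n)"
      unfolding hermite_inner_commute[of _ "Herm q n"] by (rule hermite_inner_cmult_right)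
    finally show ?thesis by (simp only: left_diff_distrib right_minus_eq)
  qed
  obtain n where n: "hermite_inner q g (Herm q n) \<noteq> 0" using qHermite_complete[OF g] nz by blast
  have \<mu>: "\<mu> = of_real r ^ n" using m[of n] n by simp
  define c where "c = hermite_inner q g (Herm q n) / hermite_inner q (Herm q n) (Herm q n)"
  have "g x - c * Herm q n x = 0" if x: "x \<in> {-1..1}" for x
  proof (rule qHermite_complete[OF _ _ x])
    show cont: "continuous_on {-1..1} (\<lambda>x. g x - c * Herm q n x)" by (intro continuous_intros g cH)
    fix k
    have "hermite_inner q (\<lambda>x. g x - c * Herm q n x) (Herm q k) = hermite_inner q (Herm q k) (\<lambda>x. g x + (- c) * Herm q n x)"
      by (subst hermite_inner_commute) simp
    also have "\<dots> = hermite_inner q (Herm q k) g + hermite_inner q (Herm q k) (\<lambda>x. (- c) * Herm q n x)"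
      by (rule hermite_inner_add_right) (intro continuous_intros g cH)+
    also have "\<dots> = hermite_inner q g (Herm q k) - c * hermite_inner q (Herm q k) (Herm q n)"
      unfolding hermite_inner_cmult_right by (simp add: hermite_inner_commute[of g])
    also have "\<dots> = 0"
    proof (cases "k = n")
      case True
      then show ?thesis using hermite_inner_Hermite_nonzero[of n] by (simp add: c_def)
    next
      case False
      \<comment> \<open>Absolute values make the strict monotonicity of powers available for
        negative \<open>r\<close>.\<close>
      have "\<bar>r\<bar> ^ k \<noteq> \<bar>r\<bar> ^ n"
        using False r power_strict_decreasing[of k n "\<bar>r\<bar>"] power_strict_decreasing[of n k "\<bar>r\<bar>"]
        by (metis less_irrefl nat_neq_iff zero_less_abs_iff)
      then have "r ^ n \<noteq> r ^ k" by (metis power_abs)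
      then have "complex_of_real (r ^ n) \<noteq> of_real (r ^ k)" by (simp only: of_real_eq_iff not_False_eq_True)
      then have "hermite_inner q g (Herm q k) = 0" using m[of k] \<mu> by simp
      then show ?thesis using hermite_inner_Hermite_orthogonal[OF False] by simp
    qed
    finally show "hermite_inner q (\<lambda>x. g x - c * Herm q n x) (Herm q k) = 0" .
  qed
  then have "\<forall>x\<in>{-1..1}. g x = c * Herm q n x" by simp
  with \<mu> show ?thesis by (metis of_real_power)
qed

lemma Tq_conv_mehler_op:
  assumes x: "x \<in> {-1..1}"
  shows "Tq q a b r f x = hfun q [a, b] (of_real x) * mehler_op q (of_real r) (\<lambda>y. f y / hfun q [a, b] (of_real y)) (of_real x)"
proof -
  have W: "wH q (cos \<phi>) * of_real (sin \<phi>) = hermite_weight q \<phi>" if "\<phi> \<in> {0..pi}" for \<phi>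
  proof (cases "sin \<phi> = 0")
    \<comment> \<open>At the ends \<open>wH\<close> divides by zero but is multiplied by
      \<open>sin \<phi> = 0\<close>; the other side is zero because
      \<open>(1; q) = 0\<close>.\<close>
    case True
    have "(cis \<phi>)\<^sup>2 = 1" using True cos_squared_eq[of \<phi>] by (simp add: complex_eq_iff power2_eq_square)
    then show ?thesis using True by (simp add: hermite_weight_def circle_weight_def qpoch_1[OF q])
  next
    case False
    have "sqrt (1 - (cos \<phi>)\<^sup>2) = sin \<phi>"
      using sin_ge_zero[of \<phi>] that by (simp add: sin_squared_eq[symmetric])
    then show ?thesis using False that unfolding wH_def zpt_cos[OF that]
      by (simp add: hermite_weight_def circle_weight_def power_one_over)
  qed
  \<comment> \<open>\<open>Tq\<close> puts the point of the circle belonging to \<open>x\<close>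
    into the parameters and evaluates at \<open>cos \<phi>\<close>, opposite to
    \<open>mehler_den\<close>; the swap symmetry reconciles the two.\<close>
  have K: "hfun q [of_real r * zpt (of_real x), of_real r / zpt (of_real x)] (of_real (cos \<phi>)) = mehler_den q (of_real r) (of_real x) (cis \<phi>)" for \<phi>
  proof -
    have "mehler_den q (of_real r) (of_real x) (cis \<phi>) = mehler_den q (of_real r) (joukowski (cis \<phi>)) (zpt (of_real x))"
      using mehler_den_swap[OF q, of "zpt (of_real x)" "cis \<phi>"] by simp
    then show ?thesis unfolding hfun_conv_hsym[OF q] mehler_den_def joukowski_cis by simp
  qed
  have "integral {0..pi} (\<lambda>\<phi>. wH q (cos \<phi>) * f (cos \<phi>) * of_real (sin \<phi>) /
       (hfun q [of_real r * zpt (of_real x), of_real r / zpt (of_real x)] (of_real (cos \<phi>)) * hfun q [a, b] (of_real (cos \<phi>))))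
     = integral {0..pi} (\<lambda>\<phi>. hermite_weight q \<phi> * (f (cos \<phi>) / hfun q [a, b] (of_real (cos \<phi>))) / mehler_den q (of_real r) (of_real x) (cis \<phi>))"
    unfolding K by (intro integral_cong) (simp add: W[symmetric] mult_ac)
  then show ?thesis unfolding Tq_def mehler_op_def by (simp add: mult_ac)
qed

end

section \<open>The intertwining relation\<close>

text \<open>The focal distances are \<open>(norm (w - 1))^2 / (2 * norm w)\<close> and
  \<open>(norm (w + 1))^2 / (2 * norm w)\<close>, and the parallelogram law adds them up. This turns
  a condition on the modulus of \<open>w\<close> into one on \<open>x\<close>, free of
  branches.\<close>

lemma norm_joukowski_foci:
  assumes "w \<noteq> 0"
  shows "norm (joukowski w - 1) + norm (joukowski w + 1) = norm w + 1 / norm w"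
proof -
  have "joukowski w - 1 = (w - 1)\<^sup>2 / (2 * w)" "joukowski w + 1 = (w + 1)\<^sup>2 / (2 * w)"
    using assms by (simp_all add: joukowski_def field_simps power2_eq_square)
  then have "norm (joukowski w - 1) + norm (joukowski w + 1) = ((norm (w - 1))\<^sup>2 + (norm (w + 1))\<^sup>2) / (2 * norm w)"
    by (simp add: norm_divide norm_mult norm_power add_divide_distrib)
  also have "(norm (w - 1))\<^sup>2 + (norm (w + 1))\<^sup>2 = 2 * (norm w)\<^sup>2 + 2"
    unfolding cmod_power2 by (simp add: power2_eq_square algebra_simps)
  also have "(2 * (norm w)\<^sup>2 + 2) / (2 * norm w) = norm w + 1 / norm w"
    using assms by (simp add: field_simps power2_eq_square)
  finally show ?thesis .
qed

text \<open>With \<open>R = norm r\<close> and \<open>W = norm w\<close> the left side says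
  \<open>(W - R) (1 - R W) > 0\<close>, and \<open>R < 1\<close> prevents both factors from being
  negative. It describes the open ellipse on which the kernel has no pole.\<close>

lemma ellipse_condition_iff:
  fixes w r :: complex
  assumes "w \<noteq> 0" "norm r < 1"
  shows "norm r * (norm (joukowski w - 1) + norm (joukowski w + 1)) < 1 + (norm r)\<^sup>2 \<longleftrightarrow>
     norm r < norm w \<and> norm r * norm w < 1"
proof -
  define R W where "R = norm r" and "W = norm w"
  have RW: "0 \<le> R" "R < 1" "W > 0" using assms by (auto simp: R_def W_def)
  have "R * (W + 1 / W) < 1 + R\<^sup>2 \<longleftrightarrow> 0 < (W - R) * (1 - R * W)"
    using RW by (simp add: field_simps power2_eq_square)
  also have "\<dots> \<longleftrightarrow> R < W \<and> R * W < 1"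
  proof
    assume p: "0 < (W - R) * (1 - R * W)"
    have "\<not> (W < R \<and> 1 < R * W)"
    proof
      assume h: "W < R \<and> 1 < R * W"
      then have "R * W < R * R" using RW by (intro mult_strict_left_mono) auto
      moreover have "R * R \<le> 1" using RW by (simp add: mult_le_one)
      ultimately show False using h by linarith
    qed
    with p show "R < W \<and> R * W < 1" by (auto simp: zero_less_mult_iff)
  qed simp
  finally show ?thesis using norm_joukowski_foci[OF assms(1)] by (simp add: R_def W_def)
qed

lemma of_real_in_qellipse:
  assumes "0 < q" "q < 1" "x \<in> {-1..1::real}"
  shows "of_real x \<in> qellipse q"
proof -
  have "q powr (1/2) \<le> 1" "1 \<le> q powr (-1/2)"
    using assms by (auto simp: powr_le1 powr_minus_divide)
  then show ?thesis unfolding qellipse_def using of_real_eq_joukowski_cis[OF assms(3)]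
    by (intro image_eqI[of _ _ "cis (arccos x)"]) auto
qed

text \<open>Both extensions agree on \<open>[-1, 1]\<close>, which accumulates at 0. The common
  domain may be disconnected, so the identity theorem is applied on its component of 0, which
  contains the connected set \<open>qellipse q\<close>.\<close>

lemma analytic_ext_unique:
  assumes q: "0 < q" "q < 1" and F: "analytic_ext q f F" "analytic_ext q f G" and x: "x \<in> qellipse q"
  shows "F x = G x"
proof -
  obtain S where S: "open S" "qellipse q \<subseteq> S" "F holomorphic_on S"
    using F(1) unfolding analytic_ext_def analytic_on_holomorphic by blast
  obtain T where T: "open T" "qellipse q \<subseteq> T" "G holomorphic_on T"
    using F(2) unfolding analytic_ext_def analytic_on_holomorphic by blast
  have "connected (qellipse q)"
  proof -
    have "{z::complex. q powr (1/2) \<le> norm z \<and> norm z \<le> q powr (-1/2)} =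
       {z. q powr (1/2) \<le> norm (z - 0) \<and> norm (z - 0) \<le> q powr (-1/2)}" by simp
    then have "connected {z::complex. q powr (1/2) \<le> norm z \<and> norm z \<le> q powr (-1/2)}"
      using connected_annulus(4)[of "q powr (1/2)" "0::complex" "q powr (-1/2)"] by simp
    moreover have "z \<noteq> 0" if "q powr (1/2) \<le> norm z" for z :: complex
      using that q by (metis norm_zero not_less powr_gt_zero less_irrefl)
    then have "continuous_on {z::complex. q powr (1/2) \<le> norm z \<and> norm z \<le> q powr (-1/2)} joukowski"
      unfolding joukowski_def by (intro continuous_intros) auto
    ultimately show ?thesis unfolding qellipse_def by (intro connected_continuous_image)
  qed
  define C where "C = connected_component_set (S \<inter> T) 0"
  have 0: "0 \<in> qellipse q" using of_real_in_qellipse[OF q, of 0] by simp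
  have C: "open C" "connected C" unfolding C_def using S T by (auto intro!: open_connected_component)
  have CST: "C \<subseteq> S \<inter> T" unfolding C_def by (rule connected_component_subset)
  have EC: "qellipse q \<subseteq> C" unfolding C_def
    using \<open>connected (qellipse q)\<close> S T 0 by (intro connected_component_maximal) auto
  let ?I = "complex_of_real ` {-1..1}"
  have "connected ?I" by (intro connected_continuous_image continuous_intros) auto
  moreover have "0 \<in> ?I" "1 \<in> ?I" by (auto simp: image_iff intro!: bexI[of _ 0] bexI[of _ 1])
  ultimately have lim: "0 islimpt ?I"
    by (intro connected_imp_perfect) (assumption, assumption, metis singletonD zero_neq_one)
  have "F x - G x = 0"
  proof (rule analytic_continuation[of "\<lambda>x. F x - G x" C ?I 0])
    show "(\<lambda>x. F x - G x) holomorphic_on C"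
      using S T CST by (intro holomorphic_intros) (auto intro: holomorphic_on_subset)
    show "?I \<subseteq> C" using of_real_in_qellipse[OF q] EC by blast
    show "F z - G z = 0" if "z \<in> ?I" for z using that F by (auto simp: analytic_ext_def)
  qed (use C EC 0 lim x in auto)
  then show ?thesis by simp
qed

context
  fixes q :: real
  assumes q: "0 < q" "q < 1"
begin

lemma analytic_on_mehler_op:
  assumes g: "continuous_on {-1..1} g" and r: "norm r < 1"
  shows "mehler_op q r g analytic_on {x. norm r * (norm (x - 1) + norm (x + 1)) < 1 + (norm r)\<^sup>2}"
proof -
  let ?U = "{x. norm r * (norm (x - 1) + norm (x + 1)) < 1 + (norm r)\<^sup>2}"
  have oU: "open ?U" by (intro open_Collect_less continuous_intros)
  have nz: "mehler_den q r x (cis \<phi>) \<noteq> 0" if "x \<in> ?U" for x \<phi>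
  proof -
    have "norm r < norm (zpt x) \<and> norm r * norm (zpt x) < 1"
      using that ellipse_condition_iff[OF zpt_nonzero r, of x] by simp
    then show ?thesis using mehler_den_nonzero[OF q, of "zpt x" "cis \<phi>" r] by (simp add: norm_mult)
  qed
  have "continuous_on (?U \<times> {0..pi}) (\<lambda>(x, \<phi>). hermite_weight q \<phi> * g (cos \<phi>) / mehler_den q r x (cis \<phi>))"
    unfolding case_prod_unfold
    by (intro continuous_intros continuous_on_mehler_den[OF q] continuous_on_hermite_weight[OF q] continuous_on_cos_comp[OF g])
      (use nz in auto)
  moreover have "(\<lambda>x. hermite_weight q \<phi> * g (cos \<phi>) / mehler_den q r x (cis \<phi>)) holomorphic_on ?U" for \<phi>
    unfolding mehler_den_def
    by (intro holomorphic_intros holomorphic_on_hsym[OF q] oU) (use nz in \<open>auto simp: mehler_den_def\<close>)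
  ultimately have "(\<lambda>x. integral {0..pi} (\<lambda>\<phi>. hermite_weight q \<phi> * g (cos \<phi>) / mehler_den q r x (cis \<phi>))) analytic_on ?U"
    by (intro analytic_on_parameter_integral[OF oU]) auto
  moreover have "mehler_op q r g = (\<lambda>x. qpoch (r\<^sup>2) q * integral {0..pi} (\<lambda>\<phi>. hermite_weight q \<phi> * g (cos \<phi>) / mehler_den q r x (cis \<phi>)))"
    by (simp add: mehler_op_def fun_eq_iff)
  ultimately show ?thesis by (simp add: analytic_on_const analytic_on_mult)
qed

lemma hfun_analytic: "hfun q [a, b] analytic_on S"
proof -
  have "(\<lambda>x. hsym q a x * hsym q b x) holomorphic_on UNIV"
    by (intro holomorphic_intros holomorphic_on_hsym[OF q]) auto
  then have "(\<lambda>x. hsym q a x * hsym q b x) analytic_on UNIV" by (simp add: analytic_on_open)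
  then show ?thesis unfolding hfun_conv_hsym[OF q, abs_def] using analytic_on_subset by blast
qed

text \<open>The swap symmetry transfers \<open>mehler_den_raise\<close> to the variable
  \<open>x\<close>, where it is integrated against \<open>g\<close>; \<open>1 - t^2\<close> again
  completes \<open>(q t^2; q)\<close> to \<open>(t^2; q)\<close>.\<close>

lemma mehler_op_raise:
  fixes p :: real
  assumes p: "0 < p" "p < 1" "p\<^sup>2 = q" and g: "continuous_on {-1..1} g" and t: "norm t < 1" and w: "norm w = 1"
  shows "mehler_op q (of_real p * t) g (joukowski (of_real p * w)) - w\<^sup>2 * mehler_op q (of_real p * t) g (joukowski (w / of_real p))
     = (1 - w\<^sup>2) * mehler_op q t g (joukowski w)"
proof -
  let ?r = "of_real p * t"
  have w0: "w \<noteq> 0" "of_real p * w \<noteq> 0" "w / of_real p \<noteq> 0" using w p by auto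
  have pt: "norm t * p < 1" "p * norm t < p"
    using t p mult_strict_mono'[of "norm t" 1 p 1] by auto
  have "p * norm t < 1" using pt(2) p(2) by linarith
  then have "p * (p * norm t) < p * 1" using p(1) by (rule mult_strict_left_mono)
  then have ppt: "p * p * norm t < 1" using p(2) by (simp only: mult.assoc mult_1_right)
  have n1: "mehler_den q ?r (joukowski (of_real p * w)) (cis \<phi>) \<noteq> 0" for \<phi>
    by (rule mehler_den_nonzero[OF q]) (use w p pt ppt w0 t in \<open>auto simp: norm_mult mult_ac\<close>)
  have n2: "mehler_den q ?r (joukowski (w / of_real p)) (cis \<phi>) \<noteq> 0" for \<phi>
    by (rule mehler_den_nonzero[OF q]) (use w p pt ppt w0 t in \<open>auto simp: norm_mult norm_divide field_simps\<close>)
  have n3: "mehler_den q t (joukowski w) (cis \<phi>) \<noteq> 0" for \<phi>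
    using mehler_den_nonzero_circle[OF q w _ t] by simp
  define I where "I = (\<lambda>r x \<phi>. hermite_weight q \<phi> * g (cos \<phi>) / mehler_den q r x (cis \<phi>))"
  have int: "I r x integrable_on {0..pi}" if "\<And>\<phi>. mehler_den q r x (cis \<phi>) \<noteq> 0" for r x
    unfolding I_def using that
    by (intro integrable_continuous_real continuous_intros continuous_on_hermite_weight[OF q] continuous_on_mehler_den[OF q]
          continuous_on_cos_comp[OF g]) auto
  have e: "I ?r (joukowski (of_real p * w)) \<phi> - w\<^sup>2 * I ?r (joukowski (w / of_real p)) \<phi> = ((1 - w\<^sup>2) * (1 - t\<^sup>2)) * I t (joukowski w) \<phi>" for \<phi>
  proof -
    have "1 / mehler_den q ?r (joukowski (of_real p * w)) (cis \<phi>) - w\<^sup>2 * (1 / mehler_den q ?r (joukowski (w / of_real p)) (cis \<phi>)) =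
       (1 - w\<^sup>2) * ((1 - t\<^sup>2) / mehler_den q t (joukowski w) (cis \<phi>))"
      unfolding mehler_den_swap[OF q w0(2) cis_neq_zero] mehler_den_swap[OF q w0(3) cis_neq_zero] mehler_den_swap[OF q w0(1) cis_neq_zero]
      by (rule mehler_den_raise[OF q _ p(3) w0(1)]) (use p n3[of \<phi>] mehler_den_swap[OF q w0(1), of "cis \<phi>"] in auto)
    moreover have "u / A - v * (u / B) = u * (1 / A - v * (1 / B))" for u v A B :: complex
      by (simp add: right_diff_distrib mult_ac)
    ultimately show ?thesis unfolding I_def by simp
  qed
  have "integral {0..pi} (I ?r (joukowski (of_real p * w))) - w\<^sup>2 * integral {0..pi} (I ?r (joukowski (w / of_real p)))
     = integral {0..pi} (\<lambda>\<phi>. I ?r (joukowski (of_real p * w)) \<phi> - w\<^sup>2 * I ?r (joukowski (w / of_real p)) \<phi>)"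
    using integral_diff[OF int[OF n1] integrable_on_mult_right[OF int[OF n2], of "w\<^sup>2"]] by simp
  also have "\<dots> = ((1 - w\<^sup>2) * (1 - t\<^sup>2)) * integral {0..pi} (I t (joukowski w))"
    unfolding e by (rule integral_mult_right)
  finally have main: "integral {0..pi} (I ?r (joukowski (of_real p * w))) - w\<^sup>2 * integral {0..pi} (I ?r (joukowski (w / of_real p)))
     = ((1 - w\<^sup>2) * (1 - t\<^sup>2)) * integral {0..pi} (I t (joukowski w))" .
  have "?r\<^sup>2 = of_real q * t\<^sup>2" using p by (simp add: power_mult_distrib flip: of_real_power)
  then have P: "mehler_op q ?r g x = qpoch (of_real q * t\<^sup>2) q * integral {0..pi} (I ?r x)" for x
    unfolding mehler_op_def I_def by simp
  have Pt: "mehler_op q t g (joukowski w) = (1 - t\<^sup>2) * qpoch (of_real q * t\<^sup>2) q * integral {0..pi} (I t (joukowski w))"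
    unfolding mehler_op_def I_def by (subst qpoch_rec[OF q]) simp
  have factor: "u * A - v * (u * B) = u * (A - v * B)" for u v A B :: complex
    by (simp add: right_diff_distrib mult_ac)
  show ?thesis unfolding P Pt factor main by (simp only: mult_ac)
qed

text \<open>Since \<open>q / p = p\<close>, removing the first factor of \<open>(c w / p; q)\<close>
  leaves \<open>(c p w; q)\<close>, while \<open>(c / (p w); q)\<close> is common to both
  sides.\<close>

lemma hsym_shift:
  fixes p :: real
  assumes p: "p > 0" "p\<^sup>2 = q" and w: "w \<noteq> 0"
  shows "(1 - c / of_real p * w) * hsym q c (joukowski (of_real p * w)) = hsym q (c / of_real p) (joukowski w)"
proof -
  have pw: "of_real p * w \<noteq> 0" using p w by simp
  have "of_real q * (c / of_real p * w) = c * (of_real p * w)"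
    using p by (simp add: power2_eq_square field_simps flip: of_real_mult)
  then have "qpoch (c / of_real p * w) q = (1 - c / of_real p * w) * qpoch (c * (of_real p * w)) q"
    by (subst qpoch_rec[OF q]) simp
  then show ?thesis unfolding hsym_joukowski[OF q pw] hsym_joukowski[OF q w] by (simp add: mult_ac)
qed

text \<open>Accounts for the polynomial factors in \<open>Bq\<close>: they bring \<open>h\<close> at
  both shifted points to the same value. The second identity is the first one at
  \<open>1 / w\<close>.\<close>

lemma hfun_shift:
  fixes p :: real
  assumes p: "p > 0" "p\<^sup>2 = q" and w: "w \<noteq> 0"
  shows "(1 - a / of_real p * w) * (1 - b / of_real p * w) * hfun q [a, b] (joukowski (of_real p * w)) =
      hfun q [a / of_real p, b / of_real p] (joukowski w)"
    and "(1 - a / of_real p / w) * (1 - b / of_real p / w) * hfun q [a, b] (joukowski (w / of_real p)) =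
      hfun q [a / of_real p, b / of_real p] (joukowski w)"
proof -
  have *: "(1 - a / of_real p * w) * (1 - b / of_real p * w) * hfun q [a, b] (joukowski (of_real p * w)) =
      hfun q [a / of_real p, b / of_real p] (joukowski w)" if "w \<noteq> 0" for w
    unfolding hfun_conv_hsym[OF q] hsym_shift[OF p that, symmetric] by (simp add: mult_ac)
  show "(1 - a / of_real p * w) * (1 - b / of_real p * w) * hfun q [a, b] (joukowski (of_real p * w)) =
      hfun q [a / of_real p, b / of_real p] (joukowski w)" by (rule *[OF w])
  have "joukowski (of_real p * (1 / w)) = joukowski (w / of_real p)"
    using joukowski_inverse[of "w / of_real p"] by simp
  then show "(1 - a / of_real p / w) * (1 - b / of_real p / w) * hfun q [a, b] (joukowski (w / of_real p)) =
      hfun q [a / of_real p, b / of_real p] (joukowski w)"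
    using *[of "1 / w"] w by (simp add: joukowski_inverse)
qed

lemma zpt_real: "x \<in> {-1<..<1} \<Longrightarrow> norm (zpt (of_real x)) = 1 \<and> (zpt (of_real x))\<^sup>2 \<noteq> 1"
proof -
  assume x: "x \<in> {-1<..<1}"
  have z: "zpt (of_real x) = cis (arccos x)" using x by (subst zpt_of_real) (auto simp: cis_conv_exp)
  have "zpt (of_real x) \<noteq> 1" "zpt (of_real x) \<noteq> - 1"
    using x arg_cong[OF joukowski_zpt[of "of_real x"], of Re] by (auto simp: joukowski_def)
  then show ?thesis by (simp add: z power2_eq_1_iff)
qed

section \<open>The operators \<open>Bq\<close> and their Askey-Wilson form\<close>

lemma q_powr_simps:
  fixes p :: real
  assumes p: "p > 0" "p\<^sup>2 = q"
  shows "q powr (1/2) = p" "q powr (-1/2) = 1 / p" "q powr (1/4) = sqrt p" "q powr (3/4) - q powr (-1/4) = - (1 - q) / sqrt p"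
proof -
  have p_powr: "q = p powr 2" using p by (simp add: powr_numeral)
  have e: "q powr u = p powr (2 * u)" for u unfolding p_powr powr_powr by simp
  show 1: "q powr (1/2) = p" "q powr (-1/2) = 1 / p" using p by (simp_all add: e powr_minus_divide)
  show 2: "q powr (1/4) = sqrt p" using p by (simp add: e powr_half_sqrt)
  have "q powr (3/4) = q * q powr (-1/4)" using q powr_add[of q 1 "-1/4"] by simp
  moreover have "q powr (-1/4) = 1 / sqrt p" using 2 by (simp add: powr_minus_divide)
  ultimately show "q powr (3/4) - q powr (-1/4) = - (1 - q) / sqrt p"
    by (simp only: times_divide_eq_right diff_divide_distrib[symmetric]) simp
qed

text \<open>By \<open>hfun_shift\<close> a common factor \<open>H\<close> leaves the bracket and
  cancels the denominator; what remains is \<open>mehler_op_raise\<close>. The constant in front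
  removes the \<open>2 q^(1/4) / (1 - q)\<close> left over from
  \<open>q^(3/4) - q^(-1/4)\<close>.\<close>

lemma Bq_hfun_mehler_op:
  fixes p :: real
  assumes p: "0 < p" "p < 1" "p\<^sup>2 = q" and g: "continuous_on {-1..1} g" and t: "norm t < 1"
    and x: "x \<in> {-1<..<1}" and nz: "hfun q [a / of_real p, b / of_real p] (of_real x) \<noteq> 0"
    and F: "\<And>y. y \<in> qellipse q \<Longrightarrow> F y = hfun q [a, b] y * mehler_op q (of_real p * t) g y"
  shows "of_real ((1 - q) / (2 * q powr (1/4))) * Bq q a b F (of_real x) = hfun q [a, b] (of_real x) * mehler_op q t g (of_real x)"
proof -
  define w where "w = zpt (of_real x)"
  have w: "norm w = 1" "w\<^sup>2 \<noteq> 1" "w \<noteq> 0" "joukowski w = of_real x" using zpt_real[OF x] by (auto simp: w_def)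
  note pw = q_powr_simps[OF p(1,3)]
  have "p \<le> 1 / p" using p mult_strict_mono'[of p 1 p 1] by (simp add: field_simps)
  then have ell: "joukowski (of_real p * w) \<in> qellipse q" "joukowski (w / of_real p) \<in> qellipse q"
    unfolding qellipse_def pw using w p by (auto intro!: imageI simp: norm_mult norm_divide)
  define H where "H = hfun q [a / of_real p, b / of_real p] (of_real x)"
  define h where "h = hfun q [a, b] (of_real x)"
  have h1: "(1 - a / of_real p * w) * (1 - b / of_real p * w) * F (joukowski (of_real p * w)) = H * mehler_op q (of_real p * t) g (joukowski (of_real p * w))"
    unfolding F[OF ell(1)] H_def w(4)[symmetric] hfun_shift(1)[OF p(1,3) w(3), symmetric] by simp
  have h2: "w\<^sup>2 * (1 - a / of_real p / w) * (1 - b / of_real p / w) * F (joukowski (w / of_real p)) = H * (w\<^sup>2 * mehler_op q (of_real p * t) g (joukowski (w / of_real p)))"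
    unfolding F[OF ell(2)] H_def w(4)[symmetric] hfun_shift(2)[OF p(1,3) w(3), symmetric] by simp
  have "Bq q a b F (of_real x) =
     h * ((1 - a / of_real p * w) * (1 - b / of_real p * w) * F (joukowski (of_real p * w))
        - w\<^sup>2 * (1 - a / of_real p / w) * (1 - b / of_real p / w) * F (joukowski (w / of_real p)))
      / (H * of_real (- (1 - q) / sqrt p) * (w\<^sup>2 - 1) / 2)"
    unfolding Bq_def Let_def w_def[symmetric] pw h_def H_def by simp
  also have "\<dots> = h * (H * ((1 - w\<^sup>2) * mehler_op q t g (of_real x))) / (H * of_real (- (1 - q) / sqrt p) * (w\<^sup>2 - 1) / 2)"
    unfolding h1 h2 right_diff_distrib[symmetric] mehler_op_raise[OF p g t w(1)] w(4) ..
  also have "\<dots> = h * mehler_op q t g (of_real x) * of_real (2 * sqrt p / (1 - q))"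
  proof -
    have "H \<noteq> 0" "w\<^sup>2 - 1 \<noteq> 0" "complex_of_real (sqrt p) \<noteq> 0" "1 - complex_of_real q \<noteq> 0"
      using nz w p q by (auto simp: H_def)
    then show ?thesis by (simp add: divide_simps) (simp add: algebra_simps)
  qed
  finally show ?thesis using p q unfolding pw h_def by simp
qed

text \<open>A zero forces \<open>norm c * q^k = 1\<close>, which at most one \<open>k\<close>
  satisfies, and then \<open>x = joukowski (c q^k)\<close>.\<close>

lemma finite_hsym_zeros: "finite {x \<in> {-1..1}. hsym q c (of_real x) = 0}"
proof -
  define K where "K = {k. norm c * q ^ k = 1}"
  have "inj (\<lambda>k. q ^ k)" using q by (auto simp: inj_on_def power_inject_exp')
  then have "finite ((\<lambda>k. q ^ k) -` {1 / norm c})" by (intro finite_vimageI) auto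
  moreover have "K \<subseteq> (\<lambda>k. q ^ k) -` {1 / norm c}"
    unfolding K_def by (auto simp: nonzero_eq_divide_eq mult.commute) (metis mult_zero_left nonzero_eq_divide_eq mult.commute zero_neq_one)
  ultimately have "finite K" by (rule rev_finite_subset)
  moreover have "{x \<in> {-1..1}. hsym q c (of_real x) = 0} \<subseteq> (\<lambda>k. Re (joukowski (c * of_real q ^ k))) ` K"
  proof
    fix x assume "x \<in> {x \<in> {-1..1}. hsym q c (of_real x) = 0}"
    then have x: "x \<in> {-1..1}" "hsym q c (of_real x) = 0" by auto
    define w where "w = cis (arccos x)"
    have w: "norm w = 1" "w \<noteq> 0" "joukowski w = of_real x"
      using of_real_eq_joukowski_cis[OF x(1)] by (auto simp: w_def)
    have "\<exists>k. c * w * of_real q ^ k = 1 \<or> c * (1 / w) * of_real q ^ k = 1"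
      using x(2) unfolding w(3)[symmetric] hsym_joukowski[OF q w(2)] by (auto simp: qpoch_eq_0_iff[OF q])
    then obtain v k where v: "v = w \<or> v = 1 / w" "c * v * of_real q ^ k = 1" by blast
    have v': "norm v = 1" "v \<noteq> 0" "joukowski v = of_real x"
      using v(1) w joukowski_inverse[of w] by (auto simp: norm_divide)
    have "c * of_real q ^ k = 1 / v" using v(2) v'(2) by (simp add: field_simps)
    then have "joukowski (c * of_real q ^ k) = of_real x" "norm c * q ^ k = 1"
      using v' joukowski_inverse[of v] arg_cong[OF v(2), of norm] q by (auto simp: norm_mult norm_power)
    then show "x \<in> (\<lambda>k. Re (joukowski (c * of_real q ^ k))) ` K"
      by (intro image_eqI[of _ _ k]) (auto simp: K_def)
  qed
  ultimately show ?thesis by (rule finite_surj)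
qed

text \<open>The numerator \<open>N\<close> of \<open>gfun\<close> is, up to a constant, a theta
  function: with \<open>S = q^(1/4)\<close> and \<open>P = q^(1/2)\<close>,
  \<open>N (P w) = N w / (S w)\<close> and \<open>N (w / P) = N w * w / S\<close>. The quotient of
  these multipliers is \<open>w^2\<close>, the source of the factor \<open>z^2\<close> in
  \<open>Bq\<close>.\<close>

lemma Bq_conv_AW:
  assumes h_nz: "hfun q [a, b] (of_real x) \<noteq> 0" and x: "x \<in> {-1<..<1}"
    and nz: "hfun q [of_real (q powr (-1/2)) * a, of_real (q powr (-1/2)) * b] (of_real x) \<noteq> 0"
  shows "Bq q a b F (of_real x) = 1 / gfun q a b (of_real x) * AW q (\<lambda>y. gfun q a b y * F y) (of_real x)"
proof -
  define p where "p = sqrt q"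
  define s where "s = sqrt p"
  have p: "0 < p" "p < 1" "p\<^sup>2 = q" using q by (auto simp: p_def)
  have s: "0 < s" "s < 1" "s\<^sup>2 = p" using p by (auto simp: s_def)
  define P where "P = complex_of_real p"
  define S where "S = complex_of_real s"
  have PS: "P \<noteq> 0" "S \<noteq> 0" "S\<^sup>2 = P" using p s by (auto simp: P_def S_def simp flip: of_real_power)
  note pw = q_powr_simps[OF p(1,3), folded s_def]
  define w where "w = zpt (of_real x)"
  have w: "norm w = 1" "w\<^sup>2 \<noteq> 1" "w \<noteq> 0" "joukowski w = of_real x" using zpt_real[OF x] by (auto simp: w_def)
  define N where "N = (\<lambda>z. qpoch (- S * z) p * qpoch (- S / z) p)"
  define h where "h = (\<lambda>y. hfun q [a, b] y)"
  have G: "gfun q a b (joukowski z) = N z / h (joukowski z)" if "z \<noteq> 0" for z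
    using zpt_cases[OF that] by (auto simp: gfun_def N_def h_def pw S_def mult.commute)
  have nS: "1 + S * w \<noteq> 0" "1 + S / w \<noteq> 0"
  proof -
    have "norm (S * w) < 1" "norm (S / w) < 1" using s w by (auto simp: S_def norm_mult norm_divide)
    then show "1 + S * w \<noteq> 0" "1 + S / w \<noteq> 0"
      by (metis add_eq_0_iff norm_minus_cancel norm_one less_irrefl)+
  qed
  have N0: "N w \<noteq> 0"
    using qpoch_nonzero[OF p(1,2), of "- S * w"] qpoch_nonzero[OF p(1,2), of "- S / w"] s(1,2) w
    by (simp add: N_def S_def norm_mult norm_divide)
  have r: "qpoch (- S * w) p = (1 + S * w) * qpoch (- S * (P * w)) p" "qpoch (- S / w) p = (1 + S / w) * qpoch (- S / (w / P)) p"
    using qpoch_rec[OF p(1,2), of "- S * w"] qpoch_rec[OF p(1,2), of "- S / w"] by (simp_all add: P_def mult_ac)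
  \<comment> \<open>As \<open>S^2 = P\<close>, the leading factors are \<open>1 + 1 / (S w)\<close>
    and \<open>1 + w / S\<close>; divided by \<open>1 + S w\<close> and \<open>1 + S / w\<close>
    from \<open>r\<close> they become monomials.\<close>
  have r2: "qpoch (- S / (P * w)) p = (1 + 1 / (S * w)) * qpoch (- S / w) p"
    "qpoch (- S * (w / P)) p = (1 + w / S) * qpoch (- S * w) p"
    using qpoch_rec[OF p(1,2), of "- S / (P * w)"] qpoch_rec[OF p(1,2), of "- S * (w / P)"] PS w
    unfolding P_def[symmetric] by (simp_all add: PS(3)[symmetric] power2_eq_square field_simps)
  have N1: "N (P * w) = N w / (S * w)"
    unfolding N_def r(1) r2(1) using nS PS w by (simp add: field_simps)
  have N2: "N (w / P) = N w * w / S"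
    unfolding N_def r(2) r2(2) using nS PS w by (simp add: field_simps)
  have Pw: "P * w \<noteq> 0" "w / P \<noteq> 0" using PS w by auto
  define H where "H = hfun q [a / P, b / P] (of_real x)"
  have H0: "H \<noteq> 0" using nz unfolding H_def pw P_def by simp
  have sh: "(1 - a / P * w) * (1 - b / P * w) * h (joukowski (P * w)) = H"
     "(1 - a / P / w) * (1 - b / P / w) * h (joukowski (w / P)) = H"
    unfolding h_def H_def w(4)[symmetric] P_def by (rule hfun_shift[OF p(1,3) w(3)])+
  then have hn: "h (joukowski (P * w)) \<noteq> 0" "h (joukowski (w / P)) \<noteq> 0" using H0 by auto
  define A where "A = F (joukowski (P * w)) / h (joukowski (P * w))"
  define B where "B = F (joukowski (w / P)) / h (joukowski (w / P))"
  have hx: "h (of_real x) \<noteq> 0" using h_nz by (simp add: h_def)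
  \<comment> \<open>The constant \<open>q^(3/4) - q^(-1/4)\<close> of \<open>Bq\<close> is
    \<open>q^(1/4)\<close> times the constant \<open>q^(1/2) - q^(-1/2)\<close> of
    \<open>AW\<close>.\<close>
  have c: "complex_of_real (- (1 - q) / s) = S * (P - 1 / P)"
  proof -
    have e: "- (1 - q) / s = s * (p - 1 / p)"
      using s p by (simp add: field_simps power2_eq_square)
    show ?thesis unfolding e P_def S_def by simp
  qed
  have "Bq q a b F (of_real x) =
     h (of_real x) * ((1 - a / P * w) * (1 - b / P * w) * F (joukowski (P * w))
        - w\<^sup>2 * (1 - a / P / w) * (1 - b / P / w) * F (joukowski (w / P)))
      / (H * (S * (P - 1 / P)) * (w\<^sup>2 - 1) / 2)"
    unfolding Bq_def Let_def w_def[symmetric] pw h_def H_def P_def c[symmetric, unfolded P_def] by simp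
  also have "(1 - a / P * w) * (1 - b / P * w) * F (joukowski (P * w)) = H * A"
    unfolding A_def sh(1)[symmetric] using hn by simp
  also have "w\<^sup>2 * (1 - a / P / w) * (1 - b / P / w) * F (joukowski (w / P)) = H * (w\<^sup>2 * B)"
    unfolding B_def sh(2)[symmetric] using hn by simp
  also have "h (of_real x) * (H * A - H * (w\<^sup>2 * B)) / (H * (S * (P - 1 / P)) * (w\<^sup>2 - 1) / 2) =
      h (of_real x) * (A - w\<^sup>2 * B) / ((S * (P - 1 / P)) * (w\<^sup>2 - 1) / 2)"
    using H0 by (simp add: right_diff_distrib[symmetric] mult.left_commute[of _ H] mult.assoc)
  finally have L: "Bq q a b F (of_real x) = h (of_real x) * (A - w\<^sup>2 * B) / ((S * (P - 1 / P)) * (w\<^sup>2 - 1) / 2)" .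
  have "AW q (\<lambda>y. gfun q a b y * F y) (of_real x) = (N (P * w) * A - N (w / P) * B) / ((P - 1 / P) * (w - 1 / w) / 2)"
    unfolding AW_def Let_def w_def[symmetric] pw
    using G[OF Pw(1)] G[OF Pw(2)] by (simp add: A_def B_def P_def)
  also have "\<dots> = N w * (A - w\<^sup>2 * B) / (S * (P - 1 / P) * (w\<^sup>2 - 1) / 2)"
  proof -
    have num: "N (P * w) * A - N (w / P) * B = N w * (A - w\<^sup>2 * B) / (S * w)"
      unfolding N1 N2 using w PS by (simp add: field_simps power2_eq_square)
    have den: "S * X * (w\<^sup>2 - 1) / 2 = (S * w) * (X * (w - 1 / w) / 2)" for X
      using w(3) by (simp add: field_simps power2_eq_square)
    show ?thesis unfolding num den by (simp only: divide_divide_eq_left)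
  qed
  finally have R: "AW q (\<lambda>y. gfun q a b y * F y) (of_real x) = N w * (A - w\<^sup>2 * B) / (S * (P - 1 / P) * (w\<^sup>2 - 1) / 2)" .
  show ?thesis unfolding L R using G[OF w(3)] N0 hx w(4) by simp
qed

end

theorem theorem7p1:
  fixes q :: real and a b :: complex
  assumes q: "0 < q" "q < 1"
    and h_nz: "\<forall>x\<in>{-1..1::real}. hfun q [a, b] (of_real x) \<noteq> 0"
  shows
    "\<comment> \<open>operators on \<open>C[-1,1]\<close>\<close>
     (\<forall>r\<in>{-1<..<1}. \<forall>f. continuous_on {-1..1} f \<longrightarrow> continuous_on {-1..1} (Tq q a b r f)) \<and>
     \<comment> \<open>(a)\<close>
     (\<forall>r\<in>{-1<..<1}. \<forall>s\<in>{-1<..<1}. \<forall>f. continuous_on {-1..1} f \<longrightarrow>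
       (\<forall>x\<in>{-1..1}. Tq q a b r (Tq q a b s f) x = Tq q a b (r * s) f x)) \<and>
     \<comment> \<open>(b)\<close>
     (\<forall>f. continuous_on {-1..1} f \<longrightarrow>
       uniform_limit {-1..1} (\<lambda>r. Tq q a b r f) f (at_left 1)) \<and>
     \<comment> \<open>(c)\<close>
     (\<forall>r\<in>{-1<..<1}. \<forall>n. eigenfunction (Tq q a b r) (of_real (r ^ n))
       (\<lambda>x. hfun q [a, b] (of_real x) * of_real (qHermite q n x))) \<and>
     (\<forall>r\<in>{-1<..<1}. r \<noteq> 0 \<longrightarrow> (\<forall>\<mu> f. eigenfunction (Tq q a b r) \<mu> f \<longrightarrow>
       (\<exists>n c. \<mu> = of_real (r ^ n) \<and>
          (\<forall>x\<in>{-1..1}. f x = c * (hfun q [a, b] (of_real x) * of_real (qHermite q n x)))))) \<and>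
     \<comment> \<open>(d), intertwining relation.  The constant is needed: \<open>Bq\<close> maps \<open>h H\<^sub>n\<close> to
        \<open>2 q\<^sup>1\<^sup>/\<^sup>4 / (1 - q) * q\<^sup>-\<^sup>n\<^sup>/\<^sup>2 h H\<^sub>n\<close>.  At the finitely many zeros of the denominator of \<open>Bq\<close>
        the relation holds in the sense of the limit.\<close>
     (\<forall>r. \<bar>r\<bar> < q powr (1/2) \<longrightarrow> (\<forall>f. continuous_on {-1..1} f \<longrightarrow>
       (\<exists>F. analytic_ext q (Tq q a b r f) F) \<and>
       (\<forall>F. analytic_ext q (Tq q a b r f) F \<longrightarrow>
          (\<forall>x\<in>{-1<..<1}.
             hfun q [of_real (q powr (-1/2)) * a, of_real (q powr (-1/2)) * b] (of_real x) \<noteq> 0 \<longrightarrow>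
             of_real ((1 - q) / (2 * q powr (1/4))) * Bq q a b F (of_real x) =
               Tq q a b (r * q powr (-1/2)) f x) \<and>
          (\<forall>x\<in>{-1..1}.
             ((\<lambda>y. of_real ((1 - q) / (2 * q powr (1/4))) * Bq q a b F (of_real y)) \<longlongrightarrow>
               Tq q a b (r * q powr (-1/2)) f x) (at x within {-1..1}))))) \<and>
     \<comment> \<open>(d), representation by the Askey--Wilson operator\<close>
     (\<forall>F. \<forall>x\<in>{-1<..<1::real}.
       hfun q [of_real (q powr (-1/2)) * a, of_real (q powr (-1/2)) * b] (of_real x) \<noteq> 0 \<longrightarrow>
       Bq q a b F (of_real x) =
         1 / gfun q a b (of_real x) * AW q (\<lambda>y. gfun q a b y * F y) (of_real x))"
proof -
  define h where "h = (\<lambda>x::real. hfun q [a, b] (of_real x))"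
  have h0: "h x \<noteq> 0" if "x \<in> {-1..1}" for x using h_nz that by (simp add: h_def)
  have ch: "continuous_on {-1..1} h"
    unfolding h_def hfun_conv_hsym[OF q] by (intro continuous_intros continuous_on_hsym[OF q])
  have cdiv: "continuous_on {-1..1} (\<lambda>x. f x / h x)" if "continuous_on {-1..1} f" for f
    using that ch h0 by (intro continuous_intros) auto
  have T: "Tq q a b r f x = h x * mehler_op q (of_real r) (\<lambda>y. f y / h y) (of_real x)" if "x \<in> {-1..1}" for r f x
    unfolding h_def by (rule Tq_conv_mehler_op[OF q that])
  have cT: "continuous_on {-1..1} (Tq q a b r f)" if "\<bar>r\<bar> < 1" "continuous_on {-1..1} f" for r f
  proof -
    have "continuous_on {-1..1} (\<lambda>x. h x * mehler_op q (of_real r) (\<lambda>y. f y / h y) (of_real x))"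
      using that by (intro continuous_intros ch continuous_on_mehler_op[OF q] cdiv) auto
    then show ?thesis by (subst continuous_on_cong[OF refl T])
  qed
  have semigroup: "Tq q a b r (Tq q a b s f) x = Tq q a b (r * s) f x"
    if "\<bar>r\<bar> < 1" "\<bar>s\<bar> < 1" "continuous_on {-1..1} f" "x \<in> {-1..1}" for r s f x
  proof -
    have "mehler_op q (of_real r) (\<lambda>y. Tq q a b s f y / h y) (of_real x) = mehler_op q (of_real r) (\<lambda>y. mehler_op q (of_real s) (\<lambda>y. f y / h y) (of_real y)) (of_real x)"
      by (rule mehler_op_cong) (simp add: T h0)
    then show ?thesis
      unfolding T[OF that(4)] using mehler_op_semigroup[OF q cdiv[OF that(3)] that(1,2,4)] by simp
  qed
  have identity: "uniform_limit {-1..1} (\<lambda>r. Tq q a b r f) f (at_left 1)" if f: "continuous_on {-1..1} f" for f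
  proof -
    have bdd: "bounded (k ` {-1..1})" if "continuous_on {-1..1} k" for k :: "real \<Rightarrow> complex"
      using that by (intro compact_imp_bounded compact_continuous_image) auto
    have "uniform_limit {-1..1} (\<lambda>r x. h x * mehler_op q (of_real r) (\<lambda>y. f y / h y) (of_real x)) (\<lambda>x. h x * (f x / h x)) (at_left 1)"
      by (intro uniform_lim_mult uniform_limit_const mehler_op_uniform_limit[OF q] cdiv f bdd ch)
    then show ?thesis by (subst (asm) uniform_limit_cong') (auto simp: T h0)
  qed
  have eigen: "eigenfunction (Tq q a b r) (of_real (r ^ n)) (\<lambda>x. h x * Herm q n x)" if r: "\<bar>r\<bar> < 1" for r n
    unfolding eigenfunction_def
  proof (intro conjI ballI)
    show "continuous_on {-1..1} (\<lambda>x. h x * Herm q n x)"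
      by (intro continuous_intros ch continuous_on_qHermite[OF q])
    show "\<exists>x\<in>{-1..1}. h x * Herm q n x \<noteq> 0"
      using qHermite_1_mono[OF q, of n] h0[of 1] by (intro bexI[of _ 1]) auto
    fix x :: real assume x: "x \<in> {-1..1}"
    have "mehler_op q (of_real r) (\<lambda>y. h y * Herm q n y / h y) (of_real x) = mehler_op q (of_real r) (Herm q n) (of_real x)"
      by (rule mehler_op_cong) (simp add: h0)
    then show "Tq q a b r (\<lambda>x. h x * Herm q n x) x = of_real (r ^ n) * (h x * Herm q n x)"
      using r x by (simp add: T mehler_op_Hermite[OF q])
  qed
  have eigen_unique: "\<exists>n c. \<mu> = of_real (r ^ n) \<and> (\<forall>x\<in>{-1..1}. f x = c * (h x * Herm q n x))"
    if r: "\<bar>r\<bar> < 1" "r \<noteq> 0" and f: "eigenfunction (Tq q a b r) \<mu> f" for r \<mu> f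
  proof -
    have cf: "continuous_on {-1..1} f" and nz: "\<exists>x\<in>{-1..1}. f x \<noteq> 0"
      and eq: "\<And>x. x \<in> {-1..1} \<Longrightarrow> Tq q a b r f x = \<mu> * f x"
      using f by (auto simp: eigenfunction_def)
    have "\<exists>n c. \<mu> = of_real (r ^ n) \<and> (\<forall>x\<in>{-1..1}. f x / h x = c * Herm q n x)"
    proof (rule mehler_op_eigenfunction[OF q cdiv[OF cf] _ r])
      show "\<exists>x\<in>{-1..1}. f x / h x \<noteq> 0" using nz h0 by auto
      show "mehler_op q (of_real r) (\<lambda>x. f x / h x) (of_real x) = \<mu> * (f x / h x)" if "x \<in> {-1..1}" for x
        using eq[OF that] h0[OF that] unfolding T[OF that] by (simp add: field_simps)
    qed
    then obtain n c where n: "\<mu> = of_real (r ^ n)" "\<And>x. x \<in> {-1..1} \<Longrightarrow> f x / h x = c * Herm q n x" by blast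
    have "f x = c * (h x * Herm q n x)" if "x \<in> {-1..1}" for x
      using n(2)[OF that] h0[OF that] by (simp add: field_simps)
    with n(1) show ?thesis by blast
  qed
  define p where "p = sqrt q"
  have p: "0 < p" "p < 1" "p\<^sup>2 = q" using q by (auto simp: p_def)
  note pw = q_powr_simps[OF q p(1,3)]
  have s: "complex_of_real (q powr (-1/2)) * c = c / of_real p" for c unfolding pw(2) by simp
  have intertwine: "(\<exists>F. analytic_ext q (Tq q a b r f) F) \<and>
      (\<forall>F. analytic_ext q (Tq q a b r f) F \<longrightarrow>
        (\<forall>x\<in>{-1<..<1}. hfun q [of_real (q powr (-1/2)) * a, of_real (q powr (-1/2)) * b] (of_real x) \<noteq> 0 \<longrightarrow>
           of_real ((1 - q) / (2 * q powr (1/4))) * Bq q a b F (of_real x) = Tq q a b (r * q powr (-1/2)) f x) \<and>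
        (\<forall>x\<in>{-1..1}. ((\<lambda>y. of_real ((1 - q) / (2 * q powr (1/4))) * Bq q a b F (of_real y)) \<longlongrightarrow>
               Tq q a b (r * q powr (-1/2)) f x) (at x within {-1..1})))"
    if r: "\<bar>r\<bar> < q powr (1/2)" and f: "continuous_on {-1..1} f" for r f
  proof -
    define g where "g = (\<lambda>y. f y / h y)"
    have g: "continuous_on {-1..1} g" unfolding g_def by (rule cdiv[OF f])
    \<comment> \<open>The bound on \<open>r\<close> says exactly \<open>|t| < 1\<close>, and
      \<open>r = p t\<close> is the form of the parameter that the raising relation takes to
      \<open>t\<close>.\<close>
    define t where "t = r * q powr (-1/2)"
    have t: "\<bar>t\<bar> < 1" "r = p * t" using r p(1) unfolding t_def pw(1,2) by (simp_all add: abs_mult)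
    have r1: "\<bar>r\<bar> < p" "\<bar>r\<bar> < 1" using r p(2) unfolding pw(1) by simp_all
    \<comment> \<open>An explicit continuation; by uniqueness every other one agrees with it on the
      ellipse, where \<open>Bq\<close> takes its values of \<open>F\<close>.\<close>
    define F0 where "F0 = (\<lambda>x. hfun q [a, b] x * mehler_op q (of_real r) g x)"
    have "qellipse q \<subseteq> {x. norm (complex_of_real r) * (norm (x - 1) + norm (x + 1)) < 1 + (norm (complex_of_real r))\<^sup>2}"
    proof
      fix x assume "x \<in> qellipse q"
      then obtain w where w: "x = joukowski w" "p \<le> norm w" "norm w \<le> 1 / p" unfolding qellipse_def pw(1,2) by blast
      have "w \<noteq> 0" using w p by auto
      have "\<bar>r\<bar> * norm w \<le> \<bar>r\<bar> * (1 / p)" using w by (intro mult_left_mono) auto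
      also have "\<dots> < 1" using r1 p by (simp add: field_simps)
      finally have "\<bar>r\<bar> * norm w < 1" .
      then show "x \<in> {x. norm (complex_of_real r) * (norm (x - 1) + norm (x + 1)) < 1 + (norm (complex_of_real r))\<^sup>2}"
        using ellipse_condition_iff[OF \<open>w \<noteq> 0\<close>, of "complex_of_real r"] r1 w by simp
    qed
    then have "mehler_op q (of_real r) g analytic_on qellipse q"
      using analytic_on_mehler_op[OF q g, of "of_real r"] r1 analytic_on_subset by auto
    then have F0: "analytic_ext q (Tq q a b r f) F0"
      unfolding analytic_ext_def F0_def
      by (intro conjI analytic_on_mult hfun_analytic[OF q]) (auto simp: T g_def h_def)
    define Z where "Z = {x \<in> {-1..1}. hfun q [of_real (q powr (-1/2)) * a, of_real (q powr (-1/2)) * b] (of_real x) = 0}"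
    have "Z \<subseteq> {x \<in> {-1..1}. hsym q (of_real (q powr (-1/2)) * a) (of_real x) = 0} \<union> {x \<in> {-1..1}. hsym q (of_real (q powr (-1/2)) * b) (of_real x) = 0}"
      unfolding Z_def hfun_conv_hsym[OF q] by auto
    then have finZ: "finite Z" by (rule finite_subset) (intro finite_UnI finite_hsym_zeros[OF q])
    have interior: "of_real ((1 - q) / (2 * q powr (1/4))) * Bq q a b F (of_real x) = Tq q a b (r * q powr (-1/2)) f x"
      if F: "analytic_ext q (Tq q a b r f) F" and x: "x \<in> {-1<..<1}"
        and nz: "hfun q [of_real (q powr (-1/2)) * a, of_real (q powr (-1/2)) * b] (of_real x) \<noteq> 0" for F x
    proof -
      have "of_real ((1 - q) / (2 * q powr (1/4))) * Bq q a b F (of_real x) = hfun q [a, b] (of_real x) * mehler_op q (of_real t) g (of_real x)"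
      proof (rule Bq_hfun_mehler_op[OF q p g _ x])
        show "hfun q [a / of_real p, b / of_real p] (of_real x) \<noteq> 0" using nz unfolding s .
        show "F y = hfun q [a, b] y * mehler_op q (of_real p * of_real t) g y" if "y \<in> qellipse q" for y
          using analytic_ext_unique[OF q F F0 that] t(2) by (simp add: F0_def)
      qed (use t in simp)
      also have "\<dots> = Tq q a b t f x" using x by (simp add: T g_def h_def)
      finally show ?thesis by (simp add: t_def)
    qed
    have limit: "((\<lambda>y. of_real ((1 - q) / (2 * q powr (1/4))) * Bq q a b F (of_real y)) \<longlongrightarrow>
               Tq q a b (r * q powr (-1/2)) f x) (at x within {-1..1})"
      if F: "analytic_ext q (Tq q a b r f) F" and x: "x \<in> {-1..1}" for F x
    proof (rule Lim_transform_eventually)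
      show "((\<lambda>y. Tq q a b (r * q powr (-1/2)) f y) \<longlongrightarrow> Tq q a b (r * q powr (-1/2)) f x) (at x within {-1..1})"
        using cT[OF t(1) f] x unfolding t_def continuous_on_def by blast
      \<comment> \<open>The endpoints join the exceptional set because \<open>z^2 = 1\<close> there
        makes the denominator of \<open>Bq\<close> zero. Off a finite set both sides agree, so the
        limit is that of a continuous function.\<close>
      have "\<not> x islimpt (Z \<union> {-1, 1})" using finZ by (intro islimpt_finite) auto
      then have "\<forall>\<^sub>F y in at x. y \<notin> Z \<union> {-1, 1}" by (simp add: islimpt_iff_eventually)
      then have "\<forall>\<^sub>F y in at x within {-1..1}. y \<notin> Z \<union> {-1, 1}" using at_le[of "{-1..1}" UNIV x] filter_leD by blast
      moreover have "\<forall>\<^sub>F y in at x within {-1..1}. y \<in> {-1..1}" by (simp add: eventually_at_filter)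
      ultimately show "\<forall>\<^sub>F y in at x within {-1..1}. Tq q a b (r * q powr (-1/2)) f y =
          of_real ((1 - q) / (2 * q powr (1/4))) * Bq q a b F (of_real y)"
      proof eventually_elim
        case (elim y)
        then have "y \<in> {-1<..<1}" by (auto simp: less_le)
        moreover have "hfun q [of_real (q powr (-1/2)) * a, of_real (q powr (-1/2)) * b] (of_real y) \<noteq> 0"
          using elim by (auto simp: Z_def)
        ultimately show ?case using interior[OF F] by simp
      qed
    qed
    from F0 interior limit show ?thesis by blast
  qed
  have AW: "Bq q a b F (of_real x) = 1 / gfun q a b (of_real x) * AW q (\<lambda>y. gfun q a b y * F y) (of_real x)"
    if "x \<in> {-1<..<1}" "hfun q [of_real (q powr (-1/2)) * a, of_real (q powr (-1/2)) * b] (of_real x) \<noteq> 0" for F x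
    using that h_nz by (intro Bq_conv_AW[OF q]) auto
  have r_iff: "r \<in> {-1<..<1} \<longleftrightarrow> \<bar>r\<bar> < 1" for r :: real by auto
  show ?thesis
  proof (intro conjI)
    show "\<forall>r\<in>{-1<..<1}. \<forall>f. continuous_on {-1..1} f \<longrightarrow> continuous_on {-1..1} (Tq q a b r f)"
      using cT r_iff by blast
    show "\<forall>r\<in>{-1<..<1}. \<forall>s\<in>{-1<..<1}. \<forall>f. continuous_on {-1..1} f \<longrightarrow>
       (\<forall>x\<in>{-1..1}. Tq q a b r (Tq q a b s f) x = Tq q a b (r * s) f x)"
      using semigroup r_iff by blast
    show "\<forall>f. continuous_on {-1..1} f \<longrightarrow> uniform_limit {-1..1} (\<lambda>r. Tq q a b r f) f (at_left 1)"
      using identity by blast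
    show "\<forall>r\<in>{-1<..<1}. \<forall>n. eigenfunction (Tq q a b r) (of_real (r ^ n))
       (\<lambda>x. hfun q [a, b] (of_real x) * of_real (qHermite q n x))"
      using eigen r_iff unfolding h_def by blast
    show "\<forall>r\<in>{-1<..<1}. r \<noteq> 0 \<longrightarrow> (\<forall>\<mu> f. eigenfunction (Tq q a b r) \<mu> f \<longrightarrow>
       (\<exists>n c. \<mu> = of_real (r ^ n) \<and>
          (\<forall>x\<in>{-1..1}. f x = c * (hfun q [a, b] (of_real x) * of_real (qHermite q n x)))))"
      using eigen_unique r_iff unfolding h_def by blast
  qed (use intertwine AW in blast)+
qed

end
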